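(* Let $1\le p\le q$ be integers, $d=p+q$, and let $\Sigma\in\mathbb{S}^d_{>}$ have upper left $p\times p$ diagonal block $\Sigma_1$ and lower right $q\times q$ diagonal block $\Sigma_2$. Assume that $\Sigma_1$ has $p$ distinct eigenvalues and $\Sigma_2$ has $q$ distinct eigenvalues. Let $H_t\in\mathbb{S}^d$ for $t>0$ and $H\in\mathbb{S}^d$ be such that $H_t\to H$ element-wise as $t\downarrow0$. Then $$\lim_{t\downarrow0}t^{-1}\bigl(\mathfrak{D}_1(\Sigma+tH_t)-\mathfrak{D}_1(\Sigma)\bigr)=\operatorname{tr}(M_1H)$$ with $$M_1=\frac{1}{2c_1}\Bigl(-\Sigma^{-1/2}+\bigl(1-\mathfrak{D}_1(\Sigma)\bigr)\Sigma_0^{-1/2}+\mathfrak{D}_1(\Sigma)\Upsilon_1\Bigr),$$ $$c_1=\operatorname{tr}(\Sigma_1^{1/2})+\operatorname{tr}(\Sigma_2^{1/2})-\operatorname{tr}(\Sigma_m^{1/2}),\qquad \Upsilon_1=\begin{bmatrix}U_1\Delta_1U_1^\top&0\\0&U_2\Delta_2U_2^\top\end{bmatrix},$$ where $\Sigma_0,\Sigma_m,U_1,U_2,\Delta_1,\Delta_2$ are as defined in the context.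
   Context: $\mathbb{S}^m$, $\mathbb{S}^m_\ge$, $\mathbb{S}^m_>$ are the sets of real symmetric, symmetric positive semi-definite and symmetric positive definite $m\times m$ matrices. Eigendecompositions: $\Sigma_j=U_j\Lambda_jU_j^\top$, $j\in\{1,2\}$, with $U_j$ orthogonal and $\Lambda_j$ diagonal containing the eigenvalues of $\Sigma_j$ in decreasing order. $\Sigma_0=\begin{bmatrix}\Sigma_1&0\\0&\Sigma_2\end{bmatrix}$. $\Sigma_m=\begin{bmatrix}\Sigma_1&\Psi_m\\ \Psi_m^\top&\Sigma_2\end{bmatrix}$ with $\Psi_m=U_1\Lambda_1^{1/2}\Pi\Lambda_2^{1/2}U_2^\top$, where $\Pi\in\mathbb{R}^{p\times q}$ is the $p\times q$ upper left block of $I_d$. Since $q\ge p$, partition $\Lambda_2=\begin{bmatrix}\Lambda_{2,1}&0\\0&\Lambda_{2,2}\end{bmatrix}$ with $\Lambda_{2,1}$ of size $p\times p$ (first $p$ eigenvalues) and $\Lambda_{2,2}$ of size $(q-p)\times(q-p)$ (empty if $q=p$). Put $\Delta_1=(\Lambda_1+\Lambda_{2,1})^{-1/2}$ and $\Delta_2=\begin{bmatrix}\Delta_1&0\\0&\Lambda_{2,2}^{-1/2}\end{bmatrix}$. The coefficient $\mathfrak{D}_1$: let $d_W^2(A,B)=\operatorname{tr}(A)+\operatorname{tr}(B)-2\operatorname{tr}\bigl((A^{1/2}BA^{1/2})^{1/2}\bigr)$ for positive semi-definite $A,B$ of the same size, and let $\Gamma(\Sigma_1,\Sigma_2)$ be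 the set of all matrices in $\mathbb{S}^d_\ge$ with diagonal blocks $\Sigma_1$ ($p\times p$) and $\Sigma_2$ ($q\times q$). For $\Sigma\in\mathbb{S}^d_\ge$ with non-zero diagonal blocks $\Sigma_1$ and $\Sigma_2$, $$\mathfrak{D}_1(\Sigma)=\frac{d_W^2(\Sigma,I_d)-d_W^2(\Sigma_1,I_p)-d_W^2(\Sigma_2,I_q)}{\sup_{\tilde\Sigma\in\Gamma(\Sigma_1,\Sigma_2)}d_W^2(\tilde\Sigma,I_d)-d_W^2(\Sigma_1,I_p)-d_W^2(\Sigma_2,I_q)}.$$ For $t>0$ sufficiently small, $\Sigma+tH_t$ is positive definite, so $\mathfrak{D}_1(\Sigma+tH_t)$ is well defined. *)

theory Defs
  imports
    "Jordan_Normal_Form.Spectral_Radius"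
    "Jordan_Normal_Form.Gauss_Jordan_Elimination"
begin

definition sym_mats :: "nat \<Rightarrow> real mat set" where
  "sym_mats n = {A \<in> carrier_mat n n. transpose_mat A = A}"

definition psd_mats :: "nat \<Rightarrow> real mat set" where
  "psd_mats n = {A \<in> sym_mats n. \<forall>v \<in> carrier_vec n. 0 \<le> v \<bullet> (A *\<^sub>v v)}"

definition pd_mats :: "nat \<Rightarrow> real mat set" where
  "pd_mats n = {A \<in> sym_mats n. \<forall>v \<in> carrier_vec n. v \<noteq> 0\<^sub>v n \<longrightarrow> 0 < v \<bullet> (A *\<^sub>v v)}"

definition mat_trace :: "real mat \<Rightarrow> real" where
  "mat_trace A = (\<Sum>i<dim_row A. A $$ (i, i))"

(* The unique positive semi-definite square root; meaningful only for positive semi-definite A. *)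
definition mat_sqrt :: "real mat \<Rightarrow> real mat" where
  "mat_sqrt A = (THE B. B \<in> psd_mats (dim_row A) \<and> B * B = A)"

(* A^(-1/2); meaningful only for positive definite A. *)
definition mat_inv_sqrt :: "real mat \<Rightarrow> real mat" where
  "mat_inv_sqrt A = the (mat_inverse (mat_sqrt A))"

(* The upper left r x c block, and the lower right block that remains after removing
   the first r rows and c columns. *)
definition ul_block :: "nat \<Rightarrow> nat \<Rightarrow> real mat \<Rightarrow> real mat" where
  "ul_block r c A = (case split_block A r c of (A1, A2, A3, A4) \<Rightarrow> A1)"

definition lr_block :: "nat \<Rightarrow> nat \<Rightarrow> real mat \<Rightarrow> real mat" where
  "lr_block r c A = (case split_block A r c of (A1, A2, A3, A4) \<Rightarrow> A4)"

(* The library predicate orthogonal_mat only asks for pairwise orthogonal non-zero columns,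
   so orthogonality in the usual sense is spelled out here. *)
definition eigendecomposition :: "nat \<Rightarrow> real mat \<Rightarrow> real mat \<Rightarrow> real mat \<Rightarrow> bool" where
  "eigendecomposition n A U L \<longleftrightarrow>
     U \<in> carrier_mat n n \<and> U * transpose_mat U = 1\<^sub>m n \<and> transpose_mat U * U = 1\<^sub>m n \<and>
     L \<in> carrier_mat n n \<and> diagonal_mat L \<and>
     (\<forall>i j. i \<le> j \<and> j < n \<longrightarrow> L $$ (j, j) \<le> L $$ (i, i)) \<and>
     A = U * L * transpose_mat U"

(* The squared Bures-Wasserstein distance. *)
definition dW2 :: "real mat \<Rightarrow> real mat \<Rightarrow> real" where
  "dW2 A B = mat_trace A + mat_trace B - 2 * mat_trace (mat_sqrt (mat_sqrt A * B * mat_sqrt A))"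

definition Gamma_set :: "nat \<Rightarrow> nat \<Rightarrow> real mat \<Rightarrow> real mat \<Rightarrow> real mat set" where
  "Gamma_set p q S1 S2 = {S \<in> psd_mats (p + q). ul_block p p S = S1 \<and> lr_block p p S = S2}"

definition D1 :: "nat \<Rightarrow> nat \<Rightarrow> real mat \<Rightarrow> real" where
  "D1 p q S =
     (let S1 = ul_block p p S; S2 = lr_block p p S in
       (dW2 S (1\<^sub>m (p + q)) - dW2 S1 (1\<^sub>m p) - dW2 S2 (1\<^sub>m q)) /
       ((SUP S' \<in> Gamma_set p q S1 S2. dW2 S' (1\<^sub>m (p + q))) - dW2 S1 (1\<^sub>m p) - dW2 S2 (1\<^sub>m q)))"

end

theory Submission
  imports Defs
begin

text \<open>
  Write \<open>F(A)\<close> for the trace of the square root of \<open>A\<close>. The squared distance of \<open>A\<close> to the identity is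
  \<open>tr A + n - 2 F(A)\<close>, and all couplings of \<open>\<Sigma>\<^sub>1\<close> and \<open>\<Sigma>\<^sub>2\<close> have the same trace. Traces and dimensions
  therefore cancel in the coefficient, which becomes
  \<open>(F(\<Sigma>\<^sub>1) + F(\<Sigma>\<^sub>2) - F(\<Sigma>)) / (F(\<Sigma>\<^sub>1) + F(\<Sigma>\<^sub>2) - G)\<close>, where \<open>G\<close> is the smallest value of \<open>F\<close> over all
  couplings (\<open>D1_eq_trace_sqrt_quotient\<close>). The theorem is the quotient rule, once \<open>F\<close> and \<open>G\<close> are
  differentiated in the direction \<open>H\<close>.

  The derivative of \<open>F\<close> at a positive definite \<open>A\<close> is \<open>tr (A\<^sup>-\<^sup>1\<^sup>/\<^sup>2 H) / 2\<close> (\<open>trace_sqrt_derivative\<close>). With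
  \<open>R\<close> and \<open>R + E\<close> the roots of \<open>A\<close> and of the perturbed matrix, the perturbation is \<open>R E + E R + E\<^sup>2\<close>;
  multiplying by \<open>R\<^sup>-\<^sup>1\<close> and taking traces isolates \<open>2 tr E\<close>, and \<open>E\<close> is of order \<open>t\<close> because the root
  is Lipschitz near \<open>A\<close>.

  The minimum \<open>G\<close> has a closed form: if \<open>\<lambda>\<close> and \<open>\<mu>\<close> are the decreasing eigenvalues of the two blocks,
  continued by zeros, then \<open>G\<close> is the sum of \<open>sqrt (\<lambda>\<^sub>i + \<mu>\<^sub>i)\<close>. A coupling is \<open>A1\<^sup>T A1 + A2\<^sup>T A2\<close>, where
  \<open>A1\<close> and \<open>A2\<close> are the row blocks of its root and the summands have the nonzero eigenvalues \<open>\<lambda>\<close> and \<open>\<mu>\<close>.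
  Ky Fan's inequality shows that its spectrum is majorized by \<open>\<lambda> + \<mu>\<close>, and a sum of square roots, being
  concave, only increases on passing to the majorized sequence (\<open>trace_sqrt_block_lower_bound\<close>). The
  matrix \<open>\<Sigma>\<^sub>m\<close> attains the bound (\<open>comonotone_coupling\<close>).

  So \<open>G\<close> depends on the blocks only through their eigenvalues. These are simple, hence differentiable with
  derivative \<open>u\<^sup>T H u\<close> for the unit eigenvector \<open>u\<close> (\<open>simple_eigenvalue_derivative\<close>). The chain rule gives the
  derivative \<open>tr (\<Upsilon>\<^sub>1 H) / 2\<close> of \<open>G\<close>.

  Everything rests on the spectral theorem for real symmetric matrices (\<open>spectral_theorem\<close>) and on
  the uniqueness of positive semi-definite square roots (\<open>psd_square_root_unique\<close>).
\<close>

section \<open>Traces and quadratic forms as sums\<close>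

lemma index_mult_sum:
  assumes "A \<in> carrier_mat n m" "B \<in> carrier_mat m k" "i < n" "j < k"
  shows "(A * B) $$ (i,j) = (\<Sum>l<m. A $$ (i,l) * B $$ (l,j))"
  using assms by (auto simp: scalar_prod_def lessThan_atLeast0 intro!: sum.cong)

lemma index_mult_mat_vec_sum:
  assumes "A \<in> carrier_mat n m" "v \<in> carrier_vec m" "i < n"
  shows "(A *\<^sub>v v) $ i = (\<Sum>l<m. A $$ (i,l) * v $ l)"
  using assms by (auto simp: scalar_prod_def lessThan_atLeast0 intro!: sum.cong)

lemma quadratic_form_sum:
  assumes "A \<in> carrier_mat n n" "v \<in> carrier_vec n"
  shows "v \<bullet> (A *\<^sub>v v) = (\<Sum>i<n. \<Sum>j<n. v $ i * A $$ (i,j) * v $ j)"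
proof -
  have "v \<bullet> (A *\<^sub>v v) = (\<Sum>i<n. v $ i * (A *\<^sub>v v) $ i)"
    using assms by (simp add: scalar_prod_def lessThan_atLeast0)
  also have "\<dots> = (\<Sum>i<n. \<Sum>j<n. v $ i * A $$ (i,j) * v $ j)"
    by (rule sum.cong[OF refl]) (simp add: index_mult_mat_vec_sum[OF assms] sum_distrib_left mult.assoc)
  finally show ?thesis .
qed

lemma mat_trace_sum: "A \<in> carrier_mat n m \<Longrightarrow> mat_trace A = (\<Sum>i<n. A $$ (i,i))"
  by (auto simp: mat_trace_def)

lemma mat_trace_mult:
  assumes "A \<in> carrier_mat n m" "B \<in> carrier_mat m n"
  shows "mat_trace (A * B) = (\<Sum>i<n. \<Sum>j<m. A $$ (i,j) * B $$ (j,i))"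
proof -
  have "A * B \<in> carrier_mat n n" using assms by auto
  thus ?thesis unfolding mat_trace_sum[OF \<open>A * B \<in> carrier_mat n n\<close>]
    by (intro sum.cong refl) (simp add: index_mult_sum[OF assms])
qed

lemma mat_trace_mult_comm:
  assumes "A \<in> carrier_mat n m" "B \<in> carrier_mat m n"
  shows "mat_trace (A * B) = mat_trace (B * A)"
  unfolding mat_trace_mult[OF assms] mat_trace_mult[OF assms(2,1)]
  by (subst sum.swap) (simp add: mult.commute)

lemma mat_trace_add:
  assumes "A \<in> carrier_mat n n" "B \<in> carrier_mat n n"
  shows "mat_trace (A + B) = mat_trace A + mat_trace B"
  using assms by (auto simp: mat_trace_def sum.distrib)

lemma mat_trace_minus:
  assumes "A \<in> carrier_mat n n" "B \<in> carrier_mat n n"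
  shows "mat_trace (A - B) = mat_trace A - mat_trace B"
  using assms by (auto simp: mat_trace_def sum_subtractf)

lemma mat_trace_smult:
  assumes "A \<in> carrier_mat n n"
  shows "mat_trace (c \<cdot>\<^sub>m A) = c * mat_trace A"
  using assms by (auto simp: mat_trace_def sum_distrib_left)

lemma mat_trace_one: "mat_trace (1\<^sub>m n) = n"
  by (auto simp: mat_trace_def)

section \<open>The spectral theorem for real symmetric matrices\<close>

text \<open>
  Over the complex numbers an eigenvector \<open>v\<close> exists. For symmetric real \<open>A\<close> both
  \<open>v\<^sup>* A v\<close> and \<open>v\<^sup>* v\<close> are invariant under conjugation, so the eigenvalue, their quotient, is real
  and hence also a root of the real characteristic polynomial.
\<close>
lemma symmetric_real_eigenvalue_exists:
  fixes A :: "real mat"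
  assumes A: "A \<in> sym_mats n" and n: "n > 0"
  shows "\<exists>k. eigenvalue A k"
proof -
  define C where "C = map_mat complex_of_real A"
  have Ac: "A \<in> carrier_mat n n" and At: "transpose_mat A = A" using A by (auto simp: sym_mats_def)
  have Asym: "A $$ (i,j) = A $$ (j,i)" if "i < n" "j < n" for i j
    using that Ac by (subst At[symmetric]) auto
  have Cc: "C \<in> carrier_mat n n" using Ac by (auto simp: C_def)
  obtain z where z: "eigenvalue C z" using spectrum_non_empty[OF Cc n] by (auto simp: spectrum_def)
  then obtain v where v: "v \<in> carrier_vec n" "v \<noteq> 0\<^sub>v n" "C *\<^sub>v v = z \<cdot>\<^sub>v v"
    using Cc by (auto simp: eigenvalue_def eigenvector_def)
  define N where "N = (\<Sum>i<n. cnj (v $ i) * v $ i)"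
  define s where "s = (\<Sum>i<n. \<Sum>j<n. cnj (v $ i) * C $$ (i,j) * v $ j)"
  have "s = (\<Sum>i<n. cnj (v $ i) * (C *\<^sub>v v) $ i)"
    unfolding s_def by (intro sum.cong refl)
      (simp add: index_mult_mat_vec_sum[OF Cc v(1)] sum_distrib_left mult.assoc)
  also have "\<dots> = z * N" using v by (simp add: N_def sum_distrib_left mult_ac)
  finally have sz: "s = z * N" .
  have "cnj s = (\<Sum>i<n. \<Sum>j<n. v $ i * C $$ (i,j) * cnj (v $ j))"
    unfolding s_def using Ac by (auto simp: C_def intro!: sum.cong)
  also have "\<dots> = s" unfolding s_def
    by (subst sum.swap) (use Ac Asym in \<open>auto simp: C_def mult_ac intro!: sum.cong\<close>)
  finally have cs: "cnj s = s" .
  have N: "N = of_real (\<Sum>i<n. (cmod (v $ i))\<^sup>2)"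
    unfolding N_def by (simp add: complex_norm_square mult.commute del: of_real_power)
  obtain i where i: "i < n" "v $ i \<noteq> 0" using v(1,2) by (metis carrier_vecD eq_vecI index_zero_vec)
  have "(\<Sum>i<n. (cmod (v $ i))\<^sup>2) > 0" by (rule sum_pos2[of _ i]) (use i in auto)
  hence "N \<noteq> 0" "cnj N = N" using N by (auto simp del: of_real_sum)
  with sz cs have "cnj z = z" by auto
  then obtain x where x: "z = of_real x" by (metis Reals_cnj_iff Reals_cases)
  have "poly (char_poly C) z = 0" using z eigenvalue_root_char_poly[OF Cc] by auto
  hence "poly (char_poly A) x = 0"
    unfolding C_def x of_real_hom.char_poly_hom[OF Ac] by simp
  thus ?thesis using eigenvalue_root_char_poly[OF Ac] by auto
qed

text \<open>
  A unit vector is completed to an orthogonal matrix by the reflection that exchanges it with the first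
  basis vector.
\<close>
lemma householder_reflection:
  fixes u :: "real vec"
  assumes u: "u \<in> carrier_vec n" and n: "n > 0" and u1: "(\<Sum>i<n. (u $ i)\<^sup>2) = 1"
  obtains Q where "Q \<in> carrier_mat n n" "transpose_mat Q = Q" "Q * Q = 1\<^sub>m n"
    "\<And>i. i < n \<Longrightarrow> Q $$ (i,0) = u $ i"
proof -
  define w where "w i = u $ i - (if i = 0 then 1 else 0)" for i
  define s where "s = (\<Sum>i<n. (w i)\<^sup>2)"
  define c where "c = 2 / s"
  define Q where "Q = mat n n (\<lambda>(i,j). (if i = j then 1 else 0) - c * w i * w j)"
  have Q: "Q \<in> carrier_mat n n" by (simp add: Q_def)
  have Qs: "transpose_mat Q = Q" by (rule eq_matI) (auto simp: Q_def)
  have s: "s = 2 - 2 * u $ 0"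
  proof -
    have "s = (\<Sum>i<n. (u $ i)\<^sup>2 + (if i = 0 then 1 - 2 * u $ 0 else 0))"
      unfolding s_def by (intro sum.cong refl) (auto simp: w_def power2_eq_square algebra_simps)
    also have "\<dots> = 2 - 2 * u $ 0" using n u1 by (simp add: sum.distrib)
    finally show ?thesis .
  qed
  \<comment> \<open>If \<open>u\<close> is the first basis vector, then \<open>s = 0\<close>; division by zero gives \<open>c = 0\<close>, and \<open>Q\<close> is the identity.\<close>
  have cs: "c * c * s = 2 * c" by (simp add: c_def)
  have "Q * Q = 1\<^sub>m n"
  proof (rule eq_matI)
    fix i j assume "i < dim_row (1\<^sub>m n)" "j < dim_col (1\<^sub>m n)"
    hence ij: "i < n" "j < n" by auto
    have "(Q * Q) $$ (i,j) = (\<Sum>k<n. Q $$ (i,k) * Q $$ (k,j))"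
      by (rule index_mult_sum[OF Q Q ij])
    also have "\<dots> = (\<Sum>k<n. (if k = i then (if i = j then 1 else 0) - c * w i * w j else 0)
        - (if k = j then c * w i * w j else 0) + c * c * w i * w j * (w k)\<^sup>2)"
      by (intro sum.cong refl) (use ij in \<open>auto simp: Q_def power2_eq_square algebra_simps\<close>)
    also have "\<dots> = (if i = j then 1 else 0) - 2 * c * w i * w j + c * c * w i * w j * s"
      using ij by (simp add: sum.distrib sum_subtractf s_def sum_distrib_left)
    also have "c * c * w i * w j * s = (c * c * s) * (w i * w j)" by simp
    finally show "(Q * Q) $$ (i,j) = 1\<^sub>m n $$ (i,j)" using ij by (simp add: cs)
  qed (use Q in auto)
  moreover have "Q $$ (i,0) = u $ i" if i: "i < n" for i
  proof (cases "s = 0")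
    case True
    hence "w i = 0" using i by (auto simp: s_def sum_nonneg_eq_0_iff)
    thus ?thesis using i n by (auto simp: Q_def w_def split: if_splits)
  next
    case False
    hence "c * w 0 = -1" using s by (simp add: c_def w_def field_simps)
    hence "c * w i * w 0 = - w i" by (metis mult.assoc mult.commute mult_minus1)
    thus ?thesis using i n by (auto simp: Q_def w_def split: if_splits)
  qed
  ultimately show ?thesis using that Q Qs by blast
qed

lemma diagonal_mat_diag:
  assumes "L \<in> carrier_mat n n" "diagonal_mat L"
  shows "L = mat_diag n (\<lambda>i. L $$ (i,i))"
  using assms by (intro eq_matI) (auto simp: mat_diag_def diagonal_mat_def)

text \<open>
  The matrices \<open>A\<close> and \<open>L\<close> are similar, and the characteristic polynomial of a triangular matrix
  is read off its diagonal.
\<close>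
lemma spectrum_eigendecomposition:
  fixes A U L :: "real mat"
  assumes U: "U \<in> carrier_mat n n" "U * transpose_mat U = 1\<^sub>m n" "transpose_mat U * U = 1\<^sub>m n"
    and L: "L \<in> carrier_mat n n" "diagonal_mat L" and A: "A = U * L * transpose_mat U"
  shows "spectrum A = (\<lambda>i. L $$ (i,i)) ` {..<n}"
proof -
  have Ut: "transpose_mat U \<in> carrier_mat n n" using U by simp
  have Ac: "A \<in> carrier_mat n n" using A U L by auto
  have LU: "L = transpose_mat U * A * U"
  proof -
    have "transpose_mat U * A * U = (transpose_mat U * U) * L * (transpose_mat U * U)"
      unfolding A using U(1) L(1) Ut by (simp add: assoc_mult_mat[of _ n n _ n _ n])
    thus ?thesis using L U by simp
  qed
  have "similar_mat A L"
    by (rule similar_matI[of _ _ U "transpose_mat U" n]) (use U Ut L Ac A in auto)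
  hence cp: "char_poly A = char_poly L" by (rule char_poly_similar)
  have ut: "upper_triangular L"
    using L by (auto simp: diagonal_mat_def upper_triangular_def)
  have "spectrum A = {k. poly (char_poly L) k = 0}"
    using spectrum_root_char_poly[OF Ac] cp by simp
  also have "\<dots> = set (diag_mat L)"
    unfolding char_poly_upper_triangular[OF L(1) ut] poly_prod_list by (auto simp: prod_list_zero_iff)
  also have "\<dots> = (\<lambda>i. L $$ (i,i)) ` {..<n}" using L by (auto simp: diag_mat_def)
  finally show ?thesis .
qed

text \<open>
  Induction on the dimension. A reflection moves an eigenvector to the first basis vector; symmetry then
  clears the first row along with the first column, which leaves a smaller symmetric matrix. Taking the
  eigenvector to the largest eigenvalue in each step makes the diagonal decrease.
\<close>
theorem spectral_theorem:
  assumes "A \<in> sym_mats n"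
  shows "\<exists>U L. eigendecomposition n A U L"
  using assms
proof (induction n arbitrary: A)
  case 0
  hence "A = 1\<^sub>m 0 * 1\<^sub>m 0 * transpose_mat (1\<^sub>m 0)"
    by (intro eq_matI) (auto simp: sym_mats_def)
  thus ?case unfolding eigendecomposition_def
    by (intro exI[of _ "1\<^sub>m 0"]) (auto simp: diagonal_mat_def)
next
  case (Suc n)
  let ?N = "Suc n"
  have A: "A \<in> carrier_mat ?N ?N" and At: "transpose_mat A = A" using Suc.prems by (auto simp: sym_mats_def)
  define k where "k = Max (spectrum A)"
  have fin: "finite (spectrum A)" by (rule card_finite_spectrum[OF A])
  have "spectrum A \<noteq> {}"
    using symmetric_real_eigenvalue_exists[OF Suc.prems] by (auto simp: spectrum_def)
  hence "k \<in> spectrum A" unfolding k_def using fin by simp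
  then obtain v where v: "v \<in> carrier_vec ?N" "v \<noteq> 0\<^sub>v ?N" "A *\<^sub>v v = k \<cdot>\<^sub>v v"
    using A by (auto simp: spectrum_def eigenvalue_def eigenvector_def)
  define s where "s = (\<Sum>i<?N. (v $ i)\<^sup>2)"
  obtain i where i: "i < ?N" "v $ i \<noteq> 0" using v(1,2) by (metis carrier_vecD eq_vecI index_zero_vec)
  have s: "s > 0" unfolding s_def by (rule sum_pos2[of _ i]) (use i in auto)
  define u where "u = (1 / sqrt s) \<cdot>\<^sub>v v"
  have u: "u \<in> carrier_vec ?N" using v by (simp add: u_def)
  have Au: "A *\<^sub>v u = k \<cdot>\<^sub>v u"
    unfolding u_def using A v by (simp add: mult_mat_vec smult_smult_assoc mult.commute)
  have "(\<Sum>i<?N. (u $ i)\<^sup>2) = (\<Sum>i<?N. (v $ i)\<^sup>2 / s)"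
    using v s by (intro sum.cong refl) (simp add: u_def power_divide)
  also have "\<dots> = 1" using s by (simp add: sum_divide_distrib[symmetric] s_def)
  finally obtain Q where Q: "Q \<in> carrier_mat ?N ?N" "transpose_mat Q = Q" "Q * Q = 1\<^sub>m ?N"
    "\<And>i. i < ?N \<Longrightarrow> Q $$ (i,0) = u $ i"
    using householder_reflection[OF u] by blast
  define B where "B = Q * A * Q"
  have B: "B \<in> carrier_mat ?N ?N" using Q A by (simp add: B_def)
  have Bt: "transpose_mat B = B"
    unfolding B_def using Q A At by (simp add: transpose_mult[of _ ?N ?N _ ?N] assoc_mult_mat[of _ ?N ?N _ ?N _ ?N])
  have Bsym: "B $$ (i,j) = B $$ (j,i)" if "i < ?N" "j < ?N" for i j
    using that B by (subst Bt[symmetric]) auto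
  have AQ: "(A * Q) $$ (i,0) = k * Q $$ (i,0)" if "i < ?N" for i
  proof -
    have "(A * Q) $$ (i,0) = (A *\<^sub>v u) $ i"
      using that by (simp add: index_mult_sum[OF A Q(1)] index_mult_mat_vec_sum[OF A u] Q(4) del: sum.lessThan_Suc)
    thus ?thesis using that u by (simp add: Au Q(4))
  qed
  have B0: "B $$ (i,0) = (if i = 0 then k else 0)" if i: "i < ?N" for i
  proof -
    have "B = Q * (A * Q)" using Q A by (simp add: B_def assoc_mult_mat[of _ ?N ?N _ ?N _ ?N])
    hence "B $$ (i,0) = (\<Sum>l<?N. Q $$ (i,l) * (A * Q) $$ (l,0))"
      using index_mult_sum[OF Q(1) _ i, of "A * Q" ?N 0] A Q(1) by simp
    also have "\<dots> = k * (\<Sum>l<?N. Q $$ (i,l) * Q $$ (l,0))"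
      by (subst sum_distrib_left, intro sum.cong refl) (simp add: AQ)
    also have "\<dots> = k * (Q * Q) $$ (i,0)" using index_mult_sum[OF Q(1) Q(1) i, of 0] by simp
    finally show ?thesis using i by (simp add: Q(3))
  qed
  define A' where "A' = mat n n (\<lambda>(i,j). B $$ (Suc i, Suc j))"
  have A': "A' \<in> carrier_mat n n" "A' \<in> sym_mats n"
    using Bsym by (auto simp: A'_def sym_mats_def intro!: eq_matI)
  have BB: "B = four_block_mat (mat 1 1 (\<lambda>_. k)) (0\<^sub>m 1 n) (0\<^sub>m n 1) A'"
    by (rule eq_matI) (use B B0 Bsym in \<open>auto simp: A'_def\<close>)
  obtain U' L' where UL': "eigendecomposition n A' U' L'" using Suc.IH[OF A'(2)] by blast
  hence U': "U' \<in> carrier_mat n n" "U' * transpose_mat U' = 1\<^sub>m n" "transpose_mat U' * U' = 1\<^sub>m n"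
    and L': "L' \<in> carrier_mat n n" "diagonal_mat L'" "\<And>i j. i \<le> j \<Longrightarrow> j < n \<Longrightarrow> L' $$ (j,j) \<le> L' $$ (i,i)"
    and A'_eq: "A' = U' * L' * transpose_mat U'"
    unfolding eigendecomposition_def by blast+
  define V where "V = four_block_mat (1\<^sub>m 1) (0\<^sub>m 1 n) (0\<^sub>m n 1) U'"
  define L where "L = four_block_mat (mat 1 1 (\<lambda>_. k)) (0\<^sub>m 1 n) (0\<^sub>m n 1) L'"
  have V: "V \<in> carrier_mat ?N ?N" and L: "L \<in> carrier_mat ?N ?N"
    unfolding V_def L_def using U'(1) L'(1) by (auto intro!: carrier_matI)
  have Vt: "transpose_mat V = four_block_mat (1\<^sub>m 1) (0\<^sub>m 1 n) (0\<^sub>m n 1) (transpose_mat U')"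
    unfolding V_def using U' by (simp add: transpose_four_block_mat[of _ 1 1 _ n _ n])
  have VV: "V * transpose_mat V = 1\<^sub>m ?N" "transpose_mat V * V = 1\<^sub>m ?N"
    unfolding Vt unfolding V_def using U'
    by (simp_all add: mult_four_block_mat[of _ 1 1 _ n _ n _ _ 1 _ n] four_block_one_mat[of 1 n, simplified])
  have B_eq: "B = V * L * transpose_mat V"
    unfolding Vt unfolding V_def L_def BB using U' L' A'
    by (simp add: mult_four_block_mat[of _ 1 1 _ n _ n _ _ 1 _ n] A'_eq)
  have diagL: "diagonal_mat L"
    using L' by (auto simp: L_def diagonal_mat_def)
  define U where "U = Q * V"
  have U: "U \<in> carrier_mat ?N ?N" using Q V by (simp add: U_def)
  have Ut: "transpose_mat U = transpose_mat V * Q"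
    unfolding U_def using Q V by (simp add: transpose_mult[of _ ?N ?N _ ?N])
  note assoc = assoc_mult_mat[of _ ?N ?N _ ?N _ ?N]
  have Vtc: "transpose_mat V \<in> carrier_mat ?N ?N" using V by simp
  have "U * transpose_mat U = Q * (V * transpose_mat V) * Q"
    unfolding Ut unfolding U_def using Q(1) V Vtc by (simp add: assoc)
  hence UU: "U * transpose_mat U = 1\<^sub>m ?N" using Q VV by simp
  have "transpose_mat U * U = transpose_mat V * (Q * Q) * V"
    unfolding Ut unfolding U_def using Q(1) V Vtc by (simp add: assoc)
  hence UU': "transpose_mat U * U = 1\<^sub>m ?N" using Q VV Vtc by simp
  have "U * L * transpose_mat U = Q * B * Q"
    unfolding Ut B_eq unfolding U_def using Q(1) V L Vtc by (simp add: assoc)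
  also have "\<dots> = (Q * Q) * A * (Q * Q)"
    unfolding B_def using Q(1) A by (simp add: assoc)
  finally have A_eq: "A = U * L * transpose_mat U" using Q A by simp
  \<comment> \<open>The chosen eigenvalue is the largest one, so putting it first keeps the diagonal sorted.\<close>
  have k_max: "L $$ (j,j) \<le> k" if "j < ?N" for j
  proof -
    have "L $$ (j,j) \<in> spectrum A"
      using that unfolding spectrum_eigendecomposition[OF U UU UU' L diagL A_eq] by auto
    thus ?thesis unfolding k_def using fin by simp
  qed
  have "L $$ (j,j) = (if j = 0 then k else L' $$ (j - 1, j - 1))" if "j < ?N" for j
    using that L'(1) by (auto simp: L_def)
  hence "L $$ (j,j) \<le> L $$ (i,i)" if "i \<le> j" "j < ?N" for i j
    using that L'(3)[of "i - 1" "j - 1"] k_max[of j] by auto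
  hence "eigendecomposition ?N A U L"
    unfolding eigendecomposition_def using U UU UU' L diagL A_eq by auto
  thus ?case by blast
qed

section \<open>Square roots of positive semi-definite matrices\<close>

lemma square_mult_carrier [simp]:
  "A \<in> carrier_mat n n \<Longrightarrow> B \<in> carrier_mat n n \<Longrightarrow> A * B \<in> carrier_mat n n"
  by simp

lemma mat_diag_dims [simp]: "dim_row (mat_diag n f) = n" "dim_col (mat_diag n f) = n"
  by (simp_all add: mat_diag_def)

definition orthogonal_matrix :: "nat \<Rightarrow> real mat \<Rightarrow> bool" where
  "orthogonal_matrix n U \<longleftrightarrow>
     U \<in> carrier_mat n n \<and> U * transpose_mat U = 1\<^sub>m n \<and> transpose_mat U * U = 1\<^sub>m n"

text \<open>
  The functional calculus: for orthogonal \<open>U\<close>, applying a scalar function to \<open>conj_diag n U f\<close>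
  means composing it with \<open>f\<close>. Square roots and inverse square roots are computed in this form.
\<close>
definition conj_diag :: "nat \<Rightarrow> real mat \<Rightarrow> (nat \<Rightarrow> real) \<Rightarrow> real mat" where
  "conj_diag n U f = U * mat_diag n f * transpose_mat U"

lemma conj_diag_carrier [simp]: "U \<in> carrier_mat n n \<Longrightarrow> conj_diag n U f \<in> carrier_mat n n"
  by (simp add: conj_diag_def)

lemma mat_diag_cong: "(\<And>i. i < n \<Longrightarrow> f i = g i) \<Longrightarrow> mat_diag n f = mat_diag n g"
  by (auto simp: mat_diag_def intro!: eq_matI)

lemma conj_diag_cong: "(\<And>i. i < n \<Longrightarrow> f i = g i) \<Longrightarrow> conj_diag n U f = conj_diag n U g"
  by (simp add: conj_diag_def cong: mat_diag_cong)

lemma transpose_mat_diag [simp]: "transpose_mat (mat_diag n f) = mat_diag n f"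
  by (auto simp: mat_diag_def intro!: eq_matI)

lemma conj_diag_transpose:
  "U \<in> carrier_mat n n \<Longrightarrow> transpose_mat (conj_diag n U f) = conj_diag n U f"
  unfolding conj_diag_def
  by (simp add: transpose_mult[of _ n n _ n] assoc_mult_mat[of _ n n _ n _ n])

lemma conj_diag_mult:
  assumes "orthogonal_matrix n U"
  shows "conj_diag n U f * conj_diag n U g = conj_diag n U (\<lambda>i. f i * g i)"
proof -
  have U: "U \<in> carrier_mat n n" "transpose_mat U \<in> carrier_mat n n" "transpose_mat U * U = 1\<^sub>m n"
    using assms by (auto simp: orthogonal_matrix_def)
  have "conj_diag n U f * conj_diag n U g
    = U * mat_diag n f * (transpose_mat U * U) * mat_diag n g * transpose_mat U"
    unfolding conj_diag_def using U(1,2) by (simp add: assoc_mult_mat[of _ n n _ n _ n])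
  also have "\<dots> = U * (mat_diag n f * mat_diag n g) * transpose_mat U"
    using U by (simp add: assoc_mult_mat[of _ n n _ n _ n] del: mat_diag_diag)
  finally show ?thesis by (simp add: conj_diag_def)
qed

lemma conj_diag_one: "orthogonal_matrix n U \<Longrightarrow> conj_diag n U (\<lambda>_. 1) = 1\<^sub>m n"
  by (auto simp: orthogonal_matrix_def conj_diag_def)

lemma conj_diag_index:
  assumes "U \<in> carrier_mat n n" "i < n" "j < n"
  shows "conj_diag n U f $$ (i,j) = (\<Sum>k<n. f k * U $$ (i,k) * U $$ (j,k))"
proof -
  have 1: "(U * mat_diag n f) $$ (i,k) = U $$ (i,k) * f k" if "k < n" for k
    using assms that by (simp add: mat_diag_mult_right[of _ n n])
  show ?thesis unfolding conj_diag_def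
    by (subst index_mult_sum[of _ n n _ n]) (use assms 1 in \<open>auto intro!: sum.cong\<close>)
qed

lemma conj_diag_trace:
  assumes "orthogonal_matrix n U"
  shows "mat_trace (conj_diag n U f) = (\<Sum>i<n. f i)"
proof -
  have U: "U \<in> carrier_mat n n" "transpose_mat U \<in> carrier_mat n n" "transpose_mat U * U = 1\<^sub>m n"
    using assms by (auto simp: orthogonal_matrix_def)
  have "mat_trace (conj_diag n U f) = mat_trace (transpose_mat U * (U * mat_diag n f))"
    unfolding conj_diag_def using U by (intro mat_trace_mult_comm[of _ n n]) auto
  also have "transpose_mat U * (U * mat_diag n f) = mat_diag n f"
    using U by (simp add: assoc_mult_mat[of _ n n _ n _ n, symmetric])
  finally show ?thesis by (simp add: mat_trace_def mat_diag_def)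
qed

lemma conj_diag_quadratic_form:
  assumes U: "U \<in> carrier_mat n n" and v: "v \<in> carrier_vec n"
  shows "v \<bullet> (conj_diag n U f *\<^sub>v v) = (\<Sum>k<n. f k * ((transpose_mat U *\<^sub>v v) $ k)\<^sup>2)"
proof -
  have "v \<bullet> (conj_diag n U f *\<^sub>v v)
    = (\<Sum>i<n. \<Sum>j<n. \<Sum>k<n. f k * (U $$ (i,k) * v $ i) * (U $$ (j,k) * v $ j))"
    unfolding quadratic_form_sum[OF conj_diag_carrier[OF U] v]
    by (intro sum.cong refl) (simp add: conj_diag_index[OF U] sum_distrib_left sum_distrib_right mult_ac)
  also have "\<dots> = (\<Sum>k<n. \<Sum>i<n. \<Sum>j<n. f k * (U $$ (i,k) * v $ i) * (U $$ (j,k) * v $ j))"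
  proof -
    have "(\<Sum>j<n. \<Sum>k<n. f k * (U $$ (i,k) * v $ i) * (U $$ (j,k) * v $ j))
      = (\<Sum>k<n. \<Sum>j<n. f k * (U $$ (i,k) * v $ i) * (U $$ (j,k) * v $ j))" for i
      by (rule sum.swap)
    thus ?thesis by (simp only:) (rule sum.swap)
  qed
  also have "\<dots> = (\<Sum>k<n. f k * (\<Sum>i<n. U $$ (i,k) * v $ i)\<^sup>2)"
    by (intro sum.cong refl) (simp add: power2_eq_square sum_product sum_distrib_left mult_ac)
  also have "\<dots> = (\<Sum>k<n. f k * ((transpose_mat U *\<^sub>v v) $ k)\<^sup>2)"
  proof (intro sum.cong refl)
    fix k assume "k \<in> {..<n}"
    thus "f k * (\<Sum>i<n. U $$ (i,k) * v $ i)\<^sup>2 = f k * ((transpose_mat U *\<^sub>v v) $ k)\<^sup>2"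
      using U by (subst index_mult_mat_vec_sum[of _ n n]) (use v in auto)
  qed
  finally show ?thesis .
qed

lemma conj_diag_psd:
  assumes "U \<in> carrier_mat n n" "\<And>i. i < n \<Longrightarrow> f i \<ge> 0"
  shows "conj_diag n U f \<in> psd_mats n"
  using assms unfolding psd_mats_def sym_mats_def
  by (auto simp: conj_diag_transpose conj_diag_quadratic_form intro!: sum_nonneg)

lemma mult_mat_zero_vec:
  fixes A :: "real mat"
  shows "A \<in> carrier_mat n m \<Longrightarrow> A *\<^sub>v 0\<^sub>v m = 0\<^sub>v n"
  by (intro eq_vecI) auto

lemma quadratic_form_unit_vec:
  fixes A :: "real mat"
  assumes "A \<in> carrier_mat n n" "i < n"
  shows "unit_vec n i \<bullet> (A *\<^sub>v unit_vec n i) = A $$ (i,i)"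
  using assms by simp

lemma psd_diag_nonneg: "A \<in> psd_mats n \<Longrightarrow> i < n \<Longrightarrow> A $$ (i,i) \<ge> 0"
  using quadratic_form_unit_vec[of A n i] unit_vec_carrier[of n i]
  unfolding psd_mats_def sym_mats_def by fastforce

lemma pd_imp_psd: "A \<in> pd_mats n \<Longrightarrow> A \<in> psd_mats n"
proof -
  assume A: "A \<in> pd_mats n"
  have "0 \<le> v \<bullet> (A *\<^sub>v v)" if "v \<in> carrier_vec n" for v
  proof (cases "v = 0\<^sub>v n")
    case True
    thus ?thesis using A by (auto simp: pd_mats_def sym_mats_def)
  next
    case False
    thus ?thesis using A that by (auto simp: pd_mats_def less_imp_le)
  qed
  thus ?thesis using A by (auto simp: pd_mats_def psd_mats_def)
qed

lemma psd_congruence: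
  assumes A: "A \<in> psd_mats n" and X: "X \<in> carrier_mat n m"
  shows "transpose_mat X * A * X \<in> psd_mats m"
proof -
  have Ac: "A \<in> carrier_mat n n" "transpose_mat A = A" using A by (auto simp: psd_mats_def sym_mats_def)
  have Xt: "transpose_mat X \<in> carrier_mat m n" using X by simp
  have "transpose_mat (transpose_mat X * A * X) = transpose_mat X * A * X"
    using X Xt Ac transpose_mult[of "transpose_mat X * A" m n X m] transpose_mult[of "transpose_mat X" m n A n]
    by (simp add: assoc_mult_mat[of _ m n _ n _ m])
  moreover have "0 \<le> v \<bullet> (transpose_mat X * A * X *\<^sub>v v)" if v: "v \<in> carrier_vec m" for v
  proof -
    have w: "X *\<^sub>v v \<in> carrier_vec n" using X v by simp
    have "v \<bullet> (transpose_mat X * A * X *\<^sub>v v) = v \<bullet> (transpose_mat X *\<^sub>v (A *\<^sub>v (X *\<^sub>v v)))"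
      using X Xt Ac v w by (simp add: assoc_mult_mat_vec[of _ m n _ m] assoc_mult_mat_vec[of _ m n _ n])
    also have "\<dots> = (X *\<^sub>v v) \<bullet> (A *\<^sub>v (X *\<^sub>v v))"
      using transpose_vec_mult_scalar[OF X v, of "A *\<^sub>v (X *\<^sub>v v)"] Ac w X v
      by (metis (no_types, lifting) Xt carrier_vecI comm_scalar_prod dim_mult_mat_vec mult_mat_vec_carrier)
    finally show ?thesis using A w by (auto simp: psd_mats_def)
  qed
  ultimately show ?thesis using X Ac Xt by (auto simp: psd_mats_def sym_mats_def)
qed

lemma eigendecomposition_conj_diag:
  assumes "eigendecomposition n A U L"
  shows "orthogonal_matrix n U" "A = conj_diag n U (\<lambda>i. L $$ (i,i))" "L = mat_diag n (\<lambda>i. L $$ (i,i))"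
    "\<And>i j. i \<le> j \<Longrightarrow> j < n \<Longrightarrow> L $$ (j,j) \<le> L $$ (i,i)"
proof -
  have *: "U \<in> carrier_mat n n" "U * transpose_mat U = 1\<^sub>m n" "transpose_mat U * U = 1\<^sub>m n"
    "L \<in> carrier_mat n n" "diagonal_mat L" "A = U * L * transpose_mat U"
    "\<And>i j. i \<le> j \<Longrightarrow> j < n \<Longrightarrow> L $$ (j,j) \<le> L $$ (i,i)"
    using assms unfolding eigendecomposition_def by blast+
  show L: "L = mat_diag n (\<lambda>i. L $$ (i,i))" by (rule diagonal_mat_diag[OF *(4,5)])
  show "orthogonal_matrix n U" using * by (simp add: orthogonal_matrix_def)
  show "A = conj_diag n U (\<lambda>i. L $$ (i,i))" unfolding conj_diag_def L[symmetric] by (rule *(6))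
qed (use assms in \<open>unfold eigendecomposition_def, blast\<close>)

lemma orthogonal_conj_transpose:
  assumes "orthogonal_matrix n U"
  shows "transpose_mat U * conj_diag n U f * U = mat_diag n f"
proof -
  have U: "U \<in> carrier_mat n n" "transpose_mat U \<in> carrier_mat n n" "transpose_mat U * U = 1\<^sub>m n"
    using assms by (auto simp: orthogonal_matrix_def)
  have "transpose_mat U * conj_diag n U f * U = (transpose_mat U * U) * mat_diag n f * (transpose_mat U * U)"
    unfolding conj_diag_def using U(1,2) by (simp add: assoc_mult_mat[of _ n n _ n _ n])
  thus ?thesis using U by simp
qed

lemma psd_eigenvalues_nonneg:
  assumes "conj_diag n U f \<in> psd_mats n" "orthogonal_matrix n U" "i < n"
  shows "f i \<ge> 0"
proof -
  have "transpose_mat U * conj_diag n U f * U \<in> psd_mats n"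
    using assms by (intro psd_congruence) (auto simp: orthogonal_matrix_def)
  thus ?thesis unfolding orthogonal_conj_transpose[OF assms(2)]
    using psd_diag_nonneg[OF _ assms(3)] assms(3) by (force simp: mat_diag_def)
qed

lemma pd_eigenvalues_pos:
  assumes "conj_diag n U f \<in> pd_mats n" "orthogonal_matrix n U" "i < n"
  shows "f i > 0"
proof -
  have U: "U \<in> carrier_mat n n" "transpose_mat U * U = 1\<^sub>m n" using assms(2) by (auto simp: orthogonal_matrix_def)
  define v where "v = U *\<^sub>v unit_vec n i"
  have v: "v \<in> carrier_vec n" using U by (simp add: v_def)
  have e: "transpose_mat U *\<^sub>v v = unit_vec n i"
    unfolding v_def using U by (subst assoc_mult_mat_vec[of _ n n _ n, symmetric]) auto
  hence "v \<noteq> 0\<^sub>v n" using mult_mat_zero_vec[of "transpose_mat U" n n] U(1) assms(3) by (metis transpose_carrier_mat unit_vec_nonzero)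
  hence "0 < v \<bullet> (conj_diag n U f *\<^sub>v v)" using assms(1) v by (auto simp: pd_mats_def)
  also have "\<dots> = (\<Sum>k<n. if k = i then f i else 0)"
    unfolding conj_diag_quadratic_form[OF U(1) v] e
    using assms(3) by (intro sum.cong refl) (auto simp: unit_vec_def)
  finally show ?thesis using assms(3) by simp
qed

lemma psd_spectral:
  assumes "A \<in> psd_mats n"
  obtains U f where "orthogonal_matrix n U" "A = conj_diag n U f" "\<And>i. i < n \<Longrightarrow> f i \<ge> 0"
proof -
  obtain U L where e: "eigendecomposition n A U L"
    using spectral_theorem[of A n] assms by (auto simp: psd_mats_def)
  show ?thesis
    using that[OF eigendecomposition_conj_diag(1,2)[OF e]] psd_eigenvalues_nonneg[of n U]
      eigendecomposition_conj_diag(1,2)[OF e] assms by metis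
qed

lemma pd_spectral:
  assumes "A \<in> pd_mats n"
  obtains U f where "orthogonal_matrix n U" "A = conj_diag n U f" "\<And>i. i < n \<Longrightarrow> f i > 0"
proof -
  obtain U L where e: "eigendecomposition n A U L"
    using spectral_theorem[of A n] assms by (auto simp: pd_mats_def)
  show ?thesis
    using that[OF eigendecomposition_conj_diag(1,2)[OF e]] pd_eigenvalues_pos[of n U]
      eigendecomposition_conj_diag(1,2)[OF e] assms by metis
qed

lemma psd_sqrt_exists:
  assumes "A \<in> psd_mats n"
  obtains R where "R \<in> psd_mats n" "R * R = A"
proof -
  obtain U f where U: "orthogonal_matrix n U" "A = conj_diag n U f" "\<And>i. i < n \<Longrightarrow> f i \<ge> 0"
    using psd_spectral[OF assms] by metis
  have "conj_diag n U (\<lambda>i. sqrt (f i)) * conj_diag n U (\<lambda>i. sqrt (f i)) = A"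
    unfolding conj_diag_mult[OF U(1)] U(2) using U(3) by (intro conj_diag_cong) auto
  moreover have "conj_diag n U (\<lambda>i. sqrt (f i)) \<in> psd_mats n"
    using U by (intro conj_diag_psd) (auto simp: orthogonal_matrix_def)
  ultimately show ?thesis using that by blast
qed

lemma trace_gram:
  assumes "X \<in> carrier_mat n m"
  shows "mat_trace (transpose_mat X * X) = (\<Sum>i<m. \<Sum>j<n. (X $$ (j,i))\<^sup>2)"
  by (subst mat_trace_mult[of _ m n]) (use assms in \<open>auto simp: power2_eq_square intro!: sum.cong\<close>)

text \<open>
  The trace of a Gram matrix is the squared Frobenius norm.
\<close>
lemma trace_gram_zero:
  assumes X: "X \<in> carrier_mat n m" and "mat_trace (transpose_mat X * X) = 0"
  shows "X = 0\<^sub>m n m"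
proof (rule eq_matI)
  fix j i assume "j < dim_row (0\<^sub>m n m)" "i < dim_col (0\<^sub>m n m)"
  thus "X $$ (j,i) = 0\<^sub>m n m $$ (j,i)"
    using assms(2) by (simp add: trace_gram[OF X] sum_nonneg_eq_0_iff sum_nonneg)
qed (use X in auto)

lemma psd_trace_nonneg: "A \<in> psd_mats n \<Longrightarrow> mat_trace A \<ge> 0"
  using psd_diag_nonneg[of A n] by (auto simp: mat_trace_def psd_mats_def sym_mats_def intro!: sum_nonneg)

text \<open>
  With \<open>B = R R\<close> the trace is the squared Frobenius norm of \<open>R X\<close>.
\<close>
lemma psd_trace_congruence_zero:
  assumes B: "B \<in> psd_mats n" and X: "X \<in> carrier_mat n m"
    and "mat_trace (transpose_mat X * B * X) = 0"
  shows "B * X = 0\<^sub>m n m"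
proof -
  obtain R where R: "R \<in> psd_mats n" "R * R = B" using psd_sqrt_exists[OF B] by blast
  hence Rc: "R \<in> carrier_mat n n" "transpose_mat R = R" by (auto simp: psd_mats_def sym_mats_def)
  have Xt: "transpose_mat X \<in> carrier_mat m n" using X by simp
  have "transpose_mat X * B * X = transpose_mat (R * X) * (R * X)"
    unfolding R(2)[symmetric] using Rc X Xt
    by (simp add: transpose_mult[of _ n n _ m] assoc_mult_mat[of _ m n _ n _ m] assoc_mult_mat[of _ m n _ n _ n]
        assoc_mult_mat[of _ n n _ n _ m])
  hence "R * X = 0\<^sub>m n m" using trace_gram_zero[of "R * X" n m] assms(3) Rc X by simp
  thus ?thesis unfolding R(2)[symmetric] using Rc X by (simp add: assoc_mult_mat[of _ n n _ n _ m])
qed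

text \<open>
  The difference \<open>E = B - C\<close> of two roots satisfies \<open>B E + E C = B\<^sup>2 - C\<^sup>2 = 0\<close>. Multiplying by \<open>E\<close>
  and taking traces gives \<open>tr (E B E) + tr (E C E) = 0\<close> with both terms nonnegative, so \<open>B E = C E = 0\<close> and
  therefore \<open>E\<^sup>2 = B E - C E = 0\<close>.
\<close>
lemma psd_square_root_unique:
  assumes B: "B \<in> psd_mats n" and C: "C \<in> psd_mats n" and eq: "B * B = C * C"
  shows "B = C"
proof -
  have Bc: "B \<in> carrier_mat n n" "transpose_mat B = B" using B by (auto simp: psd_mats_def sym_mats_def)
  have Cc: "C \<in> carrier_mat n n" "transpose_mat C = C" using C by (auto simp: psd_mats_def sym_mats_def)
  define E where "E = B - C"
  have E: "E \<in> carrier_mat n n" "transpose_mat E = E"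
    using Bc Cc by (auto simp: E_def minus_carrier_mat transpose_minus[of _ n n])
  note assoc = assoc_mult_mat[of _ n n _ n _ n]
  have "B * E + E * C = B * B - C * C"
    unfolding E_def using Bc Cc
    by (simp add: mult_minus_distrib_mat[of _ n n _ n] minus_mult_distrib_mat[of _ n n _ _ n])
       (intro eq_matI, auto)
  hence sylvester: "B * E + E * C = 0\<^sub>m n n" using eq Cc by simp
  have "mat_trace (E * B * E) + mat_trace (E * C * E) = mat_trace (E * (B * E + E * C))"
  proof -
    have "mat_trace (E * C * E) = mat_trace (E * (E * C))"
      using E Cc by (intro mat_trace_mult_comm[of _ n n]) auto
    thus ?thesis using E Bc Cc
      by (simp add: mult_add_distrib_mat[of _ n n _ n] assoc mat_trace_add[of _ n])
  qed
  also have "\<dots> = 0" using E by (simp add: sylvester mat_trace_def)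
  finally have sum0: "mat_trace (E * B * E) + mat_trace (E * C * E) = 0" .
  have "E * B * E \<in> psd_mats n" "E * C * E \<in> psd_mats n"
    using psd_congruence[OF B E(1)] psd_congruence[OF C E(1)] E by auto
  hence "mat_trace (E * B * E) \<ge> 0" "mat_trace (E * C * E) \<ge> 0" by (auto intro: psd_trace_nonneg)
  hence "mat_trace (E * B * E) = 0" "mat_trace (E * C * E) = 0" using sum0 by auto
  hence "B * E = 0\<^sub>m n n" "C * E = 0\<^sub>m n n"
    using psd_trace_congruence_zero[OF B E(1)] psd_trace_congruence_zero[OF C E(1)] E by auto
  moreover have "E * E = B * E - C * E"
    by (subst E_def) (use Bc Cc E in \<open>simp add: minus_mult_distrib_mat[of _ n n _ _ n]\<close>)
  ultimately have "E * E = 0\<^sub>m n n" by simp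
  hence "E = 0\<^sub>m n n" using trace_gram_zero[OF E(1)] E by (simp add: mat_trace_def)
  show ?thesis
  proof (rule eq_matI)
    fix i j assume ij: "i < dim_row C" "j < dim_col C"
    have "(B - C) $$ (i,j) = 0" using ij Cc \<open>E = 0\<^sub>m n n\<close> by (auto simp: E_def)
    thus "B $$ (i,j) = C $$ (i,j)" using ij Bc Cc by auto
  qed (use Bc Cc in auto)
qed

lemma mat_sqrt_eqI:
  assumes "B \<in> psd_mats n" "B * B = A"
  shows "mat_sqrt A = B"
proof -
  have "B \<in> carrier_mat n n" using assms by (auto simp: psd_mats_def sym_mats_def)
  hence "dim_row A = n" using assms(2) by auto
  thus ?thesis unfolding mat_sqrt_def using assms psd_square_root_unique
    by (intro the_equality) auto
qed

lemma mat_sqrt_psd: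
  assumes "A \<in> psd_mats n"
  shows "mat_sqrt A \<in> psd_mats n" "mat_sqrt A * mat_sqrt A = A"
proof -
  obtain R where "R \<in> psd_mats n" "R * R = A" using psd_sqrt_exists[OF assms] by blast
  thus "mat_sqrt A \<in> psd_mats n" "mat_sqrt A * mat_sqrt A = A" using mat_sqrt_eqI by auto
qed

lemma mat_sqrt_conj_diag:
  assumes "orthogonal_matrix n U" "\<And>i. i < n \<Longrightarrow> f i \<ge> 0"
  shows "mat_sqrt (conj_diag n U f) = conj_diag n U (\<lambda>i. sqrt (f i))"
proof (rule mat_sqrt_eqI)
  show "conj_diag n U (\<lambda>i. sqrt (f i)) \<in> psd_mats n"
    using assms by (intro conj_diag_psd) (auto simp: orthogonal_matrix_def)
  show "conj_diag n U (\<lambda>i. sqrt (f i)) * conj_diag n U (\<lambda>i. sqrt (f i)) = conj_diag n U f"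
    unfolding conj_diag_mult[OF assms(1)] using assms(2) by (intro conj_diag_cong) auto
qed

lemma mat_inverse_eqI:
  assumes A: "A \<in> carrier_mat n n" and B: "B \<in> carrier_mat n n" and "A * B = 1\<^sub>m n" "B * A = (1\<^sub>m n :: real mat)"
  shows "the (mat_inverse A) = B"
proof -
  have "A \<in> Units (ring_mat TYPE(real) n ())"
    using assms by (auto simp: Units_def ring_mat_def)
  then obtain C where C: "mat_inverse A = Some C" using mat_inverse(1)[OF A, of "()"] by (cases "mat_inverse A") auto
  have "C * A = 1\<^sub>m n" "C \<in> carrier_mat n n" using mat_inverse(2)[OF A C] by auto
  hence "C = C * (A * B)" using assms by simp
  also have "\<dots> = (C * A) * B" using A B \<open>C \<in> _\<close> by (simp add: assoc_mult_mat[of _ n n _ n _ n])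
  also have "\<dots> = B" using B \<open>C * A = _\<close> by simp
  finally show ?thesis using C by simp
qed

lemma mat_inv_sqrt_conj_diag:
  assumes "orthogonal_matrix n U" "\<And>i. i < n \<Longrightarrow> f i > 0"
  shows "mat_inv_sqrt (conj_diag n U f) = conj_diag n U (\<lambda>i. 1 / sqrt (f i))"
proof -
  have U: "U \<in> carrier_mat n n" using assms(1) by (auto simp: orthogonal_matrix_def)
  have s: "mat_sqrt (conj_diag n U f) = conj_diag n U (\<lambda>i. sqrt (f i))"
    using assms by (intro mat_sqrt_conj_diag) (auto simp: less_imp_le)
  have one: "conj_diag n U g = 1\<^sub>m n" if "\<And>i. i < n \<Longrightarrow> g i = 1" for g
    using conj_diag_cong[of n g "\<lambda>_. 1"] conj_diag_one[OF assms(1)] that by simp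
  show ?thesis unfolding mat_inv_sqrt_def s
    by (rule mat_inverse_eqI[of _ n]) (use U assms one in \<open>auto simp: conj_diag_mult less_imp_neq[THEN not_sym]\<close>)
qed

lemma orthogonal_one: "orthogonal_matrix n (1\<^sub>m n)"
  by (auto simp: orthogonal_matrix_def)

lemma conj_diag_one_eq: "conj_diag n (1\<^sub>m n) f = mat_diag n f"
  by (simp add: conj_diag_def)

section \<open>The directional derivative of the trace of the square root\<close>

lemma conj_diag_add:
  "U \<in> carrier_mat n n \<Longrightarrow> conj_diag n U f + conj_diag n U g = conj_diag n U (\<lambda>i. f i + g i)"
  by (rule eq_matI)
     (auto simp: conj_diag_index algebra_simps sum.distrib carrier_matD[OF conj_diag_carrier])

lemma conj_diag_smult:
  "U \<in> carrier_mat n n \<Longrightarrow> c \<cdot>\<^sub>m conj_diag n U f = conj_diag n U (\<lambda>i. c * f i)"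
  by (rule eq_matI)
     (auto simp: conj_diag_index sum_distrib_left mult_ac carrier_matD[OF conj_diag_carrier])

lemma trace_mult_symmetric_self:
  assumes "E \<in> carrier_mat n n" "transpose_mat E = E"
  shows "mat_trace (E * E) = (\<Sum>i<n. \<Sum>j<n. (E $$ (i,j))\<^sup>2)"
  using trace_gram[OF assms(1)] assms(2) by (subst sum.swap) simp

text \<open>
  The square root is Lipschitz continuous in the Frobenius norm near a positive definite matrix: for
  \<open>E = B - A\<close> and \<open>D = B\<^sup>2 - A\<^sup>2 = B E + E A\<close>, positivity of \<open>B\<close> and \<open>A \<ge> a\<close> give
  \<open>a tr (E\<^sup>2) \<le> tr (E D)\<close>, and the right-hand side is split by
  \<open>2 a E\<^sub>i\<^sub>j D\<^sub>j\<^sub>i \<le> a\<^sup>2 E\<^sub>i\<^sub>j\<^sup>2 + D\<^sub>j\<^sub>i\<^sup>2\<close>.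
\<close>
lemma sqrt_perturbation_bound:
  assumes U: "orthogonal_matrix n U" and a: "a > 0" "\<And>i. i < n \<Longrightarrow> a \<le> f i"
    and A_def: "A = conj_diag n U f" and B: "B \<in> psd_mats n"
  shows "a\<^sup>2 * (\<Sum>i<n. \<Sum>j<n. ((B - A) $$ (i,j))\<^sup>2) \<le> (\<Sum>i<n. \<Sum>j<n. ((B * B - A * A) $$ (i,j))\<^sup>2)"
proof -
  have Uc: "U \<in> carrier_mat n n" using U by (auto simp: orthogonal_matrix_def)
  have A: "A \<in> carrier_mat n n" "transpose_mat A = A"
    using Uc by (auto simp: A_def conj_diag_transpose)
  have Bc: "B \<in> carrier_mat n n" "transpose_mat B = B" using B by (auto simp: psd_mats_def sym_mats_def)
  define E where "E = B - A"
  define D where "D = B * B - A * A"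
  have E: "E \<in> carrier_mat n n" "transpose_mat E = E"
    using Bc A by (auto simp: E_def minus_carrier_mat transpose_minus[of _ n n])
  have Dc: "D \<in> carrier_mat n n" using Bc A by (auto simp: D_def minus_carrier_mat)
  note assoc = assoc_mult_mat[of _ n n _ n _ n]
  have D: "D = B * E + E * A"
    unfolding E_def D_def using Bc A
    by (simp add: mult_minus_distrib_mat[of _ n n _ n] minus_mult_distrib_mat[of _ n n _ _ n])
       (intro eq_matI, auto)
  let ?E2 = "\<Sum>i<n. \<Sum>j<n. (E $$ (i,j))\<^sup>2" and ?D2 = "\<Sum>i<n. \<Sum>j<n. (D $$ (i,j))\<^sup>2"
  have "mat_trace (E * D) = mat_trace (E * B * E) + mat_trace (E * (E * A))"
    unfolding D using E Bc A
    by (simp add: mult_add_distrib_mat[of _ n n _ n] assoc mat_trace_add[of _ n])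
  also have "mat_trace (E * (E * A)) = mat_trace (E * A * E)"
    using E A by (intro mat_trace_mult_comm[of _ n n, symmetric]) auto
  also have "mat_trace (E * A * E) = mat_trace (E * conj_diag n U (\<lambda>i. f i - a) * E) + a * ?E2"
  proof -
    have one: "conj_diag n U (\<lambda>_. a) = a \<cdot>\<^sub>m 1\<^sub>m n"
      using conj_diag_smult[OF Uc, of a "\<lambda>_. 1"] conj_diag_one[OF U] by simp
    have "A = conj_diag n U (\<lambda>i. f i - a) + a \<cdot>\<^sub>m 1\<^sub>m n"
      unfolding one[symmetric] conj_diag_add[OF Uc] by (simp add: A_def)
    hence "E * A * E = E * conj_diag n U (\<lambda>i. f i - a) * E + a \<cdot>\<^sub>m (E * E)"
      using E(1) Uc by (simp add: mult_add_distrib_mat[of _ n n _ n] add_mult_distrib_mat[of _ n n _ _ n]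
        mult_smult_distrib[of _ n n _ n] mult_smult_assoc_mat[of _ n n _ n])
    thus ?thesis using E Uc
      by (simp add: mat_trace_add[of _ n] mat_trace_smult[of _ n] trace_mult_symmetric_self)
  qed
  finally have "mat_trace (E * D) = mat_trace (E * B * E) + (mat_trace (E * conj_diag n U (\<lambda>i. f i - a) * E) + a * ?E2)" .
  moreover have "mat_trace (E * B * E) \<ge> 0"
    using psd_trace_nonneg[OF psd_congruence[OF B E(1)]] E by simp
  moreover have "mat_trace (E * conj_diag n U (\<lambda>i. f i - a) * E) \<ge> 0"
    using psd_trace_nonneg[OF psd_congruence[OF conj_diag_psd[OF Uc] E(1)], of "\<lambda>i. f i - a"] E a by simp
  ultimately have "a * ?E2 \<le> mat_trace (E * D)" by linarith
  hence "2 * a * (a * ?E2) \<le> 2 * a * mat_trace (E * D)" using a by simp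
  also have "\<dots> = (\<Sum>i<n. \<Sum>j<n. 2 * a * E $$ (i,j) * D $$ (j,i))"
    by (simp add: mat_trace_mult[OF E(1) Dc] sum_distrib_left mult.assoc)
  also have "\<dots> \<le> (\<Sum>i<n. \<Sum>j<n. a\<^sup>2 * (E $$ (i,j))\<^sup>2 + (D $$ (j,i))\<^sup>2)"
  proof (intro sum_mono)
    fix i j
    have "0 \<le> (a * E $$ (i,j) - D $$ (j,i))\<^sup>2" by simp
    thus "2 * a * E $$ (i,j) * D $$ (j,i) \<le> a\<^sup>2 * (E $$ (i,j))\<^sup>2 + (D $$ (j,i))\<^sup>2"
      by (simp add: power2_eq_square algebra_simps)
  qed
  also have "\<dots> = a\<^sup>2 * ?E2 + ?D2"
    by (simp add: sum.distrib sum_distrib_left) (rule sum.swap)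
  finally show ?thesis unfolding E_def D_def by (simp add: power2_eq_square)
qed

text \<open>
  For \<open>E = B - A\<close> one has \<open>B\<^sup>2 - A\<^sup>2 = A E + E A + E\<^sup>2\<close>. Multiplication by \<open>C = A\<^sup>-\<^sup>1\<close> turns each of
  the two linear terms into \<open>tr E\<close>, so the increment of the trace is linear in \<open>B\<^sup>2 - A\<^sup>2\<close>
  up to a term quadratic in \<open>E\<close>.
\<close>
lemma trace_sqrt_increment:
  assumes A: "A \<in> carrier_mat n n" and B: "B \<in> carrier_mat n n" and C: "C \<in> carrier_mat n n"
    and CA: "C * A = 1\<^sub>m n" "A * C = 1\<^sub>m n"
  shows "mat_trace B - mat_trace A
    = (mat_trace (C * (B * B - A * A)) - mat_trace (C * ((B - A) * (B - A)))) / 2"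
proof -
  define E where "E = B - A"
  have E: "E \<in> carrier_mat n n" using A B by (auto simp: E_def minus_carrier_mat)
  have B_eq: "B = A + E" using A B by (auto simp: E_def intro!: eq_matI)
  note assoc = assoc_mult_mat[of _ n n _ n _ n]
  have "B * B - A * A = A * E + (E * A + E * E)"
    unfolding B_eq using A E
    by (simp add: mult_add_distrib_mat[of _ n n _ n] add_mult_distrib_mat[of _ n n _ _ n])
       (intro eq_matI, auto)
  hence "mat_trace (C * (B * B - A * A)) = mat_trace (C * (A * E)) + (mat_trace (C * (E * A)) + mat_trace (C * (E * E)))"
    using A E C by (simp add: mult_add_distrib_mat[of _ n n _ n] mat_trace_add[of _ n])
  also have "C * (A * E) = C * A * E" using A E C by (simp add: assoc)
  also have "mat_trace (C * (E * A)) = mat_trace (E * A * C)"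
    using A E C by (intro mat_trace_mult_comm[of _ n n]) auto
  also have "E * A * C = E * (A * C)" using A E C by (simp add: assoc)
  finally have "mat_trace (C * (B * B - A * A)) = 2 * mat_trace E + mat_trace (C * (E * E))"
    using CA E by simp
  thus ?thesis using mat_trace_minus[OF B A] by (simp add: E_def)
qed

lemma finite_positive_lower_bound:
  fixes f :: "nat \<Rightarrow> real"
  assumes "\<And>i. i < n \<Longrightarrow> f i > 0"
  obtains a where "a > 0" "\<And>i. i < n \<Longrightarrow> a \<le> f i"
proof -
  define a where "a = Min (insert 1 (f ` {..<n}))"
  have "a \<in> insert 1 (f ` {..<n})" unfolding a_def by (rule Min_in) auto
  hence "a > 0" using assms by auto
  moreover have "a \<le> f i" if "i < n" for i unfolding a_def using that by (intro Min_le) auto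
  ultimately show ?thesis using that by blast
qed

lemma null_limit_comparison:
  fixes f g :: "'a \<Rightarrow> real"
  assumes "(g \<longlongrightarrow> 0) F" "\<forall>\<^sub>F x in F. \<bar>f x\<bar> \<le> g x"
  shows "(f \<longlongrightarrow> 0) F"
proof (rule tendsto_0_le[OF assms(1), of _ 1])
  show "\<forall>\<^sub>F x in F. norm (f x) \<le> norm (g x) * 1"
    using assms(2) by eventually_elim auto
qed

text \<open>
  The linear term of \<open>trace_sqrt_increment\<close> is the claimed derivative; the quadratic one is of order
  \<open>t\<^sup>2\<close> by \<open>sqrt_perturbation_bound\<close>.
\<close>
lemma trace_sqrt_derivative:
  assumes S: "S \<in> pd_mats n"
    and Hc: "\<And>t. t > 0 \<Longrightarrow> Ht t \<in> carrier_mat n n" "H \<in> carrier_mat n n"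
    and psd: "\<forall>\<^sub>F t in at_right 0. S + t \<cdot>\<^sub>m Ht t \<in> psd_mats n"
    and lim: "\<And>i j. i < n \<Longrightarrow> j < n \<Longrightarrow> ((\<lambda>t. Ht t $$ (i,j)) \<longlongrightarrow> H $$ (i,j)) (at_right 0)"
  shows "((\<lambda>t. (mat_trace (mat_sqrt (S + t \<cdot>\<^sub>m Ht t)) - mat_trace (mat_sqrt S)) / t)
    \<longlongrightarrow> mat_trace (mat_inv_sqrt S * H) / 2) (at_right 0)"
proof -
  obtain U g where U: "orthogonal_matrix n U" and S_eq: "S = conj_diag n U g" and g: "\<And>i. i < n \<Longrightarrow> g i > 0"
    using pd_spectral[OF S] by metis
  have Uc: "U \<in> carrier_mat n n" using U by (auto simp: orthogonal_matrix_def)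
  obtain a where a: "a > 0" "\<And>i. i < n \<Longrightarrow> a \<le> sqrt (g i)"
    using finite_positive_lower_bound[of n "\<lambda>i. sqrt (g i)"] g by auto
  define A where "A = conj_diag n U (\<lambda>i. sqrt (g i))"
  define C where "C = conj_diag n U (\<lambda>i. 1 / sqrt (g i))"
  have A: "A \<in> carrier_mat n n" and C: "C \<in> carrier_mat n n" using Uc by (auto simp: A_def C_def)
  have sA: "mat_sqrt S = A" unfolding S_eq A_def using U g by (intro mat_sqrt_conj_diag) (auto simp: less_imp_le)
  have sC: "mat_inv_sqrt S = C" unfolding S_eq C_def using U g by (intro mat_inv_sqrt_conj_diag) auto
  have AA: "A * A = S"
    unfolding A_def S_eq conj_diag_mult[OF U] using g by (intro conj_diag_cong) (auto simp: less_imp_le)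
  have one: "conj_diag n U h = 1\<^sub>m n" if "\<And>i. i < n \<Longrightarrow> h i = 1" for h
    using conj_diag_cong[of n h "\<lambda>_. 1"] conj_diag_one[OF U] that by simp
  have CA: "C * A = 1\<^sub>m n" "A * C = 1\<^sub>m n"
    unfolding A_def C_def conj_diag_mult[OF U] using g
    by (auto intro!: one simp: less_imp_neq[THEN not_sym])
  define B where "B t = mat_sqrt (S + t \<cdot>\<^sub>m Ht t)" for t
  define E where "E t = B t - A" for t
  define N where "N t = (\<Sum>i<n. \<Sum>j<n. (Ht t $$ (i,j))\<^sup>2)" for t
  have pos: "\<forall>\<^sub>F t in at_right 0. (t::real) > 0" by (rule eventually_at_right_less)
  have Sc: "S \<in> carrier_mat n n" using S_eq Uc by simp
  have ev: "\<forall>\<^sub>F t in at_right 0. t > 0 \<and> B t \<in> psd_mats n \<and> B t * B t - A * A = t \<cdot>\<^sub>m Ht t"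
    using psd pos
  proof eventually_elim
    case (elim t)
    have "B t * B t - A * A = (S + t \<cdot>\<^sub>m Ht t) - S"
      unfolding AA B_def mat_sqrt_psd(2)[OF elim(1)] ..
    also have "\<dots> = t \<cdot>\<^sub>m Ht t" using Sc Hc(1)[OF elim(2)] by (intro eq_matI) auto
    finally show ?case using elim mat_sqrt_psd(1)[OF elim(1)] by (auto simp: B_def)
  qed
  have Elim: "((\<lambda>t. (E t * E t) $$ (j,i) / t) \<longlongrightarrow> 0) (at_right 0)" if ij: "i < n" "j < n" for i j
  proof (rule null_limit_comparison)
    show "((\<lambda>t. n * (t * N t / a\<^sup>2)) \<longlongrightarrow> 0) (at_right 0)"
    proof -
      have "((\<lambda>t. n * (t * N t / a\<^sup>2)) \<longlongrightarrow> n * (0 * (\<Sum>i<n. \<Sum>j<n. (H $$ (i,j))\<^sup>2) / a\<^sup>2)) (at_right 0)"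
        unfolding N_def using a(1) by (intro tendsto_intros lim) auto
      thus ?thesis by simp
    qed
    show "\<forall>\<^sub>F t in at_right 0. \<bar>(E t * E t) $$ (j,i) / t\<bar> \<le> n * (t * N t / a\<^sup>2)"
      using ev
    proof eventually_elim
      case (elim t)
      hence t: "t > 0" and Bp: "B t \<in> psd_mats n" and D: "B t * B t - A * A = t \<cdot>\<^sub>m Ht t" by auto
      have Ec: "E t \<in> carrier_mat n n" using Bp A by (auto simp: E_def psd_mats_def sym_mats_def)
      let ?F = "\<Sum>i<n. \<Sum>j<n. (E t $$ (i,j))\<^sup>2"
      have "a\<^sup>2 * ?F \<le> (\<Sum>i<n. \<Sum>j<n. ((t \<cdot>\<^sub>m Ht t) $$ (i,j))\<^sup>2)"
        using sqrt_perturbation_bound[OF U a A_def Bp] by (simp add: E_def D)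
      also have "\<dots> = t\<^sup>2 * N t"
        unfolding N_def sum_distrib_left using Hc(1)[OF t] by (intro sum.cong refl) (auto simp: power_mult_distrib)
      finally have F: "?F \<le> t\<^sup>2 * N t / a\<^sup>2" using a(1) by (simp add: field_simps)
      have entry: "(E t $$ (k,l))\<^sup>2 \<le> ?F" if "k < n" "l < n" for k l
      proof -
        have "(E t $$ (k,l))\<^sup>2 \<le> (\<Sum>j<n. (E t $$ (k,j))\<^sup>2)"
          using that by (intro member_le_sum) auto
        also have "\<dots> \<le> ?F" using that
          by (intro member_le_sum[of k _ "\<lambda>i. \<Sum>j<n. (E t $$ (i,j))\<^sup>2"]) (auto intro: sum_nonneg)
        finally show ?thesis .
      qed
      have "\<bar>(E t * E t) $$ (j,i)\<bar> \<le> (\<Sum>k<n. \<bar>E t $$ (j,k) * E t $$ (k,i)\<bar>)"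
        unfolding index_mult_sum[OF Ec Ec ij(2,1)] by (rule sum_abs)
      also have "\<dots> \<le> (\<Sum>k<n. ?F)"
      proof (intro sum_mono)
        fix k assume "k \<in> {..<n}"
        hence e: "(E t $$ (j,k))\<^sup>2 \<le> ?F" "(E t $$ (k,i))\<^sup>2 \<le> ?F" using entry ij by auto
        have "2 * \<bar>E t $$ (j,k) * E t $$ (k,i)\<bar> \<le> (E t $$ (j,k))\<^sup>2 + (E t $$ (k,i))\<^sup>2"
          using sum_squares_bound[of "\<bar>E t $$ (j,k)\<bar>" "\<bar>E t $$ (k,i)\<bar>"] by (simp add: abs_mult)
        thus "\<bar>E t $$ (j,k) * E t $$ (k,i)\<bar> \<le> ?F" using e by linarith
      qed
      also have "\<dots> \<le> n * (t\<^sup>2 * N t / a\<^sup>2)" using mult_left_mono[OF F, of n] by simp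
      finally have "\<bar>(E t * E t) $$ (j,i)\<bar> \<le> (n * (t * N t / a\<^sup>2)) * t" by (simp add: power2_eq_square mult_ac)
      thus ?case using t by (simp add: pos_divide_le_eq abs_mult)
    qed
  qed
  have "((\<lambda>t. ((\<Sum>i<n. \<Sum>j<n. C $$ (i,j) * Ht t $$ (j,i)) - (\<Sum>i<n. \<Sum>j<n. C $$ (i,j) * ((E t * E t) $$ (j,i) / t))) / 2)
    \<longlongrightarrow> ((\<Sum>i<n. \<Sum>j<n. C $$ (i,j) * H $$ (j,i)) - (\<Sum>i<n. \<Sum>j<n. C $$ (i,j) * 0)) / 2) (at_right 0)"
    by (intro tendsto_intros lim Elim) auto
  also have "((\<Sum>i<n. \<Sum>j<n. C $$ (i,j) * H $$ (j,i)) - (\<Sum>i<n. \<Sum>j<n. C $$ (i,j) * 0)) / 2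
    = mat_trace (mat_inv_sqrt S * H) / 2"
    by (simp add: sC mat_trace_mult[OF C Hc(2)])
  finally show ?thesis
  proof (rule Lim_transform_eventually)
    show "\<forall>\<^sub>F t in at_right 0. ((\<Sum>i<n. \<Sum>j<n. C $$ (i,j) * Ht t $$ (j,i)) - (\<Sum>i<n. \<Sum>j<n. C $$ (i,j) * ((E t * E t) $$ (j,i) / t))) / 2
       = (mat_trace (mat_sqrt (S + t \<cdot>\<^sub>m Ht t)) - mat_trace (mat_sqrt S)) / t"
      using ev
    proof eventually_elim
      case (elim t)
      hence t: "t > 0" and Bp: "B t \<in> psd_mats n" and D: "B t * B t - A * A = t \<cdot>\<^sub>m Ht t" by auto
      have Bc: "B t \<in> carrier_mat n n" using Bp by (auto simp: psd_mats_def sym_mats_def)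
      hence Ec: "E t \<in> carrier_mat n n" using A by (auto simp: E_def minus_carrier_mat)
      have 1: "mat_trace (C * (t \<cdot>\<^sub>m Ht t)) = t * (\<Sum>i<n. \<Sum>j<n. C $$ (i,j) * Ht t $$ (j,i))"
        using C Hc(1)[OF t]
        by (simp add: mult_smult_distrib[of _ n n _ n] mat_trace_smult[of _ n] mat_trace_mult[of _ n n])
      have 2: "mat_trace (C * (E t * E t)) = t * (\<Sum>i<n. \<Sum>j<n. C $$ (i,j) * ((E t * E t) $$ (j,i) / t))"
        using C Ec t by (simp add: mat_trace_mult[of _ n n] sum_distrib_left)
      have "mat_trace (B t) - mat_trace A
        = (mat_trace (C * (t \<cdot>\<^sub>m Ht t)) - mat_trace (C * (E t * E t))) / 2"
        unfolding trace_sqrt_increment[OF A Bc C CA] D E_def ..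
      thus ?case unfolding 1 2 sA B_def[symmetric] using t by (simp add: field_simps)
    qed
  qed
qed

section \<open>Ky Fan sums and the derivative of a simple eigenvalue\<close>

text \<open>
  A weighted sum with weights in \<open>[0,1]\<close> and total mass at most \<open>k\<close> is largest when all the mass sits
  on the \<open>k\<close> largest terms.
\<close>
lemma weighted_sum_le_partial_sum:
  fixes f w :: "nat \<Rightarrow> real"
  assumes decr: "\<And>i j. i \<le> j \<Longrightarrow> f j \<le> f i" and nonneg: "\<And>i. 0 \<le> f i"
    and w: "\<And>i. i < n \<Longrightarrow> 0 \<le> w i" "\<And>i. i < n \<Longrightarrow> w i \<le> 1" and k: "(\<Sum>i<n. w i) \<le> real k"
  shows "(\<Sum>i<n. f i * w i) \<le> (\<Sum>i<k. f i)"
proof (cases "n \<le> k")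
  case True
  have "(\<Sum>i<n. f i * w i) \<le> (\<Sum>i<n. f i)"
    using w nonneg by (intro sum_mono) (auto intro: mult_left_le)
  also have "\<dots> \<le> (\<Sum>i<k. f i)" using True nonneg by (intro sum_mono2) auto
  finally show ?thesis .
next
  case False
  hence split: "{..<n} = {..<k} \<union> {k..<n}" "{..<k} \<inter> {k..<n} = {}" by auto
  have "(\<Sum>i<n. f i * w i) - (\<Sum>i<k. f i) = (\<Sum>i<k. f i * (w i - 1)) + (\<Sum>i=k..<n. f i * w i)"
    unfolding split(1) by (subst sum.union_disjoint) (auto simp: algebra_simps sum_subtractf)
  also have "\<dots> \<le> (\<Sum>i<k. f k * (w i - 1)) + (\<Sum>i=k..<n. f k * w i)"
    using False w decr by (intro add_mono sum_mono mult_right_mono mult_right_mono_neg) auto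
  also have "\<dots> = f k * ((\<Sum>i<n. w i) - k)"
    unfolding split(1) by (subst sum.union_disjoint) (auto simp: algebra_simps sum_subtractf sum_distrib_left)
  also have "\<dots> \<le> 0" using k nonneg[of k] by (simp add: mult_nonneg_nonpos)
  finally show ?thesis by simp
qed

text \<open>
  If \<open>C C\<^sup>T = 1\<close> then \<open>1 - C\<^sup>T C\<close> is a symmetric idempotent, and so its diagonal entries are sums
  of squares.
\<close>
lemma coisometry_column_norm:
  fixes C :: "real mat"
  assumes C: "C \<in> carrier_mat n m" and CC: "C * transpose_mat C = 1\<^sub>m n" and j: "j < m"
  shows "(\<Sum>i<n. (C $$ (i,j))\<^sup>2) \<le> 1"
proof -
  \<comment> \<open>The orthogonal projection onto the kernel of \<open>C\<close>.\<close>
  define M where "M = 1\<^sub>m m - transpose_mat C * C"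
  have Ct: "transpose_mat C \<in> carrier_mat m n" using C by simp
  have G: "transpose_mat C * C \<in> carrier_mat m m" using mult_carrier_mat[OF Ct C] .
  have M: "M \<in> carrier_mat m m" using G by (simp add: M_def minus_carrier_mat)
  have Mt: "transpose_mat M = M"
    using C Ct G by (simp add: M_def transpose_minus[of _ m m] transpose_mult[of _ m n _ m])
  have "(transpose_mat C * C) * (transpose_mat C * C) = transpose_mat C * (C * transpose_mat C) * C"
    using C Ct mult_carrier_mat[OF C Ct] mult_carrier_mat[OF Ct C]
    by (simp add: assoc_mult_mat[of _ m n _ m _ m] assoc_mult_mat[of _ m n _ n _ m] assoc_mult_mat[of _ n m _ n _ m])
  hence GG: "(transpose_mat C * C) * (transpose_mat C * C) = transpose_mat C * C" using CC Ct by simp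
  have "M * M = M"
    unfolding M_def using G
    by (simp add: mult_minus_distrib_mat[of _ m m _ m] minus_mult_distrib_mat[of _ m m _ _ m] GG minus_carrier_mat)
       (intro eq_matI, auto)
  hence "M $$ (j,j) = (\<Sum>l<m. M $$ (j,l) * M $$ (l,j))"
    using index_mult_sum[OF M M j j] by simp
  also have "\<dots> = (\<Sum>l<m. (M $$ (l,j))\<^sup>2)"
  proof (intro sum.cong refl)
    fix l assume "l \<in> {..<m}"
    hence "M $$ (j,l) = M $$ (l,j)" using M j by (subst Mt[symmetric]) auto
    thus "M $$ (j,l) * M $$ (l,j) = (M $$ (l,j))\<^sup>2" by (simp add: power2_eq_square)
  qed
  also have "\<dots> \<ge> 0" by (intro sum_nonneg) auto
  finally have "M $$ (j,j) \<ge> 0" .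
  moreover have "M $$ (j,j) = 1 - (\<Sum>i<n. (C $$ (i,j))\<^sup>2)"
  proof -
    have "(transpose_mat C * C) $$ (j,j) = (\<Sum>i<n. (C $$ (i,j))\<^sup>2)"
      unfolding index_mult_sum[OF Ct C j j] using C j by (intro sum.cong refl) (auto simp: power2_eq_square)
    thus ?thesis unfolding M_def using j G C by (subst index_minus_mat) auto
  qed
  ultimately show ?thesis by simp
qed

lemma diag_conjugation_index:
  fixes C :: "real mat"
  assumes C: "C \<in> carrier_mat n m" and j: "j < m"
  shows "(transpose_mat C * mat_diag n f * C) $$ (j,j) = (\<Sum>i<n. f i * (C $$ (i,j))\<^sup>2)"
proof -
  have Ct: "transpose_mat C \<in> carrier_mat m n" using C by simp
  have "(transpose_mat C * mat_diag n f * C) $$ (j,j) = (\<Sum>i<n. (transpose_mat C * mat_diag n f) $$ (j,i) * C $$ (i,j))"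
    using Ct by (intro index_mult_sum[OF _ C j j] mult_carrier_mat[OF Ct]) auto
  also have "\<dots> = (\<Sum>i<n. f i * (C $$ (i,j))\<^sup>2)"
    using C j by (intro sum.cong refl) (auto simp: mat_diag_mult_right[OF Ct] power2_eq_square)
  finally show ?thesis .
qed

text \<open>
  The diagonal entries of \<open>V\<^sup>T B\<^sup>T diag(f) B V\<close> are the sums of \<open>f i (B V)\<^sub>i\<^sub>j\<^sup>2\<close> over \<open>i\<close>. Adding the first
  \<open>k\<close> of them gives a weighted sum of \<open>f\<close>: rows of \<open>B V\<close> have norm 1, so no weight exceeds 1, and columns
  have norm at most 1, so the total weight is at most \<open>k\<close>. Allowing a rectangular \<open>B\<close> covers matrices of
  the form \<open>X\<^sup>T X\<close> whose nonzero eigenvalues are known from the smaller matrix \<open>X X\<^sup>T\<close>.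
\<close>
lemma ky_fan_inequality:
  fixes B V :: "real mat" and f :: "nat \<Rightarrow> real"
  assumes B: "B \<in> carrier_mat n m" "B * transpose_mat B = 1\<^sub>m n" and V: "orthogonal_matrix m V"
    and decr: "\<And>i j. i \<le> j \<Longrightarrow> f j \<le> f i" and nonneg: "\<And>i. 0 \<le> f i" and k: "k \<le> m"
  shows "(\<Sum>j<k. (transpose_mat V * (transpose_mat B * mat_diag n f * B) * V) $$ (j,j)) \<le> (\<Sum>i<k. f i)"
proof -
  have Vc: "V \<in> carrier_mat m m" "transpose_mat V \<in> carrier_mat m m" "V * transpose_mat V = 1\<^sub>m m"
    using V by (auto simp: orthogonal_matrix_def)
  have Bt: "transpose_mat B \<in> carrier_mat m n" using B by simp
  define C where "C = B * V"
  have C: "C \<in> carrier_mat n m" unfolding C_def using mult_carrier_mat[OF B(1) Vc(1)] .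
  have Ct: "transpose_mat C = transpose_mat V * transpose_mat B"
    unfolding C_def by (rule transpose_mult[OF B(1) Vc(1)])
  have "C * transpose_mat C = B * ((V * transpose_mat V) * transpose_mat B)"
    unfolding Ct unfolding C_def using B(1) Bt Vc(1,2) mult_carrier_mat[OF Vc(2) Bt]
    by (simp add: assoc_mult_mat[of _ n m _ m _ n] assoc_mult_mat[of _ m m _ m _ n])
  hence CC: "C * transpose_mat C = 1\<^sub>m n" using B Bt Vc by simp
  have BD: "transpose_mat B * mat_diag n f \<in> carrier_mat m n" using mult_carrier_mat[OF Bt mat_diag_dim] .
  have eq: "transpose_mat V * (transpose_mat B * mat_diag n f * B) * V = transpose_mat C * mat_diag n f * C"
    unfolding Ct unfolding C_def using B(1) Bt Vc(1,2) BD mult_carrier_mat[OF B(1) Vc(1)] mult_carrier_mat[OF BD B(1)] mult_carrier_mat[OF mat_diag_dim[of n f] B(1)]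
      mult_carrier_mat[OF mat_diag_dim[of n f] mult_carrier_mat[OF B(1) Vc(1)]]
    by (simp add: assoc_mult_mat[of _ m m _ m _ m] assoc_mult_mat[of _ m n _ m _ m] assoc_mult_mat[of _ m m _ n _ m]
      assoc_mult_mat[of _ m n _ n _ m] assoc_mult_mat[of _ m m _ n _ n]
      assoc_mult_mat[of _ n n _ m _ m])
  define w where "w i = (\<Sum>j<k. (C $$ (i,j))\<^sup>2)" for i
  have "(\<Sum>j<k. (transpose_mat C * mat_diag n f * C) $$ (j,j)) = (\<Sum>j<k. \<Sum>i<n. f i * (C $$ (i,j))\<^sup>2)"
    using k by (intro sum.cong refl diag_conjugation_index[OF C]) auto
  also have "\<dots> = (\<Sum>i<n. f i * w i)"
    unfolding w_def sum_distrib_left by (rule sum.swap)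
  also have "\<dots> \<le> (\<Sum>i<k. f i)"
  proof (rule weighted_sum_le_partial_sum[OF decr nonneg])
    fix i assume i: "i < n"
    show "0 \<le> w i" unfolding w_def by (intro sum_nonneg) auto
    have "w i \<le> (\<Sum>j<m. (C $$ (i,j))\<^sup>2)" unfolding w_def using k by (intro sum_mono2) auto
    also have "\<dots> = (C * transpose_mat C) $$ (i,i)"
      using C i by (subst index_mult_sum[of _ n m _ n]) (auto simp: power2_eq_square intro!: sum.cong)
    also have "\<dots> = 1" unfolding CC using i by simp
    finally show "w i \<le> 1" .
  next
    have "(\<Sum>i<n. w i) = (\<Sum>j<k. \<Sum>i<n. (C $$ (i,j))\<^sup>2)" unfolding w_def by (rule sum.swap)
    also have "\<dots> \<le> (\<Sum>j<k. 1)"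
      using k by (intro sum_mono coisometry_column_norm[OF C CC]) auto
    finally show "(\<Sum>i<n. w i) \<le> real k" by simp
  qed
  finally show ?thesis unfolding eq .
qed

lemma orthogonal_entry_le_one:
  assumes V: "orthogonal_matrix n V" and ij: "i < n" "j < n"
  shows "\<bar>V $$ (i,j)\<bar> \<le> 1"
proof -
  have Vc: "V \<in> carrier_mat n n" "V * transpose_mat V = 1\<^sub>m n" using V by (auto simp: orthogonal_matrix_def)
  have "(V $$ (i,j))\<^sup>2 \<le> (\<Sum>i<n. (V $$ (i,j))\<^sup>2)" using ij by (intro member_le_sum) auto
  also have "\<dots> \<le> 1" by (rule coisometry_column_norm[OF Vc ij(2)])
  finally show ?thesis by (simp add: abs_square_le_1)
qed

lemma congruence_index:
  assumes X: "X \<in> carrier_mat n n" and Y: "Y \<in> carrier_mat n n" and D: "D \<in> carrier_mat n n"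
    and ij: "i < n" "j < n"
  shows "(transpose_mat X * D * Y) $$ (i,j) = (\<Sum>b<n. \<Sum>a<n. X $$ (a,i) * D $$ (a,b) * Y $$ (b,j))"
proof -
  have Xt: "transpose_mat X \<in> carrier_mat n n" using X by simp
  have "(transpose_mat X * D * Y) $$ (i,j) = (\<Sum>b<n. (transpose_mat X * D) $$ (i,b) * Y $$ (b,j))"
    using Xt D Y ij by (intro index_mult_sum) auto
  also have "\<dots> = (\<Sum>b<n. \<Sum>a<n. X $$ (a,i) * D $$ (a,b) * Y $$ (b,j))"
    using X ij by (intro sum.cong refl) (auto simp: index_mult_sum[OF Xt D] sum_distrib_right)
  finally show ?thesis .
qed

text \<open>
  The sum of the first \<open>k\<close> eigenvalues of the second matrix \<open>T\<close> is the trace of \<open>T\<close> over the first \<open>k\<close> columns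
  of \<open>V\<close>; for the first matrix \<open>S\<close> the same columns give at most its own Ky Fan sum.
\<close>
lemma eigenvalue_partial_sum_le:
  fixes f g :: "nat \<Rightarrow> real"
  assumes U: "orthogonal_matrix n U" and V: "orthogonal_matrix n V"
    and decr: "\<And>i j. i \<le> j \<Longrightarrow> f j \<le> f i" and nonneg: "\<And>i. 0 \<le> f i" and k: "k \<le> n"
  shows "(\<Sum>j<k. g j) \<le> (\<Sum>j<k. f j)
    + n * (\<Sum>b<n. \<Sum>a<n. \<bar>(conj_diag n V g - conj_diag n U f) $$ (a,b)\<bar>)"
proof -
  have Uc: "U \<in> carrier_mat n n" "transpose_mat U * U = 1\<^sub>m n" using U by (auto simp: orthogonal_matrix_def)
  have Vc: "V \<in> carrier_mat n n" "transpose_mat V \<in> carrier_mat n n" using V by (auto simp: orthogonal_matrix_def)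
  define S where "S = conj_diag n U f"
  define T where "T = conj_diag n V g"
  define D where "D = T - S"
  have S: "S \<in> carrier_mat n n" and T: "T \<in> carrier_mat n n" using Uc Vc by (auto simp: S_def T_def)
  have D: "D \<in> carrier_mat n n" using S T by (simp add: D_def minus_carrier_mat)
  let ?d = "\<Sum>b<n. \<Sum>a<n. \<bar>D $$ (a,b)\<bar>"
  have ky: "(\<Sum>j<k. (transpose_mat V * S * V) $$ (j,j)) \<le> (\<Sum>j<k. f j)"
    using ky_fan_inequality[of "transpose_mat U" n n V f k] Uc V decr nonneg k
    by (auto simp: S_def conj_diag_def)
  have "transpose_mat V * T * V = transpose_mat V * S * V + transpose_mat V * D * V"
  proof -
    have "T = S + D" using S T by (auto simp: D_def intro!: eq_matI)
    thus ?thesis using S D Vc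
      by (simp add: mult_add_distrib_mat[of _ n n _ n] add_mult_distrib_mat[of _ n n _ _ n])
  qed
  hence eq: "mat_diag n g = transpose_mat V * S * V + transpose_mat V * D * V"
    unfolding T_def orthogonal_conj_transpose[OF V] .
  have gj: "g j \<le> (transpose_mat V * S * V) $$ (j,j) + ?d" if j: "j < n" for j
  proof -
    have "g j = mat_diag n g $$ (j,j)" using j by (simp add: mat_diag_def)
    also have "\<dots> = (transpose_mat V * S * V) $$ (j,j) + (transpose_mat V * D * V) $$ (j,j)"
      unfolding eq using j S D Vc by (subst index_add_mat) auto
    also have "(transpose_mat V * D * V) $$ (j,j) \<le> ?d"
      unfolding congruence_index[OF Vc(1) Vc(1) D j j]
    proof (intro sum_mono)
      fix b a assume "b \<in> {..<n}" "a \<in> {..<n}"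
      hence v: "\<bar>V $$ (a,j)\<bar> \<le> 1" "\<bar>V $$ (b,j)\<bar> \<le> 1" using orthogonal_entry_le_one[OF V] j by auto
      have "\<bar>V $$ (a,j) * D $$ (a,b) * V $$ (b,j)\<bar> = \<bar>D $$ (a,b)\<bar> * (\<bar>V $$ (a,j)\<bar> * \<bar>V $$ (b,j)\<bar>)"
        by (simp add: abs_mult)
      also have "\<dots> \<le> \<bar>D $$ (a,b)\<bar>" using v by (intro mult_left_le mult_le_one) auto
      finally show "V $$ (a,j) * D $$ (a,b) * V $$ (b,j) \<le> \<bar>D $$ (a,b)\<bar>" by linarith
    qed
    finally show ?thesis by simp
  qed
  have "(\<Sum>j<k. g j) \<le> (\<Sum>j<k. (transpose_mat V * S * V) $$ (j,j) + ?d)"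
    using k by (intro sum_mono gj) auto
  also have "\<dots> = (\<Sum>j<k. (transpose_mat V * S * V) $$ (j,j)) + k * ?d" by (simp add: sum.distrib)
  also have "\<dots> \<le> (\<Sum>j<k. f j) + n * ?d"
    using ky k by (intro add_mono mult_right_mono) (auto intro!: sum_nonneg)
  finally show ?thesis by (simp add: D_def T_def S_def)
qed

text \<open>
  An eigenvalue is the difference of two consecutive Ky Fan sums. The constant is crude, but it suffices for
  the continuity of sorted eigenvalues.
\<close>
lemma eigenvalue_perturbation:
  fixes f g :: "nat \<Rightarrow> real"
  assumes U: "orthogonal_matrix n U" and V: "orthogonal_matrix n V"
    and f: "\<And>i j. i \<le> j \<Longrightarrow> f j \<le> f i" "\<And>i. 0 \<le> f i"
    and g: "\<And>i j. i \<le> j \<Longrightarrow> g j \<le> g i" "\<And>i. 0 \<le> g i"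
    and k: "k < n"
  shows "\<bar>g k - f k\<bar> \<le> 2 * real n * (\<Sum>b<n. \<Sum>a<n. \<bar>(conj_diag n V g - conj_diag n U f) $$ (a,b)\<bar>)"
    (is "_ \<le> 2 * real n * ?d")
proof -
  have Uc: "U \<in> carrier_mat n n" and Vc: "V \<in> carrier_mat n n" using U V by (auto simp: orthogonal_matrix_def)
  have sym: "(\<Sum>b<n. \<Sum>a<n. \<bar>(conj_diag n U f - conj_diag n V g) $$ (a,b)\<bar>) = ?d"
    using Uc Vc by (intro sum.cong refl) (auto simp: carrier_matD[OF conj_diag_carrier])
  have "(\<Sum>j<Suc k. g j) \<le> (\<Sum>j<Suc k. f j) + n * ?d" "(\<Sum>j<k. g j) \<le> (\<Sum>j<k. f j) + n * ?d"
    using k by (auto intro!: eigenvalue_partial_sum_le[OF U V f] simp del: sum.lessThan_Suc)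
  moreover have "(\<Sum>j<Suc k. f j) \<le> (\<Sum>j<Suc k. g j) + n * ?d" "(\<Sum>j<k. f j) \<le> (\<Sum>j<k. g j) + n * ?d"
    unfolding sym[symmetric]
    using k by (auto intro!: eigenvalue_partial_sum_le[OF V U g] simp del: sum.lessThan_Suc)
  ultimately show ?thesis by simp
qed

text \<open>
  First order perturbation theory. In the eigenbasis of the unperturbed matrix, the overlaps
  \<open>W = U\<^sup>T V\<close> satisfy \<open>(g\<^sub>j - f\<^sub>i) W\<^sub>i\<^sub>j = t (K W)\<^sub>i\<^sub>j\<close> with \<open>K = U\<^sup>T H\<^sub>t U\<close>. As
  \<open>g\<^sub>j\<close> tends to \<open>f\<^sub>j \<noteq> f\<^sub>i\<close>, the overlaps with \<open>i \<noteq> j\<close> vanish in the limit, hence \<open>W\<^sub>j\<^sub>j\<^sup>2\<close> tends to 1, and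
  the equation with \<open>i = j\<close>, multiplied by \<open>W\<^sub>j\<^sub>j\<close>, yields the derivative \<open>K\<^sub>j\<^sub>j\<close>. Only \<open>W\<^sub>j\<^sub>j\<^sup>2\<close> can be
  controlled, because eigenvectors are determined up to sign.
\<close>
lemma simple_eigenvalue_derivative:
  fixes f :: "nat \<Rightarrow> real" and g :: "real \<Rightarrow> nat \<Rightarrow> real"
  assumes U: "orthogonal_matrix n U" and f: "\<And>i j. i \<le> j \<Longrightarrow> f j \<le> f i" "\<And>i. 0 \<le> f i"
    and simple: "\<And>i j. i < n \<Longrightarrow> j < n \<Longrightarrow> i \<noteq> j \<Longrightarrow> f i \<noteq> f j"
    and Hc: "\<And>t. t > 0 \<Longrightarrow> Ht t \<in> carrier_mat n n" "H \<in> carrier_mat n n"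
    and lim: "\<And>i j. i < n \<Longrightarrow> j < n \<Longrightarrow> ((\<lambda>t. Ht t $$ (i,j)) \<longlongrightarrow> H $$ (i,j)) (at_right 0)"
    and ev: "\<forall>\<^sub>F t in at_right 0. orthogonal_matrix n (V t)
      \<and> conj_diag n U f + t \<cdot>\<^sub>m Ht t = conj_diag n (V t) (g t)
      \<and> (\<forall>i j. i \<le> j \<longrightarrow> g t j \<le> g t i) \<and> (\<forall>i. 0 \<le> g t i)"
    and j: "j < n"
  shows "((\<lambda>t. (g t j - f j) / t) \<longlongrightarrow> (transpose_mat U * H * U) $$ (j,j)) (at_right 0)"
proof -
  have Uc: "U \<in> carrier_mat n n" "transpose_mat U \<in> carrier_mat n n"
      "U * transpose_mat U = 1\<^sub>m n" "transpose_mat U * U = 1\<^sub>m n"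
    using U by (auto simp: orthogonal_matrix_def)
  have pos: "\<forall>\<^sub>F t in at_right 0. (t::real) > 0" by (rule eventually_at_right_less)
  define K where "K t = transpose_mat U * Ht t * U" for t
  define W where "W t = transpose_mat U * V t" for t
  note assoc = assoc_mult_mat[of _ n n _ n _ n]
  have Klim: "((\<lambda>t. K t $$ (i,l)) \<longlongrightarrow> (transpose_mat U * H * U) $$ (i,l)) (at_right 0)"
    if il: "i < n" "l < n" for i l
  proof (rule Lim_transform_eventually)
    show "((\<lambda>t. \<Sum>b<n. \<Sum>a<n. U $$ (a,i) * Ht t $$ (a,b) * U $$ (b,l)) \<longlongrightarrow> (transpose_mat U * H * U) $$ (i,l)) (at_right 0)"
      unfolding congruence_index[OF Uc(1,1) Hc(2) il] by (intro tendsto_intros lim) auto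
    show "\<forall>\<^sub>F t in at_right 0. (\<Sum>b<n. \<Sum>a<n. U $$ (a,i) * Ht t $$ (a,b) * U $$ (b,l)) = K t $$ (i,l)"
      using pos by eventually_elim (simp add: K_def congruence_index[OF Uc(1,1) Hc(1) il])
  qed
  have evW: "\<forall>\<^sub>F t in at_right 0. t > 0 \<and> orthogonal_matrix n (W t)"
    using ev pos
  proof eventually_elim
    case (elim t)
    hence Vc: "V t \<in> carrier_mat n n" "transpose_mat (V t) \<in> carrier_mat n n"
      "V t * transpose_mat (V t) = 1\<^sub>m n" "transpose_mat (V t) * V t = 1\<^sub>m n"
      by (auto simp: orthogonal_matrix_def)
    have Wt: "transpose_mat (W t) = transpose_mat (V t) * U"
      unfolding W_def using Uc Vc by (simp add: transpose_mult[of _ n n _ n])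
    have "W t * transpose_mat (W t) = transpose_mat U * (V t * transpose_mat (V t)) * U"
      unfolding Wt unfolding W_def using Uc(1,2) Vc(1,2) by (simp add: assoc)
    moreover have "transpose_mat (W t) * W t = transpose_mat (V t) * (U * transpose_mat U) * V t"
      unfolding Wt unfolding W_def using Uc(1,2) Vc(1,2) by (simp add: assoc)
    moreover have "W t \<in> carrier_mat n n" using Uc Vc by (simp add: W_def)
    ultimately show ?case using Uc Vc elim by (simp add: orthogonal_matrix_def)
  qed
  have evEq: "\<forall>\<^sub>F t in at_right 0. \<forall>i<n. (g t j - f i) * W t $$ (i,j) = t * (\<Sum>l<n. K t $$ (i,l) * W t $$ (l,j))"
    using ev evW
  proof eventually_elim
    case (elim t)
    hence t: "t > 0" and Vc: "V t \<in> carrier_mat n n" "transpose_mat (V t) \<in> carrier_mat n n"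
      "transpose_mat (V t) * V t = 1\<^sub>m n"
      and eq: "conj_diag n U f + t \<cdot>\<^sub>m Ht t = conj_diag n (V t) (g t)"
      by (auto simp: orthogonal_matrix_def)
    have Wc: "W t \<in> carrier_mat n n" and Kc: "K t \<in> carrier_mat n n"
      using Uc Vc Hc(1)[OF t] by (auto simp: W_def K_def)
    have 1: "transpose_mat U * conj_diag n (V t) (g t) * V t = W t * mat_diag n (g t)"
    proof -
      have "transpose_mat U * conj_diag n (V t) (g t) * V t = W t * mat_diag n (g t) * (transpose_mat (V t) * V t)"
        unfolding W_def conj_diag_def using Uc(2) Vc(1,2) by (simp add: assoc)
      thus ?thesis using Vc Wc by simp
    qed
    have 2: "transpose_mat U * conj_diag n U f * V t = mat_diag n f * W t"
    proof -
      have "transpose_mat U * conj_diag n U f * V t = (transpose_mat U * U) * mat_diag n f * W t"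
        unfolding W_def conj_diag_def using Uc(1,2) Vc(1,2) by (simp add: assoc)
      thus ?thesis using Uc by simp
    qed
    have 3: "transpose_mat U * (t \<cdot>\<^sub>m Ht t) * V t = t \<cdot>\<^sub>m (K t * W t)"
    proof -
      have "K t * W t = transpose_mat U * Ht t * (U * transpose_mat U) * V t"
        unfolding W_def K_def using Uc(1,2) Vc(1,2) Hc(1)[OF t] by (simp add: assoc)
      thus ?thesis using Uc Vc Hc(1)[OF t]
        by (simp add: mult_smult_distrib[of _ n n _ n] mult_smult_assoc_mat[of _ n n _ n])
    qed
    have "W t * mat_diag n (g t) = mat_diag n f * W t + t \<cdot>\<^sub>m (K t * W t)"
      unfolding 1[symmetric] 2[symmetric] 3[symmetric] eq[symmetric] using Uc Vc Hc(1)[OF t]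
      by (simp add: mult_add_distrib_mat[of _ n n _ n] add_mult_distrib_mat[of _ n n _ _ n])
    hence "(W t * mat_diag n (g t)) $$ (i,j) = (mat_diag n f * W t + t \<cdot>\<^sub>m (K t * W t)) $$ (i,j)" for i by simp
    moreover have "(W t * mat_diag n (g t)) $$ (i,j) = W t $$ (i,j) * g t j" if "i < n" for i
      using that j by (simp add: mat_diag_mult_right[OF Wc])
    moreover have "(mat_diag n f * W t + t \<cdot>\<^sub>m (K t * W t)) $$ (i,j)
      = f i * W t $$ (i,j) + t * (\<Sum>l<n. K t $$ (i,l) * W t $$ (l,j))" if "i < n" for i
    proof -
      have "(mat_diag n f * W t + t \<cdot>\<^sub>m (K t * W t)) $$ (i,j)
        = (mat_diag n f * W t) $$ (i,j) + t * (K t * W t) $$ (i,j)"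
        using that j Wc Kc by (simp del: index_mult_mat(1))
      thus ?thesis using that j by (simp add: mat_diag_mult_left[OF Wc] index_mult_sum[OF Kc Wc] del: index_mult_mat(1))
    qed
    ultimately show ?case by (simp add: algebra_simps)
  qed
  have glim: "((\<lambda>t. g t j) \<longlongrightarrow> f j) (at_right 0)"
  proof (rule LIM_zero_cancel, rule null_limit_comparison)
    have "((\<lambda>t. 2 * real n * (t * (\<Sum>b<n. \<Sum>a<n. \<bar>Ht t $$ (a,b)\<bar>))) \<longlongrightarrow> 2 * real n * (0 * (\<Sum>b<n. \<Sum>a<n. \<bar>H $$ (a,b)\<bar>))) (at_right 0)"
      by (intro tendsto_intros lim) auto
    thus "((\<lambda>t. 2 * real n * (t * (\<Sum>b<n. \<Sum>a<n. \<bar>Ht t $$ (a,b)\<bar>))) \<longlongrightarrow> 0) (at_right 0)" by simp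
    show "\<forall>\<^sub>F t in at_right 0. \<bar>g t j - f j\<bar> \<le> 2 * real n * (t * (\<Sum>b<n. \<Sum>a<n. \<bar>Ht t $$ (a,b)\<bar>))"
      using ev pos
    proof eventually_elim
      case (elim t)
      have "conj_diag n (V t) (g t) - conj_diag n U f = t \<cdot>\<^sub>m Ht t"
        using elim Hc(1)[OF elim(2)] Uc
        by (intro eq_matI) (auto simp: carrier_matD[OF conj_diag_carrier] dest!: sym[of "_ + _"])
      hence "\<bar>g t j - f j\<bar> \<le> 2 * real n * (\<Sum>b<n. \<Sum>a<n. \<bar>(t \<cdot>\<^sub>m Ht t) $$ (a,b)\<bar>)"
        unfolding \<open>_ = t \<cdot>\<^sub>m Ht t\<close>[symmetric]
        by (intro eigenvalue_perturbation[OF U _ f]) (use elim j in auto)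
      also have "(\<Sum>b<n. \<Sum>a<n. \<bar>(t \<cdot>\<^sub>m Ht t) $$ (a,b)\<bar>) = t * (\<Sum>b<n. \<Sum>a<n. \<bar>Ht t $$ (a,b)\<bar>)"
        unfolding sum_distrib_left using Hc(1)[OF elim(2)] elim(2) by (intro sum.cong refl) (auto simp: abs_mult)
      finally show ?case .
    qed
  qed
  have offdiag: "((\<lambda>t. W t $$ (i,j)) \<longlongrightarrow> 0) (at_right 0)" if i: "i < n" "i \<noteq> j" for i
  proof -
    have ne: "f j - f i \<noteq> 0" using simple[OF i(1) j i(2)] by simp
    have gl: "((\<lambda>t. g t j - f i) \<longlongrightarrow> f j - f i) (at_right 0)" by (intro tendsto_intros glim)
    have num: "((\<lambda>t. (g t j - f i) * W t $$ (i,j)) \<longlongrightarrow> 0) (at_right 0)"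
    proof (rule null_limit_comparison)
      have "((\<lambda>t. t * (\<Sum>l<n. \<bar>K t $$ (i,l)\<bar>)) \<longlongrightarrow> 0 * (\<Sum>l<n. \<bar>(transpose_mat U * H * U) $$ (i,l)\<bar>)) (at_right 0)"
        using i by (intro tendsto_intros Klim) auto
      thus "((\<lambda>t. t * (\<Sum>l<n. \<bar>K t $$ (i,l)\<bar>)) \<longlongrightarrow> 0) (at_right 0)" by simp
      show "\<forall>\<^sub>F t in at_right 0. \<bar>(g t j - f i) * W t $$ (i,j)\<bar> \<le> t * (\<Sum>l<n. \<bar>K t $$ (i,l)\<bar>)"
        using evEq evW
      proof eventually_elim
        case (elim t)
        have "\<bar>\<Sum>l<n. K t $$ (i,l) * W t $$ (l,j)\<bar> \<le> (\<Sum>l<n. \<bar>K t $$ (i,l)\<bar>)"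
        proof (rule order_trans[OF sum_abs], rule sum_mono)
          fix l assume "l \<in> {..<n}"
          hence "\<bar>W t $$ (l,j)\<bar> \<le> 1" using orthogonal_entry_le_one elim j by auto
          thus "\<bar>K t $$ (i,l) * W t $$ (l,j)\<bar> \<le> \<bar>K t $$ (i,l)\<bar>"
            unfolding abs_mult by (intro mult_left_le) auto
        qed
        thus ?case using elim i by (simp add: abs_mult)
      qed
    qed
    have "((\<lambda>t. (g t j - f i) * W t $$ (i,j) / (g t j - f i)) \<longlongrightarrow> 0 / (f j - f i)) (at_right 0)"
      by (intro tendsto_divide num gl ne)
    moreover have "\<forall>\<^sub>F t in at_right 0. g t j - f i \<noteq> 0"
      using tendsto_imp_eventually_ne[OF gl ne] .
    hence "\<forall>\<^sub>F t in at_right 0. (g t j - f i) * W t $$ (i,j) / (g t j - f i) = W t $$ (i,j)"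
      by eventually_elim simp
    ultimately show ?thesis by (simp add: Lim_transform_eventually)
  qed
  have diag: "((\<lambda>t. (W t $$ (j,j))\<^sup>2) \<longlongrightarrow> 1) (at_right 0)"
  proof (rule Lim_transform_eventually)
    have "((\<lambda>t. 1 - (\<Sum>i\<in>{..<n}-{j}. (W t $$ (i,j))\<^sup>2)) \<longlongrightarrow> 1 - (\<Sum>i\<in>{..<n}-{j}. 0\<^sup>2)) (at_right 0)"
      by (intro tendsto_intros offdiag) auto
    thus "((\<lambda>t. 1 - (\<Sum>i\<in>{..<n}-{j}. (W t $$ (i,j))\<^sup>2)) \<longlongrightarrow> 1) (at_right 0)" by simp
    show "\<forall>\<^sub>F t in at_right 0. 1 - (\<Sum>i\<in>{..<n}-{j}. (W t $$ (i,j))\<^sup>2) = (W t $$ (j,j))\<^sup>2"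
      using evW
    proof eventually_elim
      case (elim t)
      hence Wc: "W t \<in> carrier_mat n n" "transpose_mat (W t) \<in> carrier_mat n n" "transpose_mat (W t) * W t = 1\<^sub>m n"
        by (auto simp: orthogonal_matrix_def)
      have "(\<Sum>i<n. (W t $$ (i,j))\<^sup>2) = (transpose_mat (W t) * W t) $$ (j,j)"
        unfolding index_mult_sum[OF Wc(2,1) j j] using Wc j by (intro sum.cong refl) (auto simp: power2_eq_square)
      also have "\<dots> = 1" using Wc j by simp
      finally show ?case using j by (simp add: sum.remove[of "{..<n}" j])
    qed
  qed
  have num: "((\<lambda>t. \<Sum>l<n. K t $$ (j,l) * (W t $$ (l,j) * W t $$ (j,j))) \<longlongrightarrow> (\<Sum>l<n. (transpose_mat U * H * U) $$ (j,l) * (if l = j then 1 else 0))) (at_right 0)"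
  proof (intro tendsto_sum tendsto_mult Klim j)
    fix l assume "l \<in> {..<n}"
    thus l: "l < n" by simp
    show "((\<lambda>t. W t $$ (l,j) * W t $$ (j,j)) \<longlongrightarrow> (if l = j then 1 else 0)) (at_right 0)"
    proof (cases "l = j")
      case True
      thus ?thesis using diag by (simp add: power2_eq_square)
    next
      case False
      have "((\<lambda>t. W t $$ (l,j) * W t $$ (j,j)) \<longlongrightarrow> 0) (at_right 0)"
      proof (rule null_limit_comparison)
        show "((\<lambda>t. \<bar>W t $$ (l,j)\<bar>) \<longlongrightarrow> 0) (at_right 0)" using offdiag[OF l False] by (rule tendsto_rabs_zero)
        show "\<forall>\<^sub>F t in at_right 0. \<bar>W t $$ (l,j) * W t $$ (j,j)\<bar> \<le> \<bar>W t $$ (l,j)\<bar>"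
          using evW
        proof eventually_elim
          case (elim t)
          hence "\<bar>W t $$ (j,j)\<bar> \<le> 1" using orthogonal_entry_le_one j by auto
          thus ?case unfolding abs_mult by (intro mult_left_le) auto
        qed
      qed
      thus ?thesis using False by simp
    qed
  qed
  \<comment> \<open>The equation for \<open>i = j\<close>, multiplied by \<open>W\<^sub>j\<^sub>j\<close> and solved for the difference quotient.\<close>
  have "((\<lambda>t. (\<Sum>l<n. K t $$ (j,l) * (W t $$ (l,j) * W t $$ (j,j))) / (W t $$ (j,j))\<^sup>2)
    \<longlongrightarrow> (\<Sum>l<n. (transpose_mat U * H * U) $$ (j,l) * (if l = j then 1 else 0)) / 1) (at_right 0)"
    by (intro tendsto_divide num diag) simp
  moreover have "(\<Sum>l<n. (transpose_mat U * H * U) $$ (j,l) * (if l = j then 1 else 0)) = (transpose_mat U * H * U) $$ (j,j)"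
    using j by (simp add: if_distrib cong: if_cong)
  moreover have "\<forall>\<^sub>F t in at_right 0. (\<Sum>l<n. K t $$ (j,l) * (W t $$ (l,j) * W t $$ (j,j))) / (W t $$ (j,j))\<^sup>2 = (g t j - f j) / t"
    using evEq evW tendsto_imp_eventually_ne[OF diag, of 0, simplified]
  proof eventually_elim
    case (elim t)
    have "t * (\<Sum>l<n. K t $$ (j,l) * (W t $$ (l,j) * W t $$ (j,j))) = t * (\<Sum>l<n. K t $$ (j,l) * W t $$ (l,j)) * W t $$ (j,j)"
      by (simp add: sum_distrib_left sum_distrib_right mult_ac)
    also have "\<dots> = (g t j - f j) * (W t $$ (j,j))\<^sup>2" using elim(1) j by (simp add: power2_eq_square)
    finally show ?case using elim by (simp add: field_simps)
  qed
  ultimately show ?thesis by (simp add: Lim_transform_eventually)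
qed

section \<open>The smallest trace of the square root for given diagonal blocks\<close>

text \<open>
  Summation by parts.
\<close>
lemma abel_sum_lower_bound:
  fixes c x :: "nat \<Rightarrow> real"
  assumes c: "\<And>i j. i \<le> j \<Longrightarrow> c i \<le> c j" and X: "\<And>k. k \<le> Suc m \<Longrightarrow> (\<Sum>i<k. x i) \<le> 0"
  shows "(\<Sum>i<Suc m. c i * x i) \<ge> c m * (\<Sum>i<Suc m. x i)"
  using X
proof (induction m)
  case (Suc m)
  have "c (Suc m) * (\<Sum>i<Suc m. x i) \<le> c m * (\<Sum>i<Suc m. x i)"
    using c[of m "Suc m"] Suc.prems[of "Suc m"] by (intro mult_right_mono_neg) auto
  also have "\<dots> \<le> (\<Sum>i<Suc m. c i * x i)" using Suc by auto
  finally show ?case by (simp add: algebra_simps)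
qed simp

text \<open>
  The concave function \<open>sqrt\<close> reverses majorization. Each difference \<open>sqrt (a i) - sqrt (b i)\<close> is
  \<open>a i - b i\<close> divided by \<open>sqrt (a i) + sqrt (b i)\<close>; these divisors decrease in \<open>i\<close>, so that summation by
  parts applies.
\<close>
lemma sum_sqrt_majorization:
  fixes a b :: "nat \<Rightarrow> real"
  assumes a: "\<And>i j. i \<le> j \<Longrightarrow> a j \<le> a i" "\<And>i. 0 \<le> a i"
    and b: "\<And>i j. i \<le> j \<Longrightarrow> b j \<le> b i" "\<And>i. 0 \<le> b i"
    and le: "\<And>k. k \<le> d \<Longrightarrow> (\<Sum>i<k. a i) \<le> (\<Sum>i<k. b i)" and eq: "(\<Sum>i<d. a i) = (\<Sum>i<d. b i)"
  shows "(\<Sum>i<d. sqrt (b i)) \<le> (\<Sum>i<d. sqrt (a i))"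
proof (cases d)
  case (Suc m)
  \<comment> \<open>The shift by \<open>e\<close> keeps the divisors positive where both sequences vanish.\<close>
  have shifted: "(\<Sum>i<d. sqrt (b i + e)) \<le> (\<Sum>i<d. sqrt (a i + e))" if e: "e > 0" for e
  proof -
    define c where "c i = 1 / (sqrt (a i + e) + sqrt (b i + e))" for i
    have pos: "sqrt (a i + e) + sqrt (b i + e) > 0" for i
      using e a(2)[of i] b(2)[of i] by (intro add_pos_pos) auto
    have cm: "c i \<le> c j" if "i \<le> j" for i j
      unfolding c_def using a(1)[OF that] b(1)[OF that] pos by (intro divide_left_mono add_mono) auto
    have "c m * (\<Sum>i<Suc m. a i - b i) \<le> (\<Sum>i<Suc m. c i * (a i - b i))"
      using le Suc by (intro abel_sum_lower_bound cm) (auto simp: sum_subtractf)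
    moreover have "(\<Sum>i<Suc m. a i - b i) = 0" using eq Suc by (simp add: sum_subtractf)
    moreover have "c i * (a i - b i) = sqrt (a i + e) - sqrt (b i + e)" for i
    proof -
      have "(sqrt (a i + e) - sqrt (b i + e)) * (sqrt (a i + e) + sqrt (b i + e)) = a i - b i"
        using e a(2)[of i] b(2)[of i] by (simp add: algebra_simps)
      thus ?thesis using pos[of i] unfolding c_def by (simp add: field_simps)
    qed
    ultimately show ?thesis using Suc by (simp add: sum_subtractf del: sum.lessThan_Suc)
  qed
  have "((\<lambda>e. \<Sum>i<d. sqrt (b i + e)) \<longlongrightarrow> (\<Sum>i<d. sqrt (b i + 0))) (at_right 0)"
    "((\<lambda>e. \<Sum>i<d. sqrt (a i + e)) \<longlongrightarrow> (\<Sum>i<d. sqrt (a i + 0))) (at_right 0)"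
    by (intro tendsto_intros)+
  moreover have "\<forall>\<^sub>F e in at_right 0. (\<Sum>i<d. sqrt (b i + e)) \<le> (\<Sum>i<d. sqrt (a i + e))"
    using eventually_at_right_less[of "0::real"] by eventually_elim (rule shifted)
  ultimately have "(\<Sum>i<d. sqrt (b i + 0)) \<le> (\<Sum>i<d. sqrt (a i + 0))"
    by (intro tendsto_le[of "at_right (0::real)"]) auto
  thus ?thesis by simp
qed simp

definition stack :: "real mat \<Rightarrow> real mat \<Rightarrow> real mat" where
  "stack X Y = mat (dim_row X + dim_row Y) (dim_col X)
     (\<lambda>(i,j). if i < dim_row X then X $$ (i,j) else Y $$ (i - dim_row X, j))"

lemma stack_carrier: "X \<in> carrier_mat p m \<Longrightarrow> Y \<in> carrier_mat q m \<Longrightarrow> stack X Y \<in> carrier_mat (p + q) m"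
  by (auto simp: stack_def)

lemma sum_lessThan_add_split:
  fixes f :: "nat \<Rightarrow> real"
  shows "(\<Sum>i<p + q. f i) = (\<Sum>i<p. f i) + (\<Sum>i<q. f (i + p))"
  by (induction q) (auto simp: add_ac)

text \<open>
  The two products of a stacked matrix with its transpose are the mechanism behind both bounds below: one has
  the given diagonal blocks, the other is a sum of Gram matrices, and they share their nonzero eigenvalues.
\<close>
lemma stack_gram:
  assumes X: "X \<in> carrier_mat p m" and Y: "Y \<in> carrier_mat q m"
  shows "transpose_mat (stack X Y) * stack X Y = transpose_mat X * X + transpose_mat Y * Y"
proof (rule eq_matI)
  have St: "stack X Y \<in> carrier_mat (p + q) m" by (rule stack_carrier[OF X Y])
  have Stt: "transpose_mat (stack X Y) \<in> carrier_mat m (p + q)" using St by simp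
  have Xt: "transpose_mat X \<in> carrier_mat m p" and Yt: "transpose_mat Y \<in> carrier_mat m q" using X Y by auto
  fix i j assume "i < dim_row (transpose_mat X * X + transpose_mat Y * Y)" "j < dim_col (transpose_mat X * X + transpose_mat Y * Y)"
  hence ij: "i < m" "j < m" using X Y by auto
  have "(transpose_mat (stack X Y) * stack X Y) $$ (i,j) = (\<Sum>l<p + q. stack X Y $$ (l,i) * stack X Y $$ (l,j))"
    unfolding index_mult_sum[OF Stt St ij] using St ij by (intro sum.cong refl) auto
  also have "\<dots> = (\<Sum>l<p. X $$ (l,i) * X $$ (l,j)) + (\<Sum>l<q. Y $$ (l,i) * Y $$ (l,j))"
    unfolding sum_lessThan_add_split using X Y ij
    by (intro arg_cong2[of _ _ _ _ "(+)"] sum.cong refl) (auto simp: stack_def)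
  also have "\<dots> = (transpose_mat X * X) $$ (i,j) + (transpose_mat Y * Y) $$ (i,j)"
    unfolding index_mult_sum[OF Xt X ij] index_mult_sum[OF Yt Y ij] using X Y ij
    by (intro arg_cong2[of _ _ _ _ "(+)"] sum.cong refl) auto
  finally show "(transpose_mat (stack X Y) * stack X Y) $$ (i,j) = (transpose_mat X * X + transpose_mat Y * Y) $$ (i,j)"
    using X Y ij by simp
qed (use X Y in \<open>auto simp: stack_def\<close>)

lemma stack_outer:
  assumes X: "X \<in> carrier_mat p m" and Y: "Y \<in> carrier_mat q m"
  shows "stack X Y * transpose_mat (stack X Y) = four_block_mat (X * transpose_mat X) (X * transpose_mat Y)
    (Y * transpose_mat X) (Y * transpose_mat Y)"
proof (rule eq_matI)
  have St: "stack X Y \<in> carrier_mat (p + q) m" by (rule stack_carrier[OF X Y])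
  let ?F = "four_block_mat (X * transpose_mat X) (X * transpose_mat Y) (Y * transpose_mat X) (Y * transpose_mat Y)"
  fix i j assume "i < dim_row ?F" "j < dim_col ?F"
  hence ij: "i < p + q" "j < p + q" using X Y by auto
  have r: "row (stack X Y) i = (if i < p then row X i else row Y (i - p))" if "i < p + q" for i
    using that X Y by (intro eq_vecI) (auto simp: stack_def)
  show "(stack X Y * transpose_mat (stack X Y)) $$ (i,j) = ?F $$ (i,j)"
    using ij X Y St by (simp add: r)
qed (use X Y in \<open>auto simp: stack_def\<close>)

lemma ul_block_carrier: "ul_block r c A \<in> carrier_mat r c"
  by (auto simp: ul_block_def split_block_def Let_def)

lemma lr_block_carrier: "A \<in> carrier_mat (r + n) (c + m) \<Longrightarrow> lr_block r c A \<in> carrier_mat n m"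
  by (auto simp: lr_block_def split_block_def Let_def)

lemma ul_block_index: "i < r \<Longrightarrow> j < c \<Longrightarrow> ul_block r c A $$ (i,j) = A $$ (i,j)"
  by (auto simp: ul_block_def split_block_def Let_def)

lemma lr_block_index:
  "A \<in> carrier_mat (r + n) (c + m) \<Longrightarrow> i < n \<Longrightarrow> j < m \<Longrightarrow> lr_block r c A $$ (i,j) = A $$ (i + r, j + c)"
  by (auto simp: lr_block_def split_block_def Let_def)

lemma ul_block_four_block:
  "A \<in> carrier_mat p p \<Longrightarrow> D \<in> carrier_mat q q \<Longrightarrow> ul_block p p (four_block_mat A B C D) = A"
  by (rule eq_matI) (auto simp: ul_block_index carrier_matD[OF ul_block_carrier])

lemma lr_block_four_block:
  assumes "A \<in> carrier_mat p p" "D \<in> carrier_mat q q"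
  shows "lr_block p p (four_block_mat A B C D) = D"
proof -
  have F: "four_block_mat A B C D \<in> carrier_mat (p + q) (p + q)" using assms by simp
  show ?thesis using assms lr_block_carrier[OF F]
    by (intro eq_matI) (auto simp: lr_block_index[OF F])
qed

lemma trace_block_split:
  assumes "A \<in> carrier_mat (p + q) (p + q)"
  shows "mat_trace A = mat_trace (ul_block p p A) + mat_trace (lr_block p p A)"
  unfolding mat_trace_sum[OF assms] mat_trace_sum[OF ul_block_carrier] mat_trace_sum[OF lr_block_carrier[OF assms]]
  by (simp add: sum_lessThan_add_split ul_block_index lr_block_index[OF assms])

lemma inverse_sqrt_sandwich: "x > 0 \<Longrightarrow> 1 / sqrt x * x * (1 / sqrt x) = 1"
  by (simp add: field_simps)

text \<open>
  The matrices \<open>A A\<^sup>T\<close> and \<open>A\<^sup>T A\<close> have the same nonzero eigenvalues. The witness is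
  \<open>B = diag(f)\<^sup>-\<^sup>1\<^sup>/\<^sup>2 U\<^sup>T A\<close>, and the result has the form which \<open>ky_fan_inequality\<close> treats.
\<close>
lemma gram_coisometry_factorization:
  assumes A: "A \<in> carrier_mat p d" and U: "orthogonal_matrix p U"
    and AA: "A * transpose_mat A = conj_diag p U f" and f: "\<And>i. i < p \<Longrightarrow> f i > 0"
  obtains B where "B \<in> carrier_mat p d" "B * transpose_mat B = 1\<^sub>m p"
    "transpose_mat A * A = transpose_mat B * mat_diag p f * B"
proof -
  define N where "N = mat_diag p (\<lambda>i. 1 / sqrt (f i))"
  have N: "N \<in> carrier_mat p p" "transpose_mat N = N" by (auto simp: N_def)
  have Uc: "U \<in> carrier_mat p p" "transpose_mat U \<in> carrier_mat p p" "U * transpose_mat U = 1\<^sub>m p"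
    using U by (auto simp: orthogonal_matrix_def)
  have At: "transpose_mat A \<in> carrier_mat d p" using A by simp
  have NU: "N * transpose_mat U \<in> carrier_mat p p" using N Uc by simp
  define B where "B = N * transpose_mat U * A"
  have B: "B \<in> carrier_mat p d" unfolding B_def by (rule mult_carrier_mat[OF NU A])
  have Bt: "transpose_mat B = transpose_mat A * (U * N)"
    unfolding B_def transpose_mult[OF NU A] using N Uc by (simp add: transpose_mult[of _ p p _ p])
  have UN: "U * N \<in> carrier_mat p p" using N Uc by simp
  note a = assoc_mult_mat[of _ p p _ p _ p] assoc_mult_mat[of _ p p _ p _ d] assoc_mult_mat[of _ p p _ d _ p]
    assoc_mult_mat[of _ d p _ p _ p] assoc_mult_mat[of _ d p _ p _ d] assoc_mult_mat[of _ p d _ p _ p]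
  have one: "mat_diag p h = 1\<^sub>m p" if "\<And>i. i < p \<Longrightarrow> h i = (1::real)" for h
    using mat_diag_cong[of p h "\<lambda>_. 1"] that by simp
  have "B * transpose_mat B = N * (transpose_mat U * (A * transpose_mat A) * U) * N"
    unfolding Bt unfolding B_def using N(1) Uc(1,2) A At UN NU mult_carrier_mat[OF At UN]
      mult_carrier_mat[OF A At] mult_carrier_mat[OF At Uc(1)] mult_carrier_mat[OF At N(1)] mult_carrier_mat[OF Uc(2) A]
    by (simp add: a)
  also have "\<dots> = N * mat_diag p f * N" unfolding AA orthogonal_conj_transpose[OF U] ..
  also have "\<dots> = 1\<^sub>m p"
    unfolding N_def mat_diag_diag by (intro one inverse_sqrt_sandwich f)
  finally have BB: "B * transpose_mat B = 1\<^sub>m p" .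
  have NfN: "N * mat_diag p f * N = 1\<^sub>m p"
    unfolding N_def mat_diag_diag by (intro one inverse_sqrt_sandwich f)
  have "transpose_mat B * mat_diag p f * B = transpose_mat A * (U * (N * mat_diag p f * N) * transpose_mat U) * A"
    unfolding Bt unfolding B_def using N(1) Uc(1,2) A At UN NU mult_carrier_mat[OF At UN]
      mult_carrier_mat[OF A At] mult_carrier_mat[OF At Uc(1)] mult_carrier_mat[OF At N(1)] mult_carrier_mat[OF Uc(2) A]
      mult_carrier_mat[OF N(1) mult_carrier_mat[OF Uc(2) A]]
      mult_carrier_mat[OF mat_diag_dim[of p f] mult_carrier_mat[OF N(1) mult_carrier_mat[OF Uc(2) A]]]
      mult_carrier_mat[OF N(1) mult_carrier_mat[OF mat_diag_dim[of p f] mult_carrier_mat[OF N(1) mult_carrier_mat[OF Uc(2) A]]]]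
    by (simp add: a)
  also have "\<dots> = transpose_mat A * A" unfolding NfN using Uc At by simp
  finally show ?thesis using that[OF B BB] by simp
qed

text \<open>
  Let \<open>A\<close> be the square root of \<open>S\<close>, with upper rows \<open>A1\<close> and lower rows \<open>A2\<close>. Then
  \<open>S = A\<^sup>T A = A1\<^sup>T A1 + A2\<^sup>T A2\<close>, and the nonzero eigenvalues of the summands are those of the diagonal blocks
  \<open>A1 A1\<^sup>T\<close> and \<open>A2 A2\<^sup>T\<close>. By the Ky Fan inequality the eigenvalues of \<open>S\<close> are majorized by \<open>f1 + f2\<close>.
\<close>
lemma trace_sqrt_block_lower_bound:
  assumes U1: "orthogonal_matrix p U1" and U2: "orthogonal_matrix q U2"
    and f1: "\<And>i j. i \<le> j \<Longrightarrow> f1 j \<le> f1 i" "\<And>i. 0 \<le> f1 i" "\<And>i. i < p \<Longrightarrow> 0 < f1 i"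
    and f2: "\<And>i j. i \<le> j \<Longrightarrow> f2 j \<le> f2 i" "\<And>i. 0 \<le> f2 i" "\<And>i. i < q \<Longrightarrow> 0 < f2 i"
    and f10: "\<And>i. p \<le> i \<Longrightarrow> f1 i = 0" and f20: "\<And>i. q \<le> i \<Longrightarrow> f2 i = 0"
    and S: "S \<in> psd_mats (p + q)" and S1: "ul_block p p S = conj_diag p U1 f1" and S2: "lr_block p p S = conj_diag q U2 f2"
  shows "(\<Sum>i<p + q. sqrt (f1 i + f2 i)) \<le> mat_trace (mat_sqrt S)"
proof -
  let ?d = "p + q"
  have Sc: "S \<in> carrier_mat ?d ?d" using S by (auto simp: psd_mats_def sym_mats_def)
  define A where "A = mat_sqrt S"
  have A: "A \<in> carrier_mat ?d ?d" "transpose_mat A = A" "A * A = S"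
    using mat_sqrt_psd[OF S] by (auto simp: A_def psd_mats_def sym_mats_def)
  define A1 where "A1 = mat p ?d (\<lambda>(i,j). A $$ (i,j))"
  define A2 where "A2 = mat q ?d (\<lambda>(i,j). A $$ (i + p,j))"
  have A1: "A1 \<in> carrier_mat p ?d" and A2: "A2 \<in> carrier_mat q ?d" by (auto simp: A1_def A2_def)
  have As: "stack A1 A2 = A" using A by (intro eq_matI) (auto simp: stack_def A1_def A2_def)
  have outer: "S = four_block_mat (A1 * transpose_mat A1) (A1 * transpose_mat A2) (A2 * transpose_mat A1) (A2 * transpose_mat A2)"
    using stack_outer[OF A1 A2] unfolding As A(2,3) .
  have inner: "S = transpose_mat A1 * A1 + transpose_mat A2 * A2"
    using stack_gram[OF A1 A2] unfolding As A(2,3) .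
  have AA: "A1 * transpose_mat A1 = conj_diag p U1 f1" "A2 * transpose_mat A2 = conj_diag q U2 f2"
  proof -
    have c: "A1 * transpose_mat A1 \<in> carrier_mat p p" "A2 * transpose_mat A2 \<in> carrier_mat q q"
      using mult_carrier_mat[OF A1, of "transpose_mat A1" p] mult_carrier_mat[OF A2, of "transpose_mat A2" q] A1 A2 by auto
    show "A1 * transpose_mat A1 = conj_diag p U1 f1" "A2 * transpose_mat A2 = conj_diag q U2 f2"
      using S1 S2 unfolding outer ul_block_four_block[OF c] lr_block_four_block[OF c] by auto
  qed
  obtain B1 where B1: "B1 \<in> carrier_mat p ?d" "B1 * transpose_mat B1 = 1\<^sub>m p"
    "transpose_mat A1 * A1 = transpose_mat B1 * mat_diag p f1 * B1"
    using gram_coisometry_factorization[OF A1 U1 AA(1) f1(3)] by blast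
  obtain B2 where B2: "B2 \<in> carrier_mat q ?d" "B2 * transpose_mat B2 = 1\<^sub>m q"
    "transpose_mat A2 * A2 = transpose_mat B2 * mat_diag q f2 * B2"
    using gram_coisometry_factorization[OF A2 U2 AA(2) f2(3)] by blast
  obtain V L where e: "eigendecomposition ?d S V L"
    using spectral_theorem[of S ?d] S by (auto simp: psd_mats_def)
  note eV = eigendecomposition_conj_diag[OF e]
  define g where "g i = (if i < ?d then L $$ (i,i) else 0)" for i
  have V: "orthogonal_matrix ?d V" by (rule eV(1))
  have Sg: "S = conj_diag ?d V g"
    unfolding eV(2) by (rule conj_diag_cong) (simp add: g_def)
  have g0: "0 \<le> g i" for i
    using psd_eigenvalues_nonneg[of ?d V g i] S V unfolding Sg[symmetric] by (cases "i < ?d") (auto simp: g_def)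
  have gm: "g j \<le> g i" if "i \<le> j" for i j
    using eV(4)[OF that] g0[of i] that by (auto simp: g_def)
  have Vc: "V \<in> carrier_mat ?d ?d" "transpose_mat V \<in> carrier_mat ?d ?d" using V by (auto simp: orthogonal_matrix_def)
  have gram_c: "transpose_mat A1 * A1 \<in> carrier_mat ?d ?d" "transpose_mat A2 * A2 \<in> carrier_mat ?d ?d"
    using A1 A2 mult_carrier_mat[of "transpose_mat A1" ?d p A1 ?d] mult_carrier_mat[of "transpose_mat A2" ?d q A2 ?d] by auto
  have partial: "(\<Sum>i<k. g i) \<le> (\<Sum>i<k. f1 i + f2 i)" if k: "k \<le> ?d" for k
  proof -
    let ?X1 = "transpose_mat V * (transpose_mat A1 * A1) * V" and ?X2 = "transpose_mat V * (transpose_mat A2 * A2) * V"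
    have Xc: "?X1 \<in> carrier_mat ?d ?d" "?X2 \<in> carrier_mat ?d ?d"
      by (intro square_mult_carrier Vc gram_c)+
    have "mat_diag ?d g = transpose_mat V * S * V"
      unfolding Sg orthogonal_conj_transpose[OF V] ..
    also have "\<dots> = ?X1 + ?X2"
      unfolding inner using Vc gram_c
      by (simp add: mult_add_distrib_mat[of _ ?d ?d _ ?d] add_mult_distrib_mat[of _ ?d ?d _ _ ?d])
    finally have eq: "mat_diag ?d g = ?X1 + ?X2" .
    have "g j = ?X1 $$ (j,j) + ?X2 $$ (j,j)" if "j < ?d" for j
    proof -
      have "g j = mat_diag ?d g $$ (j,j)" using that by (simp add: mat_diag_def)
      thus ?thesis unfolding eq using that Xc by (subst (asm) index_add_mat) auto
    qed
    hence "(\<Sum>i<k. g i) = (\<Sum>i<k. ?X1 $$ (i,i) + ?X2 $$ (i,i))" using k by (intro sum.cong refl) auto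
    also have "\<dots> = (\<Sum>i<k. ?X1 $$ (i,i)) + (\<Sum>i<k. ?X2 $$ (i,i))" by (rule sum.distrib)
    also have "\<dots> \<le> (\<Sum>i<k. f1 i) + (\<Sum>i<k. f2 i)"
      unfolding B1(3) B2(3)
      by (intro add_mono ky_fan_inequality[OF B1(1,2) V f1(1,2) k] ky_fan_inequality[OF B2(1,2) V f2(1,2) k])
    finally show ?thesis by (simp add: sum.distrib)
  qed
  have total: "(\<Sum>i<?d. g i) = (\<Sum>i<?d. f1 i + f2 i)"
  proof -
    have "(\<Sum>i<?d. g i) = mat_trace S" unfolding Sg conj_diag_trace[OF V] ..
    also have "\<dots> = (\<Sum>i<p. f1 i) + (\<Sum>i<q. f2 i)"
      unfolding trace_block_split[OF Sc] S1 S2 conj_diag_trace[OF U1] conj_diag_trace[OF U2] ..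
    also have "(\<Sum>i<p. f1 i) = (\<Sum>i<?d. f1 i)" using f10 by (intro sum.mono_neutral_left) auto
    also have "(\<Sum>i<q. f2 i) = (\<Sum>i<?d. f2 i)" using f20 by (intro sum.mono_neutral_left) auto
    finally show ?thesis by (simp add: sum.distrib)
  qed
  have "mat_trace (mat_sqrt S) = (\<Sum>i<?d. sqrt (g i))"
    unfolding Sg using g0 by (simp add: mat_sqrt_conj_diag[OF V] conj_diag_trace[OF V])
  moreover have "(\<Sum>i<?d. sqrt (f1 i + f2 i)) \<le> (\<Sum>i<?d. sqrt (g i))"
    by (rule sum_sqrt_majorization[OF gm g0 _ _ partial total]) (auto intro: add_mono add_nonneg_nonneg f1 f2)
  ultimately show ?thesis by simp
qed

text \<open>
  If \<open>Y\<^sup>T Y = diag(g)\<close>, then the root of \<open>Y Y\<^sup>T\<close> is \<open>Y diag(g)\<^sup>-\<^sup>1\<^sup>/\<^sup>2 Y\<^sup>T\<close>.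
\<close>
lemma outer_product_sqrt:
  assumes Y: "Y \<in> carrier_mat d q" and YY: "transpose_mat Y * Y = mat_diag q g" and g: "\<And>i. i < q \<Longrightarrow> g i > 0"
  shows "Y * transpose_mat Y \<in> psd_mats d" "mat_trace (mat_sqrt (Y * transpose_mat Y)) = (\<Sum>i<q. sqrt (g i))"
proof -
  have Yt: "transpose_mat Y \<in> carrier_mat q d" using Y by simp
  define N where "N = mat_diag q (\<lambda>i. 1 / sqrt (g i))"
  have N: "N \<in> carrier_mat q q" by (simp add: N_def)
  have Npsd: "N \<in> psd_mats q"
    using conj_diag_psd[of "1\<^sub>m q" q "\<lambda>i. 1 / sqrt (g i)"] g by (auto simp: N_def conj_diag_one_eq less_imp_le)
  have Ipsd: "1\<^sub>m q \<in> psd_mats q"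
    using conj_diag_psd[of "1\<^sub>m q" q "\<lambda>i. 1"] by (auto simp: conj_diag_one_eq)
  show "Y * transpose_mat Y \<in> psd_mats d"
    using psd_congruence[OF Ipsd Yt] Y by simp
  define R where "R = Y * N * transpose_mat Y"
  have R: "R \<in> psd_mats d" using psd_congruence[OF Npsd Yt] by (simp add: R_def)
  note a = assoc_mult_mat[of _ d q _ q _ d] assoc_mult_mat[of _ q q _ q _ d] assoc_mult_mat[of _ d q _ q _ q]
    assoc_mult_mat[of _ q q _ q _ q] assoc_mult_mat[of _ d q _ d _ q] assoc_mult_mat[of _ d q _ d _ d]
    assoc_mult_mat[of _ q d _ q _ d] assoc_mult_mat[of _ q q _ d _ d] assoc_mult_mat[of _ q d _ q _ q]
    assoc_mult_mat[of _ q q _ d _ q]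
  have YN: "Y * N \<in> carrier_mat d q" by (rule mult_carrier_mat[OF Y N])
  have NYt: "N * transpose_mat Y \<in> carrier_mat q d" by (rule mult_carrier_mat[OF N Yt])
  have "R * R = Y * (N * (transpose_mat Y * Y) * N) * transpose_mat Y"
    unfolding R_def using Y Yt N YN NYt mult_carrier_mat[OF Yt Y] mult_carrier_mat[OF Y NYt] mult_carrier_mat[OF Yt YN]
      mult_carrier_mat[OF Yt mult_carrier_mat[OF Y NYt]]
    by (simp add: a)
  also have "N * (transpose_mat Y * Y) * N = 1\<^sub>m q"
    unfolding YY N_def mat_diag_diag mat_diag_one[symmetric] using g
    by (intro mat_diag_cong inverse_sqrt_sandwich)
  finally have "R * R = Y * transpose_mat Y" using Y by simp
  hence "mat_sqrt (Y * transpose_mat Y) = R" using mat_sqrt_eqI[OF R] by simp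
  moreover have "mat_trace R = mat_trace (transpose_mat Y * (Y * N))"
    unfolding R_def by (rule mat_trace_mult_comm[OF YN Yt])
  moreover have "transpose_mat Y * (Y * N) = mat_diag q (\<lambda>i. g i * (1 / sqrt (g i)))"
    using Y Yt N assoc_mult_mat[OF Yt Y N] by (simp add: YY N_def)
  moreover have "mat_trace (mat_diag q (\<lambda>i. g i * (1 / sqrt (g i)))) = (\<Sum>i<q. sqrt (g i))"
    using g by (auto simp: mat_trace_def mat_diag_def real_div_sqrt less_imp_le intro!: sum.cong)
  ultimately show "mat_trace (mat_sqrt (Y * transpose_mat Y)) = (\<Sum>i<q. sqrt (g i))" by simp
qed

text \<open>
  Equality in \<open>trace_sqrt_block_lower_bound\<close> holds for the coupling that pairs the eigenvectors of both
  blocks in the order of their eigenvalues. It is \<open>Y Y\<^sup>T\<close> for the stack \<open>Y\<close> of \<open>U1 diag(f1)\<^sup>1\<^sup>/\<^sup>2 P\<close> and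
  \<open>U2 diag(f2)\<^sup>1\<^sup>/\<^sup>2\<close>, where \<open>P\<close> is the rectangular identity, and \<open>Y\<^sup>T Y\<close> is diagonal with entries \<open>f1 + f2\<close>.
\<close>
lemma comonotone_coupling:
  assumes pq: "p \<le> q" and U1: "orthogonal_matrix p U1" and U2: "orthogonal_matrix q U2"
    and f1: "\<And>i. 0 \<le> f1 i" "\<And>i. p \<le> i \<Longrightarrow> f1 i = 0" and f2: "\<And>i. i < q \<Longrightarrow> 0 < f2 i"
    and Psi: "Psi = U1 * mat_diag p (\<lambda>i. sqrt (f1 i)) * ul_block p q (1\<^sub>m (p + q)) * mat_diag q (\<lambda>i. sqrt (f2 i)) * transpose_mat U2"
    and M: "M = four_block_mat (conj_diag p U1 f1) Psi (transpose_mat Psi) (conj_diag q U2 f2)"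
  shows "M \<in> psd_mats (p + q)" "mat_trace (mat_sqrt M) = (\<Sum>i<q. sqrt (f1 i + f2 i))"
proof -
  define P :: "real mat" where "P = ul_block p q (1\<^sub>m (p + q))"
  define D1 where "D1 = mat_diag p (\<lambda>i. sqrt (f1 i))"
  define D2 where "D2 = mat_diag q (\<lambda>i. sqrt (f2 i))"
  have Uc: "U1 \<in> carrier_mat p p" "transpose_mat U1 \<in> carrier_mat p p" "transpose_mat U1 * U1 = 1\<^sub>m p"
    "U2 \<in> carrier_mat q q" "transpose_mat U2 \<in> carrier_mat q q" "transpose_mat U2 * U2 = 1\<^sub>m q"
    using U1 U2 by (auto simp: orthogonal_matrix_def)
  have P: "P \<in> carrier_mat p q" unfolding P_def by (rule ul_block_carrier)
  have Pt: "transpose_mat P \<in> carrier_mat q p" using P by simp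
  have Pi: "P $$ (i,j) = (if i = j then 1 else 0)" if "i < p" "j < q" for i j
    using that by (simp add: P_def ul_block_index)
  have D: "D1 \<in> carrier_mat p p" "transpose_mat D1 = D1" "D2 \<in> carrier_mat q q" "transpose_mat D2 = D2"
    by (auto simp: D1_def D2_def)
  have PP: "P * transpose_mat P = 1\<^sub>m p"
  proof (rule eq_matI)
    fix i j assume "i < dim_row (1\<^sub>m p)" "j < dim_col (1\<^sub>m p)"
    hence ij: "i < p" "j < p" by auto
    have "(P * transpose_mat P) $$ (i,j) = (\<Sum>l<q. if l = i then (if i = j then 1 else 0) else 0)"
      unfolding index_mult_sum[OF P Pt ij] using ij P by (intro sum.cong refl) (auto simp: Pi)
    thus "(P * transpose_mat P) $$ (i,j) = 1\<^sub>m p $$ (i,j)" using ij pq by simp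
  qed (use P in auto)
  have PDP: "transpose_mat P * mat_diag p f1 * P = mat_diag q f1"
  proof (rule eq_matI)
    fix i j assume "i < dim_row (mat_diag q f1)" "j < dim_col (mat_diag q f1)"
    hence ij: "i < q" "j < q" by auto
    have PtD: "transpose_mat P * mat_diag p f1 \<in> carrier_mat q p" by (rule mult_carrier_mat[OF Pt mat_diag_dim])
    have "(transpose_mat P * mat_diag p f1 * P) $$ (i,j) = (\<Sum>l<p. if l = i then (if i = j then f1 i else 0) else 0)"
      unfolding index_mult_sum[OF PtD P ij] unfolding mat_diag_mult_right[OF Pt]
      using ij P by (intro sum.cong refl) (auto simp: Pi)
    also have "\<dots> = mat_diag q f1 $$ (i,j)" using ij f1(2)[of i] by (auto simp: mat_diag_def)
    finally show "(transpose_mat P * mat_diag p f1 * P) $$ (i,j) = mat_diag q f1 $$ (i,j)" .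
  qed (use P in auto)
  have DD: "D1 * D1 = mat_diag p f1" "D2 * D2 = mat_diag q f2"
    unfolding D1_def D2_def mat_diag_diag using f1 f2 by (auto intro!: mat_diag_cong simp: less_imp_le)
  define X1 where "X1 = U1 * D1 * P"
  define X2 where "X2 = U2 * D2"
  have UD: "U1 * D1 \<in> carrier_mat p p" using Uc D by simp
  have X1: "X1 \<in> carrier_mat p q" unfolding X1_def by (rule mult_carrier_mat[OF UD P])
  have X2: "X2 \<in> carrier_mat q q" unfolding X2_def using Uc D by simp
  have X1t: "transpose_mat X1 = transpose_mat P * (D1 * transpose_mat U1)"
    unfolding X1_def transpose_mult[OF UD P] using Uc D by (simp add: transpose_mult[of _ p p _ p])
  have X2t: "transpose_mat X2 = D2 * transpose_mat U2"
    unfolding X2_def using Uc D by (simp add: transpose_mult[of _ q q _ q])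
  have DU: "D1 * transpose_mat U1 \<in> carrier_mat p p" using Uc D by simp
  have DUU: "D2 * transpose_mat U2 \<in> carrier_mat q q" using Uc D by simp
  note a = assoc_mult_mat[of _ p p _ p _ p] assoc_mult_mat[of _ q q _ q _ q] assoc_mult_mat[of _ p p _ p _ q]
    assoc_mult_mat[of _ p p _ q _ p] assoc_mult_mat[of _ p p _ q _ q] assoc_mult_mat[of _ p q _ p _ p]
    assoc_mult_mat[of _ p q _ q _ q] assoc_mult_mat[of _ q p _ p _ p] assoc_mult_mat[of _ q p _ p _ q]
  note c = mult_carrier_mat[OF Pt DU] mult_carrier_mat[OF D(1) P] mult_carrier_mat[OF P DUU]
    mult_carrier_mat[OF P Pt] mult_carrier_mat[OF D(1) mult_carrier_mat[OF D(1) P]]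
    mult_carrier_mat[OF Uc(1) mult_carrier_mat[OF D(1) P]] mult_carrier_mat[OF P mult_carrier_mat[OF Pt DU]]
    mult_carrier_mat[OF P D(3)]
  have "X1 * transpose_mat X1 = U1 * (D1 * (P * transpose_mat P) * D1) * transpose_mat U1"
    unfolding X1t unfolding X1_def using Uc(1,2) D(1) P Pt UD DU c by (simp add: a)
  hence o11: "X1 * transpose_mat X1 = conj_diag p U1 f1"
    unfolding PP using D by (simp add: DD conj_diag_def)
  have o22: "X2 * transpose_mat X2 = conj_diag q U2 f2"
  proof -
    have "X2 * transpose_mat X2 = U2 * (D2 * D2) * transpose_mat U2"
      unfolding X2t unfolding X2_def using Uc(4,5) D(3) DUU by (simp add: a)
    thus ?thesis by (simp add: DD conj_diag_def)
  qed
  have o12: "X1 * transpose_mat X2 = Psi"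
    unfolding X2t Psi P_def[symmetric] D1_def[symmetric] D2_def[symmetric]
    unfolding X1_def using Uc(1,2,4,5) D(1,3) P UD DUU c mult_carrier_mat[OF UD P] mult_carrier_mat[OF mult_carrier_mat[OF UD P] D(3)]
    by (simp add: a)
  have X1tc: "transpose_mat X1 \<in> carrier_mat q p" and X2tc: "transpose_mat X2 \<in> carrier_mat q q" using X1 X2 by auto
  have o21: "X2 * transpose_mat X1 = transpose_mat Psi"
    unfolding o12[symmetric] transpose_mult[OF X1 X2tc] by simp
  have i1: "transpose_mat X1 * X1 = mat_diag q f1"
  proof -
    have "transpose_mat X1 * X1 = transpose_mat P * (D1 * (transpose_mat U1 * U1) * D1) * P"
      unfolding X1t unfolding X1_def using Uc(1,2) D(1) P Pt UD DU c by (simp add: a)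
    also have "\<dots> = transpose_mat P * mat_diag p f1 * P" unfolding Uc(3) using D by (simp add: DD)
    finally show ?thesis by (simp add: PDP)
  qed
  have i2: "transpose_mat X2 * X2 = mat_diag q f2"
  proof -
    have "transpose_mat X2 * X2 = D2 * (transpose_mat U2 * U2) * D2"
      unfolding X2t unfolding X2_def using Uc(4,5) D(3) DUU by (simp add: a)
    thus ?thesis unfolding Uc(6) using D by (simp add: DD)
  qed
  define Y where "Y = stack X1 X2"
  have Y: "Y \<in> carrier_mat (p + q) q" unfolding Y_def by (rule stack_carrier[OF X1 X2])
  have inner: "transpose_mat Y * Y = mat_diag q (\<lambda>i. f1 i + f2 i)"
    unfolding Y_def stack_gram[OF X1 X2] i1 i2 by (intro eq_matI) (auto simp: mat_diag_def)
  have outer: "Y * transpose_mat Y = M"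
    unfolding Y_def stack_outer[OF X1 X2] o11 o12 o21 o22 M ..
  have pos: "f1 i + f2 i > 0" if "i < q" for i using f1(1)[of i] f2[OF that] by simp
  show "M \<in> psd_mats (p + q)" "mat_trace (mat_sqrt M) = (\<Sum>i<q. sqrt (f1 i + f2 i))"
    using outer_product_sqrt[OF Y inner pos] unfolding outer by auto
qed

section \<open>The coefficient as a quotient of traces\<close>

text \<open>
  The decreasing list of eigenvalues of a positive definite matrix is continued by zeros to all of
  \<open>nat\<close>. Spectra of matrices of different sizes can then be added and compared index by index.
\<close>
definition padded_spectrum :: "nat \<Rightarrow> real mat \<Rightarrow> real mat \<Rightarrow> (nat \<Rightarrow> real) \<Rightarrow> bool" where
  "padded_spectrum n A U f \<longleftrightarrow> orthogonal_matrix n U \<and> A = conj_diag n U f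
     \<and> (\<forall>i j. i \<le> j \<longrightarrow> f j \<le> f i) \<and> (\<forall>i. 0 \<le> f i) \<and> (\<forall>i<n. 0 < f i) \<and> (\<forall>i\<ge>n. f i = 0)"

lemma padded_spectrumD:
  assumes "padded_spectrum n A U f"
  shows "orthogonal_matrix n U" "A = conj_diag n U f" "\<And>i j. i \<le> j \<Longrightarrow> f j \<le> f i" "\<And>i. 0 \<le> f i"
    "\<And>i. i < n \<Longrightarrow> 0 < f i" "\<And>i. n \<le> i \<Longrightarrow> f i = 0"
  using assms unfolding padded_spectrum_def by blast+

lemma eigendecomposition_padded_spectrum:
  assumes e: "eigendecomposition n A U L" and A: "A \<in> pd_mats n"
  shows "padded_spectrum n A U (\<lambda>i. if i < n then L $$ (i,i) else 0)" (is "padded_spectrum n A U ?f")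
proof -
  note eD = eigendecomposition_conj_diag[OF e]
  have Af: "A = conj_diag n U ?f" unfolding eD(2) by (rule conj_diag_cong) simp
  have pos: "0 < ?f i" if "i < n" for i
    using pd_eigenvalues_pos[of n U ?f i] A eD(1) that unfolding Af[symmetric] by simp
  show ?thesis unfolding padded_spectrum_def
    using eD(1,4) Af pos by (auto simp: less_imp_le)
qed

lemma pd_padded_spectrum_exists:
  assumes "A \<in> pd_mats n"
  shows "\<exists>U f. padded_spectrum n A U f"
  using eigendecomposition_padded_spectrum[OF _ assms] spectral_theorem[of A n] assms
  unfolding pd_mats_def by blast

lemma dW2_identity:
  assumes S: "S \<in> psd_mats n"
  shows "dW2 S (1\<^sub>m n) = mat_trace S + n - 2 * mat_trace (mat_sqrt S)"
proof -
  have "mat_sqrt S \<in> carrier_mat n n" using mat_sqrt_psd(1)[OF S] by (auto simp: psd_mats_def sym_mats_def)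
  thus ?thesis using mat_sqrt_psd(2)[OF S] by (simp add: dW2_def mat_trace_one)
qed

text \<open>
  All couplings have the same trace, so the distance to the identity is largest where the trace of the
  square root is smallest.
\<close>
lemma Sup_dW2_coupling:
  assumes pq: "p \<le> q" and S1: "padded_spectrum p S1 U1 f1" and S2: "padded_spectrum q S2 U2 f2"
  shows "(SUP S' \<in> Gamma_set p q S1 S2. dW2 S' (1\<^sub>m (p + q)))
    = mat_trace S1 + mat_trace S2 + (p + q) - 2 * (\<Sum>i<q. sqrt (f1 i + f2 i))"
proof (rule cSup_eq_maximum)
  note s1 = padded_spectrumD[OF S1] and s2 = padded_spectrumD[OF S2]
  have U1: "U1 \<in> carrier_mat p p" and U2: "U2 \<in> carrier_mat q q" using s1(1) s2(1) by (auto simp: orthogonal_matrix_def)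
  have c: "conj_diag p U1 f1 \<in> carrier_mat p p" "conj_diag q U2 f2 \<in> carrier_mat q q" using U1 U2 by auto
  have dW2: "dW2 S' (1\<^sub>m (p + q)) = mat_trace S1 + mat_trace S2 + (p + q) - 2 * mat_trace (mat_sqrt S')"
    if "S' \<in> Gamma_set p q S1 S2" for S'
  proof -
    have S': "S' \<in> psd_mats (p + q)" "ul_block p p S' = S1" "lr_block p p S' = S2"
      using that by (auto simp: Gamma_set_def)
    hence "S' \<in> carrier_mat (p + q) (p + q)" by (auto simp: psd_mats_def sym_mats_def)
    thus ?thesis using S' by (simp add: dW2_identity trace_block_split)
  qed
  define Psi where "Psi = U1 * mat_diag p (\<lambda>i. sqrt (f1 i)) * ul_block p q (1\<^sub>m (p + q)) * mat_diag q (\<lambda>i. sqrt (f2 i)) * transpose_mat U2"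
  define M where "M = four_block_mat (conj_diag p U1 f1) Psi (transpose_mat Psi) (conj_diag q U2 f2)"
  note M = comonotone_coupling[OF pq s1(1) s2(1) s1(4,6) s2(5) Psi_def M_def]
  have MG: "M \<in> Gamma_set p q S1 S2"
    unfolding Gamma_set_def using M(1) s1(2) s2(2)
    by (simp add: M_def ul_block_four_block[OF c] lr_block_four_block[OF c])
  show "mat_trace S1 + mat_trace S2 + (p + q) - 2 * (\<Sum>i<q. sqrt (f1 i + f2 i))
    \<in> (\<lambda>S'. dW2 S' (1\<^sub>m (p + q))) ` Gamma_set p q S1 S2"
    using dW2[OF MG] M(2) MG by (intro image_eqI[of _ _ M]) auto
  fix x assume "x \<in> (\<lambda>S'. dW2 S' (1\<^sub>m (p + q))) ` Gamma_set p q S1 S2"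
  then obtain S' where S': "S' \<in> Gamma_set p q S1 S2" "x = dW2 S' (1\<^sub>m (p + q))" by auto
  have "(\<Sum>i<p + q. sqrt (f1 i + f2 i)) \<le> mat_trace (mat_sqrt S')"
    by (rule trace_sqrt_block_lower_bound[OF s1(1) s2(1) s1(3,4,5) s2(3,4,5) s1(6) s2(6)])
       (use S' s1(2) s2(2) in \<open>auto simp: Gamma_set_def\<close>)
  moreover have "(\<Sum>i<q. sqrt (f1 i + f2 i)) = (\<Sum>i<p + q. sqrt (f1 i + f2 i))"
    using s1(6) s2(6) pq by (intro sum.mono_neutral_left) auto
  ultimately show "x \<le> mat_trace S1 + mat_trace S2 + (p + q) - 2 * (\<Sum>i<q. sqrt (f1 i + f2 i))"
    using dW2[OF S'(1)] S'(2) by simp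
qed

lemma padded_spectrum_psd:
  assumes "padded_spectrum n A U f"
  shows "A \<in> psd_mats n"
  using padded_spectrumD[OF assms] conj_diag_psd[of U n f] by (auto simp: orthogonal_matrix_def)

lemma D1_eq_trace_sqrt_quotient:
  assumes pq: "p \<le> q" and S: "S \<in> psd_mats (p + q)"
    and S1: "padded_spectrum p (ul_block p p S) U1 f1" and S2: "padded_spectrum q (lr_block p p S) U2 f2"
  shows "D1 p q S =
    (mat_trace (mat_sqrt (ul_block p p S)) + mat_trace (mat_sqrt (lr_block p p S)) - mat_trace (mat_sqrt S)) /
    (mat_trace (mat_sqrt (ul_block p p S)) + mat_trace (mat_sqrt (lr_block p p S)) - (\<Sum>i<q. sqrt (f1 i + f2 i)))"
proof -
  have Sc: "S \<in> carrier_mat (p + q) (p + q)" using S by (auto simp: psd_mats_def sym_mats_def)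
  let ?F1 = "mat_trace (mat_sqrt (ul_block p p S))" and ?F2 = "mat_trace (mat_sqrt (lr_block p p S))"
    and ?F = "mat_trace (mat_sqrt S)" and ?G = "\<Sum>i<q. sqrt (f1 i + f2 i)"
  have "D1 p q S = (2 * (?F1 + ?F2 - ?F)) / (2 * (?F1 + ?F2 - ?G))"
    unfolding D1_def Let_def Sup_dW2_coupling[OF pq S1 S2] dW2_identity[OF S] trace_block_split[OF Sc]
      dW2_identity[OF padded_spectrum_psd[OF S1]] dW2_identity[OF padded_spectrum_psd[OF S2]]
    by (intro arg_cong2[of _ _ _ _ "(/)"]) simp_all
  also have "\<dots> = (?F1 + ?F2 - ?F) / (?F1 + ?F2 - ?G)" by (rule mult_divide_mult_cancel_left) simp
  finally show ?thesis .
qed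

text \<open>
  Vectors for a block are extended by zeros.
\<close>
lemma pd_blocks:
  assumes S: "S \<in> pd_mats (p + q)"
  shows "ul_block p p S \<in> pd_mats p" "lr_block p p S \<in> pd_mats q"
proof -
  have Sc: "S \<in> carrier_mat (p + q) (p + q)" and St: "transpose_mat S = S"
    and pd: "\<And>v. v \<in> carrier_vec (p + q) \<Longrightarrow> v \<noteq> 0\<^sub>v (p + q) \<Longrightarrow> 0 < v \<bullet> (S *\<^sub>v v)"
    using S by (auto simp: pd_mats_def sym_mats_def)
  have sym: "S $$ (i,j) = S $$ (j,i)" if "i < p + q" "j < p + q" for i j
    using that Sc by (subst St[symmetric]) auto
  note uc = ul_block_carrier[of p p S] and lc = lr_block_carrier[OF Sc]
  have "0 < v \<bullet> (ul_block p p S *\<^sub>v v)" if v: "v \<in> carrier_vec p" "v \<noteq> 0\<^sub>v p" for v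
  proof -
    let ?w = "v @\<^sub>v 0\<^sub>v q"
    have w: "?w \<in> carrier_vec (p + q)" using v by simp
    obtain i where i: "i < p" "v $ i \<noteq> 0" using v by (metis carrier_vecD eq_vecI index_zero_vec)
    hence "?w $ i \<noteq> 0\<^sub>v (p + q) $ i" using v by simp
    hence "?w \<noteq> 0\<^sub>v (p + q)" by metis
    hence "0 < ?w \<bullet> (S *\<^sub>v ?w)" by (rule pd[OF w])
    also have "\<dots> = v \<bullet> (ul_block p p S *\<^sub>v v)"
      unfolding quadratic_form_sum[OF Sc w] quadratic_form_sum[OF uc v(1)]
      using v by (simp add: sum_lessThan_add_split ul_block_index)
    finally show ?thesis .
  qed
  moreover have "transpose_mat (ul_block p p S) = ul_block p p S"
    using uc by (intro eq_matI) (auto simp: ul_block_index sym)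
  ultimately show "ul_block p p S \<in> pd_mats p" using uc by (auto simp: pd_mats_def sym_mats_def)
  have "0 < v \<bullet> (lr_block p p S *\<^sub>v v)" if v: "v \<in> carrier_vec q" "v \<noteq> 0\<^sub>v q" for v
  proof -
    let ?w = "0\<^sub>v p @\<^sub>v v"
    have w: "?w \<in> carrier_vec (p + q)" using v by simp
    obtain i where i: "i < q" "v $ i \<noteq> 0" using v by (metis carrier_vecD eq_vecI index_zero_vec)
    hence "?w $ (i + p) \<noteq> 0\<^sub>v (p + q) $ (i + p)" using v by simp
    hence "?w \<noteq> 0\<^sub>v (p + q)" by metis
    hence "0 < ?w \<bullet> (S *\<^sub>v ?w)" by (rule pd[OF w])
    also have "\<dots> = v \<bullet> (lr_block p p S *\<^sub>v v)"
      unfolding quadratic_form_sum[OF Sc w] quadratic_form_sum[OF lc v(1)]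
      using v by (simp add: sum_lessThan_add_split lr_block_index[OF Sc])
    finally show ?thesis .
  qed
  moreover have "transpose_mat (lr_block p p S) = lr_block p p S"
    using lc by (intro eq_matI) (auto simp: lr_block_index[OF Sc] sym)
  ultimately show "lr_block p p S \<in> pd_mats q" using lc by (auto simp: pd_mats_def sym_mats_def)
qed

text \<open>
  The quadratic form of \<open>S\<close> is at least \<open>a\<close> times the squared norm, with \<open>a\<close> below all eigenvalues,
  while the perturbation changes it by at most \<open>t N\<close> times the squared norm, with \<open>N\<close> the sum of the
  absolute entries of \<open>Ht t\<close>, which stays bounded.
\<close>
lemma eventually_pd_perturbation:
  assumes S: "S \<in> pd_mats n" and Ht: "\<And>t. t > 0 \<Longrightarrow> Ht t \<in> sym_mats n"
    and lim: "\<And>i j. i < n \<Longrightarrow> j < n \<Longrightarrow> ((\<lambda>t. Ht t $$ (i,j)) \<longlongrightarrow> H $$ (i,j)) (at_right 0)"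
  shows "\<forall>\<^sub>F t in at_right 0. S + t \<cdot>\<^sub>m Ht t \<in> pd_mats n"
proof -
  obtain U g where U: "orthogonal_matrix n U" and S_eq: "S = conj_diag n U g" and g: "\<And>i. i < n \<Longrightarrow> g i > 0"
    using pd_spectral[OF S] by metis
  have Uc: "U \<in> carrier_mat n n" using U by (auto simp: orthogonal_matrix_def)
  obtain a where a: "a > 0" "\<And>i. i < n \<Longrightarrow> a \<le> g i" using finite_positive_lower_bound[of n g] g by auto
  have Sc: "S \<in> carrier_mat n n" "transpose_mat S = S" using S by (auto simp: pd_mats_def sym_mats_def)
  define N where "N t = (\<Sum>i<n. \<Sum>j<n. \<bar>Ht t $$ (i,j)\<bar>)" for t
  have "((\<lambda>t. t * N t) \<longlongrightarrow> 0 * (\<Sum>i<n. \<Sum>j<n. \<bar>H $$ (i,j)\<bar>)) (at_right 0)"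
    unfolding N_def by (intro tendsto_intros lim) auto
  hence "((\<lambda>t. t * N t) \<longlongrightarrow> 0) (at_right 0)" by simp
  hence "\<forall>\<^sub>F t in at_right 0. t * N t < a" by (rule order_tendstoD(2)[OF _ a(1)])
  moreover have "\<forall>\<^sub>F t in at_right 0. (t::real) > 0" by (rule eventually_at_right_less)
  ultimately show ?thesis
  proof eventually_elim
    case (elim t)
    have Hc: "Ht t \<in> carrier_mat n n" "transpose_mat (Ht t) = Ht t" using Ht[OF elim(2)] by (auto simp: sym_mats_def)
    define T where "T = S + t \<cdot>\<^sub>m Ht t"
    have T: "T \<in> carrier_mat n n" using Sc Hc by (simp add: T_def)
    have smult_t: "transpose_mat (t \<cdot>\<^sub>m Ht t) = t \<cdot>\<^sub>m transpose_mat (Ht t)" by (intro eq_matI) auto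
    have Tt: "transpose_mat T = T" unfolding T_def using Sc Hc by (simp add: transpose_add[of _ n n] smult_t)
    have "0 < v \<bullet> (T *\<^sub>v v)" if v: "v \<in> carrier_vec n" "v \<noteq> 0\<^sub>v n" for v
    proof -
      define s where "s = (\<Sum>i<n. (v $ i)\<^sup>2)"
      obtain i where i: "i < n" "v $ i \<noteq> 0" using v by (metis carrier_vecD eq_vecI index_zero_vec)
      have s: "s > 0" unfolding s_def by (rule sum_pos2[of _ i]) (use i in auto)
      have entry: "\<bar>v $ i\<bar> * \<bar>v $ j\<bar> \<le> s" if "i < n" "j < n" for i j
      proof -
        have "(v $ k)\<^sup>2 \<le> s" if "k < n" for k unfolding s_def using that by (intro member_le_sum) auto
        hence "(v $ i)\<^sup>2 \<le> s" "(v $ j)\<^sup>2 \<le> s" using that by auto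
        moreover have "2 * (\<bar>v $ i\<bar> * \<bar>v $ j\<bar>) \<le> (v $ i)\<^sup>2 + (v $ j)\<^sup>2"
          using sum_squares_bound[of "\<bar>v $ i\<bar>" "\<bar>v $ j\<bar>"] by simp
        ultimately show ?thesis by linarith
      qed
      have "(\<Sum>k<n. ((transpose_mat U *\<^sub>v v) $ k)\<^sup>2) = v \<bullet> (1\<^sub>m n *\<^sub>v v)"
        using conj_diag_quadratic_form[OF Uc v(1), of "\<lambda>_. 1"] conj_diag_one[OF U] by simp
      also have "\<dots> = s" using v by (simp add: s_def scalar_prod_def lessThan_atLeast0 power2_eq_square)
      finally have norm: "(\<Sum>k<n. ((transpose_mat U *\<^sub>v v) $ k)\<^sup>2) = s" .
      have "a * s \<le> v \<bullet> (S *\<^sub>v v)"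
        unfolding S_eq conj_diag_quadratic_form[OF Uc v(1)] norm[symmetric] sum_distrib_left
        by (intro sum_mono mult_right_mono a) auto
      moreover have "v \<bullet> (T *\<^sub>v v) = v \<bullet> (S *\<^sub>v v) + (\<Sum>i<n. \<Sum>j<n. v $ i * (t * Ht t $$ (i,j)) * v $ j)"
        unfolding quadratic_form_sum[OF T v(1)] quadratic_form_sum[OF Sc(1) v(1)] sum.distrib[symmetric]
        using Sc Hc by (intro sum.cong refl) (auto simp: T_def algebra_simps)
      moreover have "\<bar>\<Sum>i<n. \<Sum>j<n. v $ i * (t * Ht t $$ (i,j)) * v $ j\<bar> \<le> t * N t * s"
      proof -
        have "\<bar>\<Sum>i<n. \<Sum>j<n. v $ i * (t * Ht t $$ (i,j)) * v $ j\<bar>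
          \<le> (\<Sum>i<n. \<Sum>j<n. \<bar>v $ i * (t * Ht t $$ (i,j)) * v $ j\<bar>)"
          by (rule order_trans[OF sum_abs]) (intro sum_mono sum_abs)
        also have "\<dots> \<le> (\<Sum>i<n. \<Sum>j<n. t * \<bar>Ht t $$ (i,j)\<bar> * s)"
        proof (intro sum_mono)
          fix i j assume "i \<in> {..<n}" "j \<in> {..<n}"
          hence "\<bar>v $ i\<bar> * \<bar>v $ j\<bar> \<le> s" using entry by auto
          hence "t * \<bar>Ht t $$ (i,j)\<bar> * (\<bar>v $ i\<bar> * \<bar>v $ j\<bar>) \<le> t * \<bar>Ht t $$ (i,j)\<bar> * s"
            using elim(2) by (intro mult_left_mono) auto
          thus "\<bar>v $ i * (t * Ht t $$ (i,j)) * v $ j\<bar> \<le> t * \<bar>Ht t $$ (i,j)\<bar> * s"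
            using elim(2) by (simp add: abs_mult mult_ac)
        qed
        also have "\<dots> = t * N t * s" by (simp add: N_def sum_distrib_left sum_distrib_right)
        finally show ?thesis .
      qed
      moreover have "t * N t * s < a * s" using elim(1) s by (rule mult_strict_right_mono)
      ultimately show ?thesis by linarith
    qed
    thus ?case using T Tt by (auto simp: T_def pd_mats_def sym_mats_def)
  qed
qed

lemma sqrt_right_derivative:
  fixes y :: "real \<Rightarrow> real"
  assumes a: "a > 0" and lim: "((\<lambda>t. (y t - a) / t) \<longlongrightarrow> d) (at_right 0)"
  shows "((\<lambda>t. (sqrt (y t) - sqrt a) / t) \<longlongrightarrow> d / (2 * sqrt a)) (at_right 0)"
proof -
  have pos: "\<forall>\<^sub>F t in at_right 0. (t::real) > 0" by (rule eventually_at_right_less)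
  have "((\<lambda>t. a + t * ((y t - a) / t)) \<longlongrightarrow> a + 0 * d) (at_right 0)" by (intro tendsto_intros lim)
  moreover have "\<forall>\<^sub>F t in at_right 0. a + t * ((y t - a) / t) = y t" using pos by eventually_elim simp
  ultimately have yl: "(y \<longlongrightarrow> a) (at_right 0)" by (simp add: Lim_transform_eventually)
  have "((\<lambda>t. ((y t - a) / t) / (sqrt (y t) + sqrt a)) \<longlongrightarrow> d / (sqrt a + sqrt a)) (at_right 0)"
    using a by (intro tendsto_intros lim yl) auto
  moreover have "\<forall>\<^sub>F t in at_right 0. ((y t - a) / t) / (sqrt (y t) + sqrt a) = (sqrt (y t) - sqrt a) / t"
    using pos order_tendstoD(1)[OF yl a]
  proof eventually_elim
    case (elim t)
    have "(sqrt (y t) - sqrt a) * (sqrt (y t) + sqrt a) = y t - a" using elim a by (simp add: algebra_simps)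
    moreover have "sqrt (y t) + sqrt a > 0" using elim a by (intro add_pos_pos) auto
    ultimately have "(y t - a) / (sqrt (y t) + sqrt a) = sqrt (y t) - sqrt a"
      by (metis less_irrefl nonzero_mult_div_cancel_right)
    thus ?case by (metis divide_divide_eq_left mult.commute)
  qed
  ultimately show ?thesis by (simp add: Lim_transform_eventually)
qed

lemma quotient_right_derivative:
  fixes x y :: "real \<Rightarrow> real"
  assumes b: "b \<noteq> 0" and xl: "((\<lambda>t. (x t - a) / t) \<longlongrightarrow> x') (at_right 0)"
    and yl: "((\<lambda>t. (y t - b) / t) \<longlongrightarrow> y') (at_right 0)"
  shows "((\<lambda>t. (x t / y t - a / b) / t) \<longlongrightarrow> (x' - a / b * y') / b) (at_right 0)"
proof -
  have pos: "\<forall>\<^sub>F t in at_right 0. (t::real) > 0" by (rule eventually_at_right_less)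
  have "((\<lambda>t. b + t * ((y t - b) / t)) \<longlongrightarrow> b + 0 * y') (at_right 0)" by (intro tendsto_intros yl)
  moreover have "\<forall>\<^sub>F t in at_right 0. b + t * ((y t - b) / t) = y t" using pos by eventually_elim simp
  ultimately have yb: "(y \<longlongrightarrow> b) (at_right 0)" by (simp add: Lim_transform_eventually)
  have "((\<lambda>t. ((x t - a) / t - a / b * ((y t - b) / t)) / y t) \<longlongrightarrow> (x' - a / b * y') / b) (at_right 0)"
    by (intro tendsto_intros xl yl yb b)
  moreover have "\<forall>\<^sub>F t in at_right 0. ((x t - a) / t - a / b * ((y t - b) / t)) / y t = (x t / y t - a / b) / t"
    using pos tendsto_imp_eventually_ne[OF yb b]
    by eventually_elim (use b in \<open>simp add: field_simps\<close>)
  ultimately show ?thesis by (rule Lim_transform_eventually)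
qed

lemma trace_conj_diag_mult:
  assumes U: "U \<in> carrier_mat n n" and H: "H \<in> carrier_mat n n"
  shows "mat_trace (conj_diag n U h * H) = (\<Sum>i<n. h i * (transpose_mat U * H * U) $$ (i,i))"
proof -
  have Ut: "transpose_mat U \<in> carrier_mat n n" using U by simp
  have "conj_diag n U h * H = U * (mat_diag n h * (transpose_mat U * H))"
    unfolding conj_diag_def using U Ut H by (simp add: assoc_mult_mat[of _ n n _ n _ n])
  hence "mat_trace (conj_diag n U h * H) = mat_trace (mat_diag n h * (transpose_mat U * H) * U)"
    using mat_trace_mult_comm[of U n n "mat_diag n h * (transpose_mat U * H)"] U Ut H by simp
  also have "mat_diag n h * (transpose_mat U * H) * U = mat_diag n h * (transpose_mat U * H * U)"
    using U Ut H by (simp add: assoc_mult_mat[of _ n n _ n _ n])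
  also have "mat_trace \<dots> = (\<Sum>i<n. h i * (transpose_mat U * H * U) $$ (i,i))"
  proof -
    have X: "transpose_mat U * H * U \<in> carrier_mat n n" using U Ut H by simp
    show ?thesis unfolding mat_diag_mult_left[OF X] by (simp add: mat_trace_def)
  qed
  finally show ?thesis .
qed

lemma trace_block_diagonal_mult:
  assumes A: "A \<in> carrier_mat p p" and B: "B \<in> carrier_mat q q" and H: "H \<in> carrier_mat (p + q) (p + q)"
  shows "mat_trace (four_block_mat A (0\<^sub>m p q) (0\<^sub>m q p) B * H)
    = mat_trace (A * ul_block p p H) + mat_trace (B * lr_block p p H)"
proof -
  have F: "four_block_mat A (0\<^sub>m p q) (0\<^sub>m q p) B \<in> carrier_mat (p + q) (p + q)" using A B by simp
  show ?thesis
    unfolding mat_trace_mult[OF F H] mat_trace_mult[OF A ul_block_carrier] mat_trace_mult[OF B lr_block_carrier[OF H]]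
    using A B by (simp add: sum_lessThan_add_split ul_block_index lr_block_index[OF H])
qed

text \<open>
  A block diagonal matrix is diagonalized by the block diagonal matrix of the two eigenbases.
\<close>
lemma mat_inv_sqrt_block_diagonal:
  assumes U1: "orthogonal_matrix p U1" and U2: "orthogonal_matrix q U2"
    and f1: "\<And>i. i < p \<Longrightarrow> f1 i > 0" and f2: "\<And>i. i < q \<Longrightarrow> f2 i > 0"
  shows "mat_inv_sqrt (four_block_mat (conj_diag p U1 f1) (0\<^sub>m p q) (0\<^sub>m q p) (conj_diag q U2 f2))
    = four_block_mat (mat_inv_sqrt (conj_diag p U1 f1)) (0\<^sub>m p q) (0\<^sub>m q p) (mat_inv_sqrt (conj_diag q U2 f2))"
proof -
  define U where "U = four_block_mat U1 (0\<^sub>m p q) (0\<^sub>m q p) U2"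
  have c: "U1 \<in> carrier_mat p p" "transpose_mat U1 \<in> carrier_mat p p" "U1 * transpose_mat U1 = 1\<^sub>m p" "transpose_mat U1 * U1 = 1\<^sub>m p"
    "U2 \<in> carrier_mat q q" "transpose_mat U2 \<in> carrier_mat q q" "U2 * transpose_mat U2 = 1\<^sub>m q" "transpose_mat U2 * U2 = 1\<^sub>m q"
    using U1 U2 by (auto simp: orthogonal_matrix_def)
  have Ut: "transpose_mat U = four_block_mat (transpose_mat U1) (0\<^sub>m p q) (0\<^sub>m q p) (transpose_mat U2)"
    unfolding U_def using c by (simp add: transpose_four_block_mat[of _ p p _ q _ q])
  have U: "orthogonal_matrix (p + q) U"
    unfolding orthogonal_matrix_def Ut unfolding U_def using c
    by (simp add: mult_four_block_mat[of _ p p _ q _ q _ _ p _ q])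
  have block: "conj_diag (p + q) U (\<lambda>i. if i < p then g1 i else g2 (i - p))
    = four_block_mat (conj_diag p U1 g1) (0\<^sub>m p q) (0\<^sub>m q p) (conj_diag q U2 g2)" for g1 g2
  proof -
    have "mat_diag (p + q) (\<lambda>i. if i < p then g1 i else g2 (i - p))
      = four_block_mat (mat_diag p g1) (0\<^sub>m p q) (0\<^sub>m q p) (mat_diag q g2)"
      by (intro eq_matI) (auto simp: mat_diag_def)
    thus ?thesis unfolding conj_diag_def Ut unfolding U_def using c
      by (simp add: mult_four_block_mat[of _ p p _ q _ q _ _ p _ q])
  qed
  have "mat_inv_sqrt (four_block_mat (conj_diag p U1 f1) (0\<^sub>m p q) (0\<^sub>m q p) (conj_diag q U2 f2))
    = conj_diag (p + q) U (\<lambda>i. 1 / sqrt (if i < p then f1 i else f2 (i - p)))"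
    unfolding block[symmetric] by (rule mat_inv_sqrt_conj_diag[OF U]) (use f1 f2 in auto)
  also have "\<dots> = conj_diag (p + q) U (\<lambda>i. if i < p then 1 / sqrt (f1 i) else 1 / sqrt (f2 (i - p)))"
    by (rule conj_diag_cong) simp
  also have "\<dots> = four_block_mat (conj_diag p U1 (\<lambda>i. 1 / sqrt (f1 i))) (0\<^sub>m p q) (0\<^sub>m q p)
    (conj_diag q U2 (\<lambda>i. 1 / sqrt (f2 i)))" by (rule block)
  finally show ?thesis
    by (simp add: mat_inv_sqrt_conj_diag[OF U1 f1] mat_inv_sqrt_conj_diag[OF U2 f2])
qed

lemma simple_spectrum_distinct:
  assumes e: "eigendecomposition n A U L" and card: "card (spectrum A) = n" and ij: "i < n" "j < n" "i \<noteq> j"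
  shows "L $$ (i,i) \<noteq> L $$ (j,j)"
proof -
  have "spectrum A = (\<lambda>i. L $$ (i,i)) ` {..<n}"
    using e unfolding eigendecomposition_def by (intro spectrum_eigendecomposition) auto
  hence "inj_on (\<lambda>i. L $$ (i,i)) {..<n}" using card by (intro eq_card_imp_inj_on) auto
  thus ?thesis using ij by (auto dest: inj_onD)
qed

lemma mat_inv_sqrt_mat_diag:
  assumes "\<And>i. i < n \<Longrightarrow> f i > 0"
  shows "mat_inv_sqrt (mat_diag n f) = mat_diag n (\<lambda>i. 1 / sqrt (f i))"
  using mat_inv_sqrt_conj_diag[OF orthogonal_one assms] by (simp add: conj_diag_one_eq)

lemma mat_sqrt_mat_diag:
  assumes "\<And>i. i < n \<Longrightarrow> f i \<ge> 0"
  shows "mat_sqrt (mat_diag n f) = mat_diag n (\<lambda>i. sqrt (f i))"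
  using mat_sqrt_conj_diag[OF orthogonal_one assms] by (simp add: conj_diag_one_eq)

lemma block_perturbation:
  assumes S: "S \<in> carrier_mat (p + q) (p + q)" and H: "H \<in> carrier_mat (p + q) (p + q)"
  shows "ul_block p p (S + t \<cdot>\<^sub>m H) = ul_block p p S + t \<cdot>\<^sub>m ul_block p p H"
    "lr_block p p (S + t \<cdot>\<^sub>m H) = lr_block p p S + t \<cdot>\<^sub>m lr_block p p H"
proof -
  have T: "S + t \<cdot>\<^sub>m H \<in> carrier_mat (p + q) (p + q)" using S H by simp
  show "ul_block p p (S + t \<cdot>\<^sub>m H) = ul_block p p S + t \<cdot>\<^sub>m ul_block p p H"
    using S H by (intro eq_matI) (auto simp: ul_block_index carrier_matD[OF ul_block_carrier])
  show "lr_block p p (S + t \<cdot>\<^sub>m H) = lr_block p p S + t \<cdot>\<^sub>m lr_block p p H"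
    using S H by (intro eq_matI) (auto simp: lr_block_index[OF T] lr_block_index[OF S] lr_block_index[OF H]
      carrier_matD[OF lr_block_carrier[OF T]] carrier_matD[OF lr_block_carrier[OF S]] carrier_matD[OF lr_block_carrier[OF H]])
qed

section \<open>The directional derivative of the coefficient\<close>

theorem theorem4p1:
  fixes p q :: nat
    and Sigma Sigma0 Sigma1 Sigma2 Sigma_m Psi_m P :: "real mat"
    and U1 L1 U2 L2 L21 L22 Delta1 Delta2 Upsilon1 M1 H :: "real mat"
    and Ht :: "real \<Rightarrow> real mat"
    and c1 :: real
  assumes "1 \<le> p" and "p \<le> q"
    and "Sigma \<in> pd_mats (p + q)"
    and "Sigma1 = ul_block p p Sigma" and "Sigma2 = lr_block p p Sigma"
    and "card (spectrum Sigma1) = p" and "card (spectrum Sigma2) = q"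
    and "eigendecomposition p Sigma1 U1 L1" and "eigendecomposition q Sigma2 U2 L2"
    and "Sigma0 = four_block_mat Sigma1 (0\<^sub>m p q) (0\<^sub>m q p) Sigma2"
    and "P = ul_block p q (1\<^sub>m (p + q))"
    and "Psi_m = U1 * mat_sqrt L1 * P * mat_sqrt L2 * transpose_mat U2"
    and "Sigma_m = four_block_mat Sigma1 Psi_m (transpose_mat Psi_m) Sigma2"
    and "L21 = ul_block p p L2" and "L22 = lr_block p p L2"
    and "Delta1 = mat_inv_sqrt (L1 + L21)"
    and "Delta2 = four_block_mat Delta1 (0\<^sub>m p (q - p)) (0\<^sub>m (q - p) p) (mat_inv_sqrt L22)"
    and "Upsilon1 = four_block_mat (U1 * Delta1 * transpose_mat U1) (0\<^sub>m p q)
                      (0\<^sub>m q p) (U2 * Delta2 * transpose_mat U2)"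
    and "c1 = mat_trace (mat_sqrt Sigma1) + mat_trace (mat_sqrt Sigma2)
                - mat_trace (mat_sqrt Sigma_m)"
    and "M1 = (1 / (2 * c1)) \<cdot>\<^sub>m
                (- mat_inv_sqrt Sigma + (1 - D1 p q Sigma) \<cdot>\<^sub>m mat_inv_sqrt Sigma0
                  + D1 p q Sigma \<cdot>\<^sub>m Upsilon1)"
    and "\<And>t. t > 0 \<Longrightarrow> Ht t \<in> sym_mats (p + q)"
    and "H \<in> sym_mats (p + q)"
    and "\<And>i j. i < p + q \<Longrightarrow> j < p + q \<Longrightarrow>
           ((\<lambda>t. Ht t $$ (i, j)) \<longlongrightarrow> H $$ (i, j)) (at_right 0)"
  shows "((\<lambda>t. inverse t * (D1 p q (Sigma + t \<cdot>\<^sub>m Ht t) - D1 p q Sigma))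
            \<longlongrightarrow> mat_trace (M1 * H)) (at_right 0)"
proof -
  note pq = assms(2) and Sp = assms(3) and S1_def = assms(4) and S2_def = assms(5)
  note simple_spectrum1 = assms(6) and simple_spectrum2 = assms(7) and e1 = assms(8) and e2 = assms(9)
  note Sigma0_def = assms(10) and P_def = assms(11) and Psi_m_def = assms(12) and Sigma_m_def = assms(13)
  note L21_def = assms(14) and L22_def = assms(15) and Delta1_def = assms(16) and Delta2_def = assms(17)
  note Upsilon1_def = assms(18) and c1_def = assms(19) and M1_def = assms(20)
  note Ht_sym = assms(21) and H_sym = assms(22) and lim = assms(23)
  have Sc: "Sigma \<in> carrier_mat (p + q) (p + q)" using Sp by (auto simp: pd_mats_def sym_mats_def)
  have Hc: "H \<in> carrier_mat (p + q) (p + q)" using H_sym by (auto simp: sym_mats_def)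
  have Htc: "Ht t \<in> carrier_mat (p + q) (p + q)" if "t > 0" for t
    using Ht_sym[OF that] by (auto simp: sym_mats_def)
  have S1p: "Sigma1 \<in> pd_mats p" and S2p: "Sigma2 \<in> pd_mats q"
    using pd_blocks[OF Sp] by (auto simp: S1_def S2_def)
  define f1 where "f1 i = (if i < p then L1 $$ (i,i) else 0)" for i
  define f2 where "f2 i = (if i < q then L2 $$ (i,i) else 0)" for i
  have spec1: "padded_spectrum p Sigma1 U1 f1"
    using eigendecomposition_padded_spectrum[OF e1 S1p] unfolding f1_def .
  have spec2: "padded_spectrum q Sigma2 U2 f2"
    using eigendecomposition_padded_spectrum[OF e2 S2p] unfolding f2_def .
  note s1 = padded_spectrumD[OF spec1] and s2 = padded_spectrumD[OF spec2]
  have simple1: "f1 i \<noteq> f1 j" if "i < p" "j < p" "i \<noteq> j" for i j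
    using simple_spectrum_distinct[OF e1 simple_spectrum1 that] that by (simp add: f1_def)
  have simple2: "f2 i \<noteq> f2 j" if "i < q" "j < q" "i \<noteq> j" for i j
    using simple_spectrum_distinct[OF e2 simple_spectrum2 that] that by (simp add: f2_def)
  have U1c: "U1 \<in> carrier_mat p p" and U2c: "U2 \<in> carrier_mat q q"
    using s1(1) s2(1) by (auto simp: orthogonal_matrix_def)
  have ypos: "f1 i + f2 i > 0" if "i < q" for i using s1(4)[of i] s2(5)[OF that] by simp

  define K1 where "K1 t = ul_block p p (Ht t)" for t
  define K2 where "K2 t = lr_block p p (Ht t)" for t
  define H1 where "H1 = ul_block p p H"
  define H2 where "H2 = lr_block p p H"
  have H1c: "H1 \<in> carrier_mat p p" unfolding H1_def by (rule ul_block_carrier)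
  have H2c: "H2 \<in> carrier_mat q q" unfolding H2_def by (rule lr_block_carrier[OF Hc])
  have K1c: "K1 t \<in> carrier_mat p p" for t unfolding K1_def by (rule ul_block_carrier)
  have K2c: "K2 t \<in> carrier_mat q q" if "t > 0" for t unfolding K2_def by (rule lr_block_carrier[OF Htc[OF that]])
  have pos: "\<forall>\<^sub>F t in at_right 0. (t::real) > 0" by (rule eventually_at_right_less)
  have K1lim: "((\<lambda>t. K1 t $$ (i,j)) \<longlongrightarrow> H1 $$ (i,j)) (at_right 0)" if "i < p" "j < p" for i j
    using lim[of i j] that by (simp add: K1_def H1_def ul_block_index)
  have K2lim: "((\<lambda>t. K2 t $$ (i,j)) \<longlongrightarrow> H2 $$ (i,j)) (at_right 0)" if "i < q" "j < q" for i j
  proof (rule Lim_transform_eventually)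
    show "((\<lambda>t. Ht t $$ (i + p,j + p)) \<longlongrightarrow> H2 $$ (i,j)) (at_right 0)"
      using lim[of "i + p" "j + p"] that by (simp add: H2_def lr_block_index[OF Hc])
    show "\<forall>\<^sub>F t in at_right 0. Ht t $$ (i + p,j + p) = K2 t $$ (i,j)"
      using pos by eventually_elim (use that in \<open>simp add: K2_def lr_block_index[OF Htc]\<close>)
  qed
  define St where "St t = Sigma + t \<cdot>\<^sub>m Ht t" for t
  have block1: "ul_block p p (St t) = Sigma1 + t \<cdot>\<^sub>m K1 t" if "t > 0" for t
    unfolding St_def S1_def K1_def by (rule block_perturbation(1)[OF Sc Htc[OF that]])
  have block2: "lr_block p p (St t) = Sigma2 + t \<cdot>\<^sub>m K2 t" if "t > 0" for t
    unfolding St_def S2_def K2_def by (rule block_perturbation(2)[OF Sc Htc[OF that]])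
  have evpd: "\<forall>\<^sub>F t in at_right 0. St t \<in> pd_mats (p + q)"
    unfolding St_def by (rule eventually_pd_perturbation[OF Sp Ht_sym lim])
  \<comment> \<open>The eigenbases of the perturbed blocks are chosen separately for each \<open>t\<close>.\<close>
  have "\<forall>t. \<exists>V g. St t \<in> pd_mats (p + q) \<longrightarrow> padded_spectrum p (ul_block p p (St t)) V g"
    using pd_padded_spectrum_exists[OF pd_blocks(1)] by blast
  then obtain V1 g1 where "\<And>t. St t \<in> pd_mats (p + q) \<Longrightarrow> padded_spectrum p (ul_block p p (St t)) (V1 t) (g1 t)"
    by metis
  note spec1t = this
  have "\<forall>t. \<exists>V g. St t \<in> pd_mats (p + q) \<longrightarrow> padded_spectrum q (lr_block p p (St t)) V g"
    using pd_padded_spectrum_exists[OF pd_blocks(2)] by blast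
  then obtain V2 g2 where "\<And>t. St t \<in> pd_mats (p + q) \<Longrightarrow> padded_spectrum q (lr_block p p (St t)) (V2 t) (g2 t)"
    by metis
  note spec2t = this

  \<comment> \<open>Beyond \<open>p\<close> the padded spectrum is constantly zero, and so is its derivative.\<close>
  define d1 where "d1 i = (if i < p then (transpose_mat U1 * H1 * U1) $$ (i,i) else 0)" for i
  define d2 where "d2 i = (transpose_mat U2 * H2 * U2) $$ (i,i)" for i
  have der1: "((\<lambda>t. (g1 t i - f1 i) / t) \<longlongrightarrow> d1 i) (at_right 0)" for i
  proof (cases "i < p")
    case True
    have "((\<lambda>t. (g1 t i - f1 i) / t) \<longlongrightarrow> (transpose_mat U1 * H1 * U1) $$ (i,i)) (at_right 0)"
    proof (rule simple_eigenvalue_derivative[OF s1(1,3,4) simple1 K1c H1c K1lim _ True, where V = V1])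
      show "\<forall>\<^sub>F t in at_right 0. orthogonal_matrix p (V1 t)
        \<and> conj_diag p U1 f1 + t \<cdot>\<^sub>m K1 t = conj_diag p (V1 t) (g1 t)
        \<and> (\<forall>i j. i \<le> j \<longrightarrow> g1 t j \<le> g1 t i) \<and> (\<forall>i. 0 \<le> g1 t i)"
        using evpd pos
      proof eventually_elim
        case (elim t)
        note s = padded_spectrumD[OF spec1t[OF elim(1)]]
        show ?case using s(1,3,4) s(2) block1[OF elim(2)] s1(2) by auto
      qed
    qed
    thus ?thesis using True by (simp add: d1_def)
  next
    case False
    have "\<forall>\<^sub>F t in at_right 0. 0 = (g1 t i - f1 i) / t"
      using evpd
    proof eventually_elim
      case (elim t)
      thus ?case using padded_spectrumD(6)[OF spec1t[OF elim]] s1(6) False by simp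
    qed
    thus ?thesis using False by (auto simp: d1_def intro: Lim_transform_eventually[OF tendsto_const])
  qed
  have der2: "((\<lambda>t. (g2 t i - f2 i) / t) \<longlongrightarrow> d2 i) (at_right 0)" if i: "i < q" for i
    unfolding d2_def
  proof (rule simple_eigenvalue_derivative[OF s2(1,3,4) simple2 K2c H2c K2lim _ i, where V = V2])
    show "\<forall>\<^sub>F t in at_right 0. orthogonal_matrix q (V2 t)
      \<and> conj_diag q U2 f2 + t \<cdot>\<^sub>m K2 t = conj_diag q (V2 t) (g2 t)
      \<and> (\<forall>i j. i \<le> j \<longrightarrow> g2 t j \<le> g2 t i) \<and> (\<forall>i. 0 \<le> g2 t i)"
      using evpd pos
    proof eventually_elim
      case (elim t)
      note s = padded_spectrumD[OF spec2t[OF elim(1)]]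
      show ?case using s(1,3,4) s(2) block2[OF elim(2)] s2(2) by auto
    qed
  qed
  define G where "G = (\<Sum>i<q. sqrt (f1 i + f2 i))"
  define Gt where "Gt t = (\<Sum>i<q. sqrt (g1 t i + g2 t i))" for t
  define dG where "dG = (\<Sum>i<q. (d1 i + d2 i) / (2 * sqrt (f1 i + f2 i)))"
  have derG: "((\<lambda>t. (Gt t - G) / t) \<longlongrightarrow> dG) (at_right 0)"
  proof -
    have "((\<lambda>t. (sqrt (g1 t i + g2 t i) - sqrt (f1 i + f2 i)) / t) \<longlongrightarrow> (d1 i + d2 i) / (2 * sqrt (f1 i + f2 i))) (at_right 0)"
      if i: "i < q" for i
    proof (rule sqrt_right_derivative[OF ypos[OF i]])
      have "((\<lambda>t. (g1 t i - f1 i) / t + (g2 t i - f2 i) / t) \<longlongrightarrow> d1 i + d2 i) (at_right 0)"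
        by (intro tendsto_add der1 der2 i)
      thus "((\<lambda>t. (g1 t i + g2 t i - (f1 i + f2 i)) / t) \<longlongrightarrow> d1 i + d2 i) (at_right 0)"
        by (simp add: add_divide_distrib[symmetric] algebra_simps)
    qed
    hence "((\<lambda>t. \<Sum>i<q. (sqrt (g1 t i + g2 t i) - sqrt (f1 i + f2 i)) / t) \<longlongrightarrow> dG) (at_right 0)"
      unfolding dG_def by (intro tendsto_sum) auto
    thus ?thesis by (simp add: G_def Gt_def sum_subtractf sum_divide_distrib[symmetric])
  qed

  let ?F = "\<lambda>A. mat_trace (mat_sqrt A)"
  define t0 where "t0 = mat_trace (mat_inv_sqrt Sigma * H)"
  define t1 where "t1 = mat_trace (mat_inv_sqrt Sigma1 * H1)"
  define t2 where "t2 = mat_trace (mat_inv_sqrt Sigma2 * H2)"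
  have derF: "((\<lambda>t. (?F (St t) - ?F Sigma) / t) \<longlongrightarrow> t0 / 2) (at_right 0)"
    unfolding t0_def St_def
    by (rule trace_sqrt_derivative[OF Sp Htc Hc _ lim])
       (use evpd in \<open>auto simp: St_def elim!: eventually_mono intro: pd_imp_psd\<close>)
  have "((\<lambda>t. (?F (Sigma1 + t \<cdot>\<^sub>m K1 t) - ?F Sigma1) / t) \<longlongrightarrow> t1 / 2) (at_right 0)"
    unfolding t1_def
  proof (rule trace_sqrt_derivative[OF S1p K1c H1c _ K1lim])
    show "\<forall>\<^sub>F t in at_right 0. Sigma1 + t \<cdot>\<^sub>m K1 t \<in> psd_mats p"
      using evpd pos by eventually_elim (metis block1 pd_blocks(1) pd_imp_psd)
  qed
  moreover have "\<forall>\<^sub>F t in at_right 0. (?F (Sigma1 + t \<cdot>\<^sub>m K1 t) - ?F Sigma1) / t = (?F (ul_block p p (St t)) - ?F Sigma1) / t"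
    using pos by eventually_elim (simp add: block1)
  ultimately have derF1: "((\<lambda>t. (?F (ul_block p p (St t)) - ?F Sigma1) / t) \<longlongrightarrow> t1 / 2) (at_right 0)"
    by (rule Lim_transform_eventually)
  have "((\<lambda>t. (?F (Sigma2 + t \<cdot>\<^sub>m K2 t) - ?F Sigma2) / t) \<longlongrightarrow> t2 / 2) (at_right 0)"
    unfolding t2_def
  proof (rule trace_sqrt_derivative[OF S2p K2c H2c _ K2lim])
    show "\<forall>\<^sub>F t in at_right 0. Sigma2 + t \<cdot>\<^sub>m K2 t \<in> psd_mats q"
      using evpd pos by eventually_elim (metis block2 pd_blocks(2) pd_imp_psd)
  qed
  moreover have "\<forall>\<^sub>F t in at_right 0. (?F (Sigma2 + t \<cdot>\<^sub>m K2 t) - ?F Sigma2) / t = (?F (lr_block p p (St t)) - ?F Sigma2) / t"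
    using pos by eventually_elim (simp add: block2)
  ultimately have derF2: "((\<lambda>t. (?F (lr_block p p (St t)) - ?F Sigma2) / t) \<longlongrightarrow> t2 / 2) (at_right 0)"
    by (rule Lim_transform_eventually)

  have L1: "L1 = mat_diag p f1"
    using eigendecomposition_conj_diag(3)[OF e1] mat_diag_cong[of p "\<lambda>i. L1 $$ (i,i)" f1] by (simp add: f1_def)
  have L2: "L2 = mat_diag q f2"
    using eigendecomposition_conj_diag(3)[OF e2] mat_diag_cong[of q "\<lambda>i. L2 $$ (i,i)" f2] by (simp add: f2_def)
  \<comment> \<open>The constant \<open>c1\<close> is the unperturbed denominator, by the attained bound.\<close>
  have Fm: "?F Sigma_m = G"
    unfolding G_def
  proof (rule comonotone_coupling(2)[OF pq s1(1) s2(1) s1(4,6) s2(5)])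
    have "mat_sqrt L1 = mat_diag p (\<lambda>i. sqrt (f1 i))" "mat_sqrt L2 = mat_diag q (\<lambda>i. sqrt (f2 i))"
      unfolding L1 L2 using s1(4) s2(4) by (auto intro: mat_sqrt_mat_diag)
    thus "Psi_m = U1 * mat_diag p (\<lambda>i. sqrt (f1 i)) * ul_block p q (1\<^sub>m (p + q)) * mat_diag q (\<lambda>i. sqrt (f2 i)) * transpose_mat U2"
      using P_def Psi_m_def by simp
    show "Sigma_m = four_block_mat (conj_diag p U1 f1) Psi_m (transpose_mat Psi_m) (conj_diag q U2 f2)"
      using Sigma_m_def s1(2) s2(2) by simp
  qed
  have c1: "c1 = ?F Sigma1 + ?F Sigma2 - G" using c1_def Fm by simp
  \<comment> \<open>Strict subadditivity of the square root at the largest eigenvalues makes the denominator positive.\<close>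
  have c1_pos: "c1 > 0"
  proof -
    have "?F Sigma1 = (\<Sum>i<p. sqrt (f1 i))"
      unfolding s1(2) using s1(4) by (simp add: mat_sqrt_conj_diag[OF s1(1)] conj_diag_trace[OF s1(1)])
    also have "\<dots> = (\<Sum>i<q. sqrt (f1 i))" using pq s1(6) by (intro sum.mono_neutral_left) auto
    finally have 1: "?F Sigma1 = (\<Sum>i<q. sqrt (f1 i))" .
    have 2: "?F Sigma2 = (\<Sum>i<q. sqrt (f2 i))"
      unfolding s2(2) using s2(4) by (simp add: mat_sqrt_conj_diag[OF s2(1)] conj_diag_trace[OF s2(1)])
    have "G < (\<Sum>i<q. sqrt (f1 i) + sqrt (f2 i))"
      unfolding G_def
    proof (rule sum_strict_mono_ex1)
      show "\<forall>i\<in>{..<q}. sqrt (f1 i + f2 i) \<le> sqrt (f1 i) + sqrt (f2 i)"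
        using sqrt_add_le_add_sqrt s1(4) s2(4) by blast
      have "f1 0 > 0" "f2 0 > 0" using s1(5) s2(5) assms(1) pq by auto
      hence "sqrt (f1 0 + f2 0) < sqrt (f1 0) + sqrt (f2 0)"
        by (intro real_less_lsqrt) (auto simp: power2_sum)
      thus "\<exists>i\<in>{..<q}. sqrt (f1 i + f2 i) < sqrt (f1 i) + sqrt (f2 i)" using assms(1) pq by (intro bexI[of _ 0]) auto
    qed simp
    thus ?thesis unfolding c1 1 2 by (simp add: sum.distrib)
  qed
  have D1_S: "D1 p q Sigma = (?F Sigma1 + ?F Sigma2 - ?F Sigma) / c1"
    unfolding c1 G_def
    using D1_eq_trace_sqrt_quotient[OF pq pd_imp_psd[OF Sp], of U1 f1 U2 f2] spec1 spec2 S1_def S2_def by simp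
  have D1_St: "\<forall>\<^sub>F t in at_right 0. (?F (ul_block p p (St t)) + ?F (lr_block p p (St t)) - ?F (St t)) /
      (?F (ul_block p p (St t)) + ?F (lr_block p p (St t)) - Gt t) = D1 p q (St t)"
    using evpd
  proof eventually_elim
    case (elim t)
    show ?case unfolding Gt_def
      by (rule D1_eq_trace_sqrt_quotient[OF pq pd_imp_psd[OF elim] spec1t[OF elim] spec2t[OF elim], symmetric])
  qed
  have "((\<lambda>t. ((?F (ul_block p p (St t)) + ?F (lr_block p p (St t)) - ?F (St t)) /
      (?F (ul_block p p (St t)) + ?F (lr_block p p (St t)) - Gt t) - (?F Sigma1 + ?F Sigma2 - ?F Sigma) / c1) / t)
    \<longlongrightarrow> ((t1 / 2 + t2 / 2 - t0 / 2) - (?F Sigma1 + ?F Sigma2 - ?F Sigma) / c1 * (t1 / 2 + t2 / 2 - dG)) / c1) (at_right 0)"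
  proof (rule quotient_right_derivative)
    show "c1 \<noteq> 0" using c1_pos by simp
    have "((\<lambda>t. (?F (ul_block p p (St t)) - ?F Sigma1) / t + (?F (lr_block p p (St t)) - ?F Sigma2) / t - (?F (St t) - ?F Sigma) / t)
      \<longlongrightarrow> t1 / 2 + t2 / 2 - t0 / 2) (at_right 0)"
      by (intro tendsto_intros derF derF1 derF2)
    thus "((\<lambda>t. (?F (ul_block p p (St t)) + ?F (lr_block p p (St t)) - ?F (St t) - (?F Sigma1 + ?F Sigma2 - ?F Sigma)) / t)
      \<longlongrightarrow> t1 / 2 + t2 / 2 - t0 / 2) (at_right 0)"
      by (simp add: diff_divide_distrib add_divide_distrib algebra_simps)
    have "((\<lambda>t. (?F (ul_block p p (St t)) - ?F Sigma1) / t + (?F (lr_block p p (St t)) - ?F Sigma2) / t - (Gt t - G) / t)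
      \<longlongrightarrow> t1 / 2 + t2 / 2 - dG) (at_right 0)"
      by (intro tendsto_intros derG derF1 derF2)
    thus "((\<lambda>t. (?F (ul_block p p (St t)) + ?F (lr_block p p (St t)) - Gt t - c1) / t)
      \<longlongrightarrow> t1 / 2 + t2 / 2 - dG) (at_right 0)"
      unfolding c1 by (simp add: diff_divide_distrib add_divide_distrib algebra_simps)
  qed
  moreover have "\<forall>\<^sub>F t in at_right 0. ((?F (ul_block p p (St t)) + ?F (lr_block p p (St t)) - ?F (St t)) /
      (?F (ul_block p p (St t)) + ?F (lr_block p p (St t)) - Gt t) - (?F Sigma1 + ?F Sigma2 - ?F Sigma) / c1) / t
    = inverse t * (D1 p q (Sigma + t \<cdot>\<^sub>m Ht t) - D1 p q Sigma)"
    using D1_St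
  proof eventually_elim
    case (elim t)
    show ?case unfolding elim D1_S[symmetric] St_def[symmetric] by (simp add: divide_inverse_commute)
  qed
  ultimately have main: "((\<lambda>t. inverse t * (D1 p q (Sigma + t \<cdot>\<^sub>m Ht t) - D1 p q Sigma))
    \<longlongrightarrow> ((t1 / 2 + t2 / 2 - t0 / 2) - D1 p q Sigma * (t1 / 2 + t2 / 2 - dG)) / c1) (at_right 0)"
    unfolding D1_S[symmetric] by (rule Lim_transform_eventually)

  have inv1: "mat_inv_sqrt Sigma1 = conj_diag p U1 (\<lambda>i. 1 / sqrt (f1 i))"
    using mat_inv_sqrt_conj_diag[OF s1(1,5)] s1(2) by simp
  have inv2: "mat_inv_sqrt Sigma2 = conj_diag q U2 (\<lambda>i. 1 / sqrt (f2 i))"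
    using mat_inv_sqrt_conj_diag[OF s2(1,5)] s2(2) by simp
  have inv1c: "mat_inv_sqrt Sigma1 \<in> carrier_mat p p" and inv2c: "mat_inv_sqrt Sigma2 \<in> carrier_mat q q"
    unfolding inv1 inv2 using U1c U2c by simp_all
  have inv0: "mat_inv_sqrt Sigma0 = four_block_mat (mat_inv_sqrt Sigma1) (0\<^sub>m p q) (0\<^sub>m q p) (mat_inv_sqrt Sigma2)"
    using mat_inv_sqrt_block_diagonal[OF s1(1) s2(1) s1(5) s2(5)] Sigma0_def s1(2) s2(2) by simp
  have tr0: "mat_trace (mat_inv_sqrt Sigma0 * H) = t1 + t2"
    unfolding inv0 trace_block_diagonal_mult[OF inv1c inv2c Hc] t1_def t2_def H1_def H2_def ..
  have Delta1: "Delta1 = mat_diag p (\<lambda>i. 1 / sqrt (f1 i + f2 i))"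
  proof -
    have "L21 = mat_diag p f2"
      unfolding L21_def L2 using pq
      by (intro eq_matI) (auto simp: ul_block_index carrier_matD[OF ul_block_carrier] mat_diag_def)
    hence "L1 + L21 = mat_diag p (\<lambda>i. f1 i + f2 i)"
      unfolding L1 by (intro eq_matI) (auto simp: mat_diag_def)
    thus ?thesis unfolding Delta1_def using ypos pq by (simp add: mat_inv_sqrt_mat_diag)
  qed
  have Delta2: "Delta2 = mat_diag q (\<lambda>i. 1 / sqrt (f1 i + f2 i))"
  proof -
    have L2c: "mat_diag q f2 \<in> carrier_mat (p + (q - p)) (p + (q - p))" using pq by simp
    have L22_index: "lr_block p p (mat_diag q f2) $$ (i,j) = (if i = j then f2 (i + p) else 0)"
      if "i < q - p" "j < q - p" for i j
      unfolding lr_block_index[OF L2c that] using that by (simp add: mat_diag_def)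
    have "L22 = mat_diag (q - p) (\<lambda>i. f2 (i + p))"
      unfolding L22_def L2
    proof (rule eq_matI)
      fix i j assume "i < dim_row (mat_diag (q - p) (\<lambda>i. f2 (i + p)))" "j < dim_col (mat_diag (q - p) (\<lambda>i. f2 (i + p)))"
      thus "lr_block p p (mat_diag q f2) $$ (i,j) = mat_diag (q - p) (\<lambda>i. f2 (i + p)) $$ (i,j)"
        by (simp add: L22_index) (simp add: mat_diag_def)
    qed (use lr_block_carrier[OF L2c] in auto)
    hence "mat_inv_sqrt L22 = mat_diag (q - p) (\<lambda>i. 1 / sqrt (f2 (i + p)))"
      using s2(5) by (simp add: mat_inv_sqrt_mat_diag)
    thus ?thesis unfolding Delta2_def Delta1 using pq s1(6)
      by (intro eq_matI) (auto simp: mat_diag_def)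
  qed
  have Ups: "Upsilon1 = four_block_mat (conj_diag p U1 (\<lambda>i. 1 / sqrt (f1 i + f2 i))) (0\<^sub>m p q) (0\<^sub>m q p)
      (conj_diag q U2 (\<lambda>i. 1 / sqrt (f1 i + f2 i)))"
    unfolding Upsilon1_def Delta1 Delta2 conj_diag_def ..
  \<comment> \<open>The matrix \<open>Upsilon1\<close> represents twice the derivative of the smallest trace.\<close>
  have trU: "mat_trace (Upsilon1 * H) = 2 * dG"
  proof -
    have "mat_trace (Upsilon1 * H) = (\<Sum>i<p. 1 / sqrt (f1 i + f2 i) * d1 i) + (\<Sum>i<q. 1 / sqrt (f1 i + f2 i) * d2 i)"
      unfolding Ups trace_block_diagonal_mult[OF conj_diag_carrier[OF U1c] conj_diag_carrier[OF U2c] Hc]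
        H1_def[symmetric] H2_def[symmetric] trace_conj_diag_mult[OF U1c H1c] trace_conj_diag_mult[OF U2c H2c]
      by (simp add: d1_def d2_def)
    also have "(\<Sum>i<p. 1 / sqrt (f1 i + f2 i) * d1 i) = (\<Sum>i<q. 1 / sqrt (f1 i + f2 i) * d1 i)"
      using pq by (intro sum.mono_neutral_left) (auto simp: d1_def)
    also have "\<dots> + (\<Sum>i<q. 1 / sqrt (f1 i + f2 i) * d2 i) = 2 * dG"
      unfolding dG_def sum_distrib_left sum.distrib[symmetric] by (intro sum.cong refl) (simp add: add_divide_distrib)
    finally show ?thesis .
  qed
  obtain U g where U: "orthogonal_matrix (p + q) U" "Sigma = conj_diag (p + q) U g" "\<And>i. i < p + q \<Longrightarrow> g i > 0"
    using pd_spectral[OF Sp] by metis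
  have invc: "mat_inv_sqrt Sigma \<in> carrier_mat (p + q) (p + q)"
    unfolding U(2) using U(1,3) by (simp add: mat_inv_sqrt_conj_diag orthogonal_matrix_def)
  have inv0c: "mat_inv_sqrt Sigma0 \<in> carrier_mat (p + q) (p + q)"
    unfolding inv0 using inv1c inv2c by simp
  have Upsc: "Upsilon1 \<in> carrier_mat (p + q) (p + q)"
    unfolding Ups using U1c U2c by simp
  have uminus_eq: "- mat_inv_sqrt Sigma = (-1) \<cdot>\<^sub>m mat_inv_sqrt Sigma" by (intro eq_matI) auto
  let ?n = "p + q"
  have "mat_trace (M1 * H) = 1 / (2 * c1) * (- t0 + (1 - D1 p q Sigma) * (t1 + t2) + D1 p q Sigma * (2 * dG))"
    unfolding M1_def uminus_eq t0_def tr0[symmetric] trU[symmetric] using invc inv0c Upsc Hc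
    by (simp add: mult_smult_assoc_mat[of _ ?n ?n _ ?n] add_mult_distrib_mat[of _ ?n ?n _ _ ?n]
        mat_trace_smult[of _ ?n] mat_trace_add[of _ ?n])
  also have "\<dots> = ((t1 / 2 + t2 / 2 - t0 / 2) - D1 p q Sigma * (t1 / 2 + t2 / 2 - dG)) / c1"
    using c1_pos by (simp add: field_simps)
  finally show ?thesis using main by simp
qed

end
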